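(* There exist an infinite-dimensional separable complex Hilbert space $X$, an operator $T\in\mathcal L(X)$, and a $T$-invariant Gaussian measure $\mu$ on $X$ with full support such that the corresponding measure preserving system $\mathbf X=(X,\mathcal B,\mu,T)$ is mildly mixing but not strongly mixing.
   Context: $\mathcal L(X)$ is the space of bounded linear operators on $X$, and $\mathcal B$ is the Borel $\sigma$-algebra. A Gaussian measure on $X$ is a Borel probability measure such that every continuous linear functional, viewed as a random variable, has a symmetric complex Gaussian distribution (real and imaginary parts are independent centered Gaussians of equal variance, possibly $0$). With $U_Tf=f\circ T$ the Koopman operator on $L_2(X,\mu)$, the system is mildly mixing if $\limsup_{|n|\to\infty}|\langle U_T^nf,f\rangle|<1$ for every $f\in L_2(\mu)$ with $\int f\,d\mu=0$ and $\|f\|=1$; equivalently, it admits no nontrivial rigid factor, where a system $(Y,\mathcal C,\nu,S)$ is rigid if there is $n_k\nearrow\infty$ with $\nu(S^{-n_k}A\,\triangle\,A)\to0$ for all $A\in\mathcal C$. (For $n<0$, $\langle U_T^nf,f\rangle$ is understood as $\overline{\langle U_T^{-n}f,f\rangle}$.) Strongly mixing means $\mu(T^{-n}A\cap B)\to\mu(A)\mu(B)$ for all $A,B\in\mathcal B$. *)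

theory Defs
  imports "HOL-Probability.Probability" "HOL-Algebra.Module"
begin

section \<open>Complex Hilbert spaces\<close>

definition complex_field :: "complex ring" where
  "complex_field = \<lparr>carrier = UNIV, mult = (*), one = 1, zero = 0, add = (+)\<rparr>"

text \<open>
  Vector spaces are carrier-based, as in HOL-Algebra, so that a theorem can quantify
  existentially over them. For separable Hilbert spaces any carrier type of the cardinality of the
  continuum, such as \<open>nat \<Rightarrow> complex\<close>, suffices up to isomorphism. The multiplicative fields \<open>mult\<close> and \<open>one\<close> that the library's module
  record inherits from rings play no role, as in the library's locale \<open>module\<close>.
\<close>

record 'b complex_space = "(complex, 'b) module" +
  cinner :: "'b \<Rightarrow> 'b \<Rightarrow> complex"

definition cnorm :: "('b, 'm) complex_space_scheme \<Rightarrow> 'b \<Rightarrow> real" where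
  "cnorm X x = sqrt (Re (cinner X x x))"

text \<open>The value \<open>0\<close> off the carrier is needed because the locale \<open>Metric_space\<close> asks for
  non-negativity and symmetry on the whole type.\<close>

definition cdist :: "('b, 'm) complex_space_scheme \<Rightarrow> 'b \<Rightarrow> 'b \<Rightarrow> real" where
  "cdist X x y = (if x \<in> carrier X \<and> y \<in> carrier X then cnorm X (x \<ominus>\<^bsub>X\<^esub> y) else 0)"

definition norm_topology :: "('b, 'm) complex_space_scheme \<Rightarrow> 'b topology" where
  "norm_topology X = Metric_space.mtopology (carrier X) (cdist X)"

locale complex_inner_space = module complex_field X for X (structure) +
  assumes cinner_add_left:
      "\<lbrakk>x \<in> carrier X; y \<in> carrier X; z \<in> carrier X\<rbrakk> \<Longrightarrow>
       cinner X (x \<oplus> y) z = cinner X x z + cinner X y z"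
    and cinner_smult_left:
      "\<lbrakk>x \<in> carrier X; y \<in> carrier X\<rbrakk> \<Longrightarrow> cinner X (a \<odot> x) y = a * cinner X x y"
    and cinner_commute:
      "\<lbrakk>x \<in> carrier X; y \<in> carrier X\<rbrakk> \<Longrightarrow> cinner X x y = cnj (cinner X y x)"
    and cinner_pos: "\<lbrakk>x \<in> carrier X; x \<noteq> \<zero>\<rbrakk> \<Longrightarrow> 0 < Re (cinner X x x)"

context complex_inner_space
begin

lemma cinner_minus_left:
  assumes "x \<in> carrier X" "y \<in> carrier X" "z \<in> carrier X"
  shows "cinner X (x \<ominus> y) z = cinner X x z - cinner X y z"
proof -
  have "(x \<ominus> y) \<oplus> y = x"
    using assms by (simp add: M.minus_eq M.a_assoc M.l_neg)
  then show ?thesis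
    using cinner_add_left[of "x \<ominus> y" y z] assms by simp
qed

lemma cinner_zero_left: "z \<in> carrier X \<Longrightarrow> cinner X \<zero> z = 0"
  using cinner_add_left[of \<zero> \<zero> z] by simp

lemma cinner_nonneg: "x \<in> carrier X \<Longrightarrow> 0 \<le> Re (cinner X x x)"
  using cinner_pos[of x] cinner_zero_left[of x] by (cases "x = \<zero>") auto

lemma cinner_add_self:
  assumes x: "x \<in> carrier X" and y: "y \<in> carrier X"
  shows "Re (cinner X (x \<oplus> y) (x \<oplus> y)) =
    Re (cinner X x x) + 2 * Re (cinner X x y) + Re (cinner X y y)"
proof -
  have xy: "x \<oplus> y \<in> carrier X" using x y by simp
  have "cinner X x (x \<oplus> y) = cnj (cinner X x x + cinner X y x)"
    using cinner_commute[OF x xy] cinner_add_left[OF x y x] by simp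
  moreover have "cinner X y (x \<oplus> y) = cnj (cinner X x y + cinner X y y)"
    using cinner_commute[OF y xy] cinner_add_left[OF x y y] by simp
  moreover have "Re (cinner X y x) = Re (cinner X x y)"
    using cinner_commute[OF x y] by simp
  ultimately show ?thesis using cinner_add_left[OF x y xy] by simp
qed

lemma cnorm_triangle:
  assumes x: "x \<in> carrier X" and y: "y \<in> carrier X"
  shows "cnorm X (x \<oplus> y) \<le> cnorm X x + cnorm X y"
proof -
  have quad: "0 \<le> t\<^sup>2 * Re (cinner X x x) + 2 * t * Re (cinner X x y) + Re (cinner X y y)" for t :: real
  proof -
    let ?a = "complex_of_real t"
    have ax: "?a \<odot> x \<in> carrier X" using x by (simp add: complex_field_def)
    have "cinner X (?a \<odot> x) (?a \<odot> x) = ?a * cnj (?a * cinner X x x)"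
      using cinner_smult_left[OF x ax, of ?a] cinner_commute[OF x ax] cinner_smult_left[OF x x, of ?a] by simp
    then show ?thesis
      using cinner_nonneg[of "?a \<odot> x \<oplus> y"] cinner_add_self[OF ax y] cinner_smult_left[OF x y, of ?a] ax y
      by (simp add: power2_eq_square)
  qed
  define p where "p = Re (cinner X x x)"
  define q where "q = Re (cinner X y y)"
  define r where "r = Re (cinner X x y)"
  have pq: "0 \<le> p" "0 \<le> q" using cinner_nonneg x y by (auto simp: p_def q_def)
  have "r\<^sup>2 \<le> p * q"
  proof (cases "x = \<zero>")
    case True
    then show ?thesis using cinner_zero_left[OF y] pq by (simp add: r_def)
  next
    case False
    then have p: "0 < p" using cinner_pos x by (simp add: p_def)
    have "0 \<le> (- r / p)\<^sup>2 * p + 2 * (- r / p) * r + q"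
      using quad[of "- r / p"] by (simp add: p_def q_def r_def)
    also have "\<dots> = q - r\<^sup>2 / p" using p by (simp add: power2_eq_square field_simps)
    finally show ?thesis using p by (simp add: field_simps)
  qed
  then have r: "r \<le> sqrt p * sqrt q"
    using real_le_rsqrt[of r "p * q"] by (simp add: real_sqrt_mult)
  have "p + 2 * r + q \<le> (sqrt p + sqrt q)\<^sup>2"
    using r pq by (simp add: power2_sum)
  then show ?thesis
    unfolding cnorm_def cinner_add_self[OF x y] p_def[symmetric] q_def[symmetric] r_def[symmetric]
    using pq by (intro real_le_lsqrt) auto
qed

sublocale Metric_space "carrier X" "cdist X"
proof
  show "0 \<le> cdist X x y" for x y
    by (auto simp: cdist_def cnorm_def intro!: cinner_nonneg)
  have minus: "cinner X (x \<ominus> y) (x \<ominus> y) = cinner X (y \<ominus> x) (y \<ominus> x)"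
    if x: "x \<in> carrier X" and y: "y \<in> carrier X" for x y
  proof -
    have c: "x \<ominus> y \<in> carrier X" "y \<ominus> x \<in> carrier X" using x y by auto
    have d: "cinner X (x \<ominus> y) z = - cinner X (y \<ominus> x) z" if "z \<in> carrier X" for z
      using that x y by (simp add: cinner_minus_left)
    have "cinner X (x \<ominus> y) (x \<ominus> y) = - cinner X (y \<ominus> x) (x \<ominus> y)"
      using d[OF c(1)] .
    also have "\<dots> = - cnj (cinner X (x \<ominus> y) (y \<ominus> x))"
      by (simp only: cinner_commute[OF c(2) c(1)])
    also have "\<dots> = cnj (cinner X (y \<ominus> x) (y \<ominus> x))"
      unfolding d[OF c(2)] by simp
    also have "\<dots> = cinner X (y \<ominus> x) (y \<ominus> x)"
      using cinner_commute[OF c(2) c(2)] by (rule sym)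
    finally show ?thesis .
  qed
  show "cdist X x y = cdist X y x" for x y
    using minus[of x y] by (auto simp: cdist_def cnorm_def)
  show "cdist X x y = 0 \<longleftrightarrow> x = y" if "x \<in> carrier X" "y \<in> carrier X" for x y
  proof -
    have "cnorm X z = 0 \<longleftrightarrow> z = \<zero>" if "z \<in> carrier X" for z
      using that cinner_pos[of z] cinner_zero_left[of z] by (fastforce simp: cnorm_def)
    moreover have "x \<ominus> y = \<zero> \<longleftrightarrow> x = y"
      using that M.minus_equality[of x "\<ominus> y"] by (auto simp: M.minus_eq M.r_neg)
    ultimately show ?thesis using that by (simp add: cdist_def)
  qed
  show "cdist X x z \<le> cdist X x y + cdist X y z"
    if "x \<in> carrier X" "y \<in> carrier X" "z \<in> carrier X" for x y z
  proof -
    have "(x \<ominus> y) \<oplus> (y \<ominus> z) = x \<ominus> z"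
      using that by (simp add: M.minus_eq M.a_assoc M.r_neg2 M.r_neg1)
    then show ?thesis using that cnorm_triangle[of "x \<ominus> y" "y \<ominus> z"] by (simp add: cdist_def)
  qed
qed

end

locale complex_hilbert_space = complex_inner_space +
  assumes complete: mcomplete

definition infinite_dimensional :: "('b, 'm) complex_space_scheme \<Rightarrow> bool" where
  "infinite_dimensional X \<longleftrightarrow>
     (\<nexists>S. finite S \<and> S \<subseteq> carrier X \<and>
        (\<forall>x\<in>carrier X. \<exists>c. x = finsum X (\<lambda>s. c s \<odot>\<^bsub>X\<^esub> s) S))"

definition bounded_operators :: "('b, 'm) complex_space_scheme \<Rightarrow> ('b \<Rightarrow> 'b) set" where
  "bounded_operators X = {T \<in> carrier X \<rightarrow> carrier X.
     (\<forall>x\<in>carrier X. \<forall>y\<in>carrier X. T (x \<oplus>\<^bsub>X\<^esub> y) = T x \<oplus>\<^bsub>X\<^esub> T y) \<and>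
     (\<forall>a. \<forall>x\<in>carrier X. T (a \<odot>\<^bsub>X\<^esub> x) = a \<odot>\<^bsub>X\<^esub> T x) \<and>
     (\<exists>K. \<forall>x\<in>carrier X. cnorm X (T x) \<le> K * cnorm X x)}"

definition continuous_functionals :: "('b, 'm) complex_space_scheme \<Rightarrow> ('b \<Rightarrow> complex) set" where
  "continuous_functionals X = {\<phi>.
     (\<forall>x\<in>carrier X. \<forall>y\<in>carrier X. \<phi> (x \<oplus>\<^bsub>X\<^esub> y) = \<phi> x + \<phi> y) \<and>
     (\<forall>a. \<forall>x\<in>carrier X. \<phi> (a \<odot>\<^bsub>X\<^esub> x) = a * \<phi> x) \<and>
     continuous_map (norm_topology X) euclidean \<phi>}"

definition borel_on :: "('b, 'm) complex_space_scheme \<Rightarrow> 'b measure" where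
  "borel_on X = sigma (carrier X) {U. openin (norm_topology X) U}"


section \<open>Gaussian measures\<close>

definition centered_gaussian :: "real \<Rightarrow> real measure" where
  "centered_gaussian \<sigma> =
     (if \<sigma> = 0 then return borel 0 else density lborel (\<lambda>x. ennreal (normal_density 0 \<sigma> x)))"

definition symmetric_complex_gaussian :: "'a measure \<Rightarrow> ('a \<Rightarrow> complex) \<Rightarrow> bool" where
  "symmetric_complex_gaussian M Z \<longleftrightarrow>
     Z \<in> borel_measurable M \<and>
     prob_space.indep_var M borel (\<lambda>x. Re (Z x)) borel (\<lambda>x. Im (Z x)) \<and>
     (\<exists>\<sigma>\<ge>0. distr M borel (\<lambda>x. Re (Z x)) = centered_gaussian \<sigma> \<and>
            distr M borel (\<lambda>x. Im (Z x)) = centered_gaussian \<sigma>)"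

definition gaussian_measure :: "('b, 'm) complex_space_scheme \<Rightarrow> 'b measure \<Rightarrow> bool" where
  "gaussian_measure X \<mu> \<longleftrightarrow>
     prob_space \<mu> \<and> space \<mu> = carrier X \<and> sets \<mu> = sets (borel_on X) \<and>
     (\<forall>\<phi>\<in>continuous_functionals X. symmetric_complex_gaussian \<mu> \<phi>)"

definition full_support :: "('b, 'm) complex_space_scheme \<Rightarrow> 'b measure \<Rightarrow> bool" where
  "full_support X \<mu> \<longleftrightarrow> (\<forall>U. openin (norm_topology X) U \<and> U \<noteq> {} \<longrightarrow> 0 < emeasure \<mu> U)"


section \<open>Measure-preserving systems and mixing\<close>

definition invariant_measure :: "'a measure \<Rightarrow> ('a \<Rightarrow> 'a) \<Rightarrow> bool" where
  "invariant_measure M T \<longleftrightarrow> T \<in> M \<rightarrow>\<^sub>M M \<and> distr M M T = M"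

text \<open>Elements of \<open>L\<^sub>2\<close> are handled through their square-integrable representatives.\<close>

definition square_integrable :: "'a measure \<Rightarrow> ('a \<Rightarrow> complex) set" where
  "square_integrable M = {f \<in> borel_measurable M. integrable M (\<lambda>x. (cmod (f x))\<^sup>2)}"

definition l2_inner :: "'a measure \<Rightarrow> ('a \<Rightarrow> complex) \<Rightarrow> ('a \<Rightarrow> complex) \<Rightarrow> complex" where
  "l2_inner M f g = (LINT x|M. f x * cnj (g x))"

definition l2_norm :: "'a measure \<Rightarrow> ('a \<Rightarrow> complex) \<Rightarrow> real" where
  "l2_norm M f = sqrt (Re (l2_inner M f f))"

definition koopman :: "('a \<Rightarrow> 'a) \<Rightarrow> ('a \<Rightarrow> complex) \<Rightarrow> ('a \<Rightarrow> complex)" where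
  "koopman T f = f \<circ> T"

definition koopman_correlation :: "'a measure \<Rightarrow> ('a \<Rightarrow> 'a) \<Rightarrow> ('a \<Rightarrow> complex) \<Rightarrow> int \<Rightarrow> complex" where
  "koopman_correlation M T f n =
     (if 0 \<le> n then l2_inner M ((koopman T ^^ nat n) f) f
      else cnj (l2_inner M ((koopman T ^^ nat (- n)) f) f))"

definition mildly_mixing :: "'a measure \<Rightarrow> ('a \<Rightarrow> 'a) \<Rightarrow> bool" where
  "mildly_mixing M T \<longleftrightarrow>
     (\<forall>f\<in>square_integrable M. (LINT x|M. f x) = 0 \<and> l2_norm M f = 1 \<longrightarrow>
        Limsup (filtercomap abs at_top) (\<lambda>n. ereal (cmod (koopman_correlation M T f n))) < 1)"

definition strongly_mixing :: "'a measure \<Rightarrow> ('a \<Rightarrow> 'a) \<Rightarrow> bool" where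
  "strongly_mixing M T \<longleftrightarrow>
     (\<forall>A\<in>sets M. \<forall>B\<in>sets M.
        (\<lambda>n. measure M (((T ^^ n) -` A \<inter> space M) \<inter> B)) \<longlonglongrightarrow> measure M A * measure M B)"

end

theory Submission
  imports Defs
begin

text \<open>
  Let \<open>X\<close> be \<open>\<ell>\<^sup>2\<close> with weights \<open>2\<^sup>-\<^sup>n\<close>, \<open>T\<close> the backward shift and \<open>\<mu>\<close> the law of a stationary complex
  Gaussian sequence with covariance \<open>\<kappa>(n - m) + [n = m]\<close>, where \<open>\<kappa>\<close> are the Fourier coefficients of
  the Riesz product \<open>\<Prod>(1 + cos (4\<^sup>j t))\<close>. The white-noise summand makes the support full.
  Since \<open>\<kappa>(4\<^sup>k) = 1/2\<close> for all \<open>k\<close>, the system is not strongly mixing.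

  For mild mixing, the gaps in the support of \<open>\<kappa>\<close> show that for large \<open>n\<close> the function
  \<open>p \<mapsto> \<kappa>(n + p)\<close> agrees on any prescribed window with \<open>\<theta> \<kappa>(q + p)\<close> for some \<open>q\<close> and some \<open>\<theta> \<le> 1/2\<close>.
  Correlations of the functions \<open>exp(i Re \<phi>)\<close>, with \<open>\<phi>\<close> a finite combination of coordinates, are exponentials
  of covariances. Expanding the exponential and applying Cauchy--Schwarz to the powers of the Gram matrices
  gives \<open>\<bar>\<langle>U\<^sup>n f, f\<rangle>\<bar> \<le> \<parallel>f\<parallel>\<^sup>2 / 2\<close> eventually, for every centred linear combination \<open>f\<close> of such functions,
  and these are dense.
\<close>

text \<open>Covariances that tend to 0 would give strong mixing as well, so \<kappa> has to stay
  away from 0 along a sequence without ever returning near \<kappa>(0). In the Riesz product every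
  nonzero digit costs a factor 1/2, so a recurrence reproduces at most half of a window of \<kappa>;
  this is the origin of \<theta>. The powers of order m \<ge> 1 of a covariance then carry
  \<theta>^m \<le> \<theta>, and only the constant term of the exponential escapes. That term is the
  product of the means, which is why centred functions suffice. The window of \<kappa> seen at a far
  lag belongs to some other place q, so it is the mixed Gram matrix of two different families of
  vectors that have the same Gram matrix each; this is where Cauchy--Schwarz enters. The white noise
  is uncorrelated at nonzero lags and does not disturb the estimate. The weights \<open>2^-n\<close>
  decay fast enough to make a sequence of bounded variance an element of the space almost surely,
  and slowly enough for the shift to be bounded. The exponentials only approximate a given function,
  so the final bound is 9/10.\<close>

section \<open>The covariance kernel\<close>

text \<open>The value is 1/2 to the number of nonzero digits if \<open>n\<close> has an expansion in
  base 4 with digits -1, 0, 1, and 0 otherwise; the factor 1 + cos(4^j t) has coefficient 1/2 at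
  both of its nonzero frequencies. Remainder 3 is the digit -1 with a carry, remainder 2 is no
  digit.\<close>

function riesz_coeff :: "int \<Rightarrow> real" where
  "riesz_coeff n =
    (if n = 0 then 1
     else if n mod 4 = 0 then riesz_coeff (n div 4)
     else if n mod 4 = 1 then riesz_coeff (n div 4) / 2
     else if n mod 4 = 3 then riesz_coeff (n div 4 + 1) / 2
     else 0)"
  by pat_completeness auto
termination by (relation "Wellfounded.measure (\<lambda>n. nat \<bar>n\<bar>)") (auto, presburger+)

declare riesz_coeff.simps [simp del]

lemma riesz_coeff_0 [simp]: "riesz_coeff 0 = 1"
  by (simp add: riesz_coeff.simps)

lemma riesz_coeff_digit:
  "riesz_coeff (4 * n) = riesz_coeff n"
  "riesz_coeff (4 * n + 1) = riesz_coeff n / 2"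
  "riesz_coeff (4 * n - 1) = riesz_coeff n / 2"
  "riesz_coeff (4 * n + 2) = 0"
proof -
  show "riesz_coeff (4 * n) = riesz_coeff n"
    by (cases "n = 0") (simp_all add: riesz_coeff.simps [of "4 * n"])
  have "(4 * n + 1) mod 4 = 1" "(4 * n + 1) div 4 = n" "4 * n + 1 \<noteq> 0" by presburger+
  then show "riesz_coeff (4 * n + 1) = riesz_coeff n / 2"
    by (simp add: riesz_coeff.simps [of "4 * n + 1"])
  have "(4 * n - 1) mod 4 = 3" "(4 * n - 1) div 4 = n - 1" "4 * n - 1 \<noteq> 0" by presburger+
  then show "riesz_coeff (4 * n - 1) = riesz_coeff n / 2"
    by (simp add: riesz_coeff.simps [of "4 * n - 1"])
  have "(4 * n + 2) mod 4 = 2" "4 * n + 2 \<noteq> 0" by presburger+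
  then show "riesz_coeff (4 * n + 2) = 0"
    by (simp add: riesz_coeff.simps [of "4 * n + 2"])
qed

lemma int_digit4_cases:
  obtains (zero) m where "(n::int) = 4 * m" | (one) m where "n = 4 * m + 1"
    | (minus_one) m where "n = 4 * m - 1" | (two) m where "n = 4 * m + 2"
proof -
  have "n = 4 * (n div 4) \<or> n = 4 * (n div 4) + 1 \<or> n = 4 * (n div 4 + 1) - 1 \<or> n = 4 * (n div 4) + 2"
    by presburger
  then show thesis using that by blast
qed

text \<open>With \<open>d\<close> the lowest digit, the window of radius 4^J / 2 passes down to the
  quotient, and the window of radius 4^J / 3 passes back up: 3|m| \<le> b - 1 leaves room for one
  more digit. The distance between 1/3 and 1/2 is the gap used later.\<close>

lemma digit4_bounds:
  fixes b m d :: int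
  assumes "\<bar>d\<bar> \<le> 1"
  shows "2 * \<bar>4 * m + d\<bar> \<le> 4 * b \<Longrightarrow> 2 * \<bar>m\<bar> \<le> b"
    and "3 * \<bar>m\<bar> < b \<Longrightarrow> 3 * \<bar>4 * m + d\<bar> < 4 * b"
proof -
  have d: "d \<le> 1" "- 1 \<le> d" using assms by auto
  show "2 * \<bar>m\<bar> \<le> b" if "2 * \<bar>4 * m + d\<bar> \<le> 4 * b"
    using that d by (cases "0 \<le> m") (auto simp: abs_if split: if_splits)
  show "3 * \<bar>4 * m + d\<bar> < 4 * b" if "3 * \<bar>m\<bar> < b"
    using that d by (cases "0 \<le> m") (auto simp: abs_if split: if_splits)
qed

lemma riesz_coeff_uminus: "riesz_coeff (- n) = riesz_coeff n"
proof (induction n rule: measure_induct_rule [where f = "\<lambda>n. nat \<bar>n\<bar>"])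
  case (less n)
  show ?case
  proof (cases n rule: int_digit4_cases)
    case (zero m)
    then show ?thesis using less [of m] riesz_coeff_digit(1) [of "- m"]
      by (cases "m = 0") (simp_all add: riesz_coeff_digit)
  next
    case (one m)
    then have "\<bar>m\<bar> < \<bar>n\<bar>" by linarith
    then show ?thesis using less [of m] riesz_coeff_digit(3) [of "- m"] one
      by (simp add: riesz_coeff_digit)
  next
    case (minus_one m)
    then have "\<bar>m\<bar> < \<bar>n\<bar> \<or> m = 0" by linarith
    then show ?thesis using less [of m] riesz_coeff_digit(2) [of "- m"] minus_one
      by (auto simp add: riesz_coeff_digit)
  next
    case (two m)
    then have "- n = 4 * (- m - 1) + 2" by simp
    then show ?thesis using two by (simp only: riesz_coeff_digit)
  qed
qed

text \<open>A nonzero integer has at least one nonzero digit; the resulting 1/2 becomes the \<theta>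
  of the contraction.\<close>

lemma riesz_coeff_bounds: "0 \<le> riesz_coeff n \<and> riesz_coeff n \<le> (if n = 0 then 1 else 1 / 2)"
proof (induction n rule: measure_induct_rule [where f = "\<lambda>n. nat \<bar>n\<bar>"])
  case (less n)
  show ?case
  proof (cases "n = 0")
    case False
    then show ?thesis
    proof (cases n rule: int_digit4_cases)
      case (zero m)
      then show ?thesis using less [of m] False by (auto simp: riesz_coeff_digit split: if_splits)
    next
      case (one m)
      then have "\<bar>m\<bar> < \<bar>n\<bar> \<or> m = 0" by linarith
      then show ?thesis using less [of m] False one by (auto simp: riesz_coeff_digit split: if_splits)
    next
      case (minus_one m)
      then have "\<bar>m\<bar> < \<bar>n\<bar> \<or> m = 0" by linarith
      then show ?thesis using less [of m] False minus_one by (auto simp: riesz_coeff_digit split: if_splits)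
    qed (simp add: riesz_coeff_digit)
  qed simp
qed

lemma riesz_coeff_power: "riesz_coeff (4 ^ k) = 1 / 2"
  using riesz_coeff_digit(2) [of 0] by (induction k) (simp_all add: riesz_coeff_digit)

text \<open>No carry crosses position \<open>J\<close>, so the digits of \<open>h\<close> and
  \<open>q\<close> are those of the sum and their weights multiply. At the boundary |q| = 4^J / 2
  with J > 0 the digit 2 occurs and both sides vanish.\<close>

lemma riesz_coeff_mult_split:
  "2 * \<bar>q\<bar> \<le> 4 ^ J \<Longrightarrow> riesz_coeff (4 ^ J * h + q) = riesz_coeff h * riesz_coeff q"
proof (induction J arbitrary: q)
  case (Suc J)
  have *: "4 ^ Suc J * h + 4 * m = 4 * (4 ^ J * h + m)"
          "4 ^ Suc J * h + (4 * m + 1) = 4 * (4 ^ J * h + m) + 1"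
          "4 ^ Suc J * h + (4 * m - 1) = 4 * (4 ^ J * h + m) - 1"
          "4 ^ Suc J * h + (4 * m + 2) = 4 * (4 ^ J * h + m) + 2" for m
    by (simp_all add: algebra_simps)
  show ?case
  proof (cases q rule: int_digit4_cases)
    case (zero m)
    then show ?thesis using Suc.IH [of m] Suc.prems by (simp only: * riesz_coeff_digit) simp
  next
    case (one m)
    have "2 * \<bar>m\<bar> \<le> 4 ^ J" using Suc.prems digit4_bounds(1) [of "1" m "4 ^ J"] one by auto
    then show ?thesis using Suc.IH [of m] unfolding one * riesz_coeff_digit by simp
  next
    case (minus_one m)
    have "2 * \<bar>m\<bar> \<le> 4 ^ J" using Suc.prems digit4_bounds(1) [of "-1" m "4 ^ J"] minus_one by auto
    then show ?thesis using Suc.IH [of m] unfolding minus_one * riesz_coeff_digit by simp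
  next
    case (two m)
    then show ?thesis by (simp only: * riesz_coeff_digit)
  qed
next
  case 0
  then have "q = 0" by auto
  then show ?case by simp
qed

text \<open>\<open>J\<close> digits of size at most 1 reach only 1 + 4 + ... + 4^(J-1) < 4^J / 3. A
  support point of the window therefore keeps a distance of more than 4^J / 6 from its
  boundary.\<close>

lemma riesz_coeff_nonzero_bound:
  "2 * \<bar>q\<bar> \<le> 4 ^ J \<Longrightarrow> riesz_coeff (4 ^ J * h + q) \<noteq> 0 \<Longrightarrow> 3 * \<bar>q\<bar> < 4 ^ J"
proof (induction J arbitrary: q)
  case (Suc J)
  have *: "4 ^ Suc J * h + 4 * m = 4 * (4 ^ J * h + m)"
          "4 ^ Suc J * h + (4 * m + 1) = 4 * (4 ^ J * h + m) + 1"
          "4 ^ Suc J * h + (4 * m - 1) = 4 * (4 ^ J * h + m) - 1"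
          "4 ^ Suc J * h + (4 * m + 2) = 4 * (4 ^ J * h + m) + 2" for m
    by (simp_all add: algebra_simps)
  show ?case
  proof (cases q rule: int_digit4_cases)
    case (zero m)
    have "2 * \<bar>m\<bar> \<le> 4 ^ J" "3 * \<bar>m\<bar> < 4 ^ J \<Longrightarrow> 3 * \<bar>q\<bar> < 4 ^ Suc J"
      using Suc.prems(1) digit4_bounds [of "0" m "4 ^ J"] zero by auto
    then show ?thesis using Suc.IH [of m] Suc.prems(2) zero by (simp only: * riesz_coeff_digit) simp
  next
    case (one m)
    have "2 * \<bar>m\<bar> \<le> 4 ^ J" "3 * \<bar>m\<bar> < 4 ^ J \<Longrightarrow> 3 * \<bar>q\<bar> < 4 ^ Suc J"
      using Suc.prems(1) digit4_bounds [of "1" m "4 ^ J"] one by auto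
    then show ?thesis using Suc.IH [of m] Suc.prems(2) unfolding one * riesz_coeff_digit by simp
  next
    case (minus_one m)
    have "2 * \<bar>m\<bar> \<le> 4 ^ J" "3 * \<bar>m\<bar> < 4 ^ J \<Longrightarrow> 3 * \<bar>q\<bar> < 4 ^ Suc J"
      using Suc.prems(1) digit4_bounds [of "-1" m "4 ^ J"] minus_one by auto
    then show ?thesis using Suc.IH [of m] Suc.prems(2) unfolding minus_one * riesz_coeff_digit by simp
  next
    case (two m)
    then show ?thesis using Suc.prems(2) by (simp only: * riesz_coeff_digit)
  qed
next
  case 0
  then have "q = 0" by auto
  then show ?case by simp
qed

text \<open>Digits \<open>\<plusminus>1\<close> in base \<open>4\<close> leave a gap around \<open>4\<^sup>J / 2\<close>, so that translating by \<open>p\<close> affects only the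
  low digits of any \<open>n\<close> that is close to the support.\<close>

lemma riesz_coeff_tail:
  "\<exists>N. \<forall>n. N \<le> \<bar>n\<bar> \<longrightarrow>
    (\<exists>q \<theta>. 0 \<le> \<theta> \<and> \<theta> \<le> 1 / 2 \<and> (\<forall>p. \<bar>p\<bar> \<le> M \<longrightarrow> riesz_coeff (n + p) = \<theta> * riesz_coeff (q + p)))"
proof -
  \<comment> \<open>The gap between B/3 and B/2, with B = 4^J, has to absorb two translations by at
    most \<open>M\<close>, hence 12 M < B.\<close>
  obtain J where "of_int (12 * M + 12) < (4::real) ^ J"
    using real_arch_pow [of 4] by auto
  then have J: "12 * M + 12 < 4 ^ J"
    by (metis of_int_less_iff of_int_numeral of_int_power)
  have "\<exists>q \<theta>. 0 \<le> \<theta> \<and> \<theta> \<le> 1 / 2 \<and> (\<forall>p. \<bar>p\<bar> \<le> M \<longrightarrow> riesz_coeff (n + p) = \<theta> * riesz_coeff (q + p))"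
    if n: "2 * 4 ^ J \<le> \<bar>n\<bar>" for n
  proof (cases "\<exists>p. \<bar>p\<bar> \<le> M \<and> riesz_coeff (n + p) \<noteq> 0")
    case True
    then obtain p where p: "\<bar>p\<bar> \<le> M" "riesz_coeff (n + p) \<noteq> 0" by blast
    define B :: int where "B = 4 ^ J"
    \<comment> \<open>\<open>h\<close> is (n + p) / B rounded to the nearest integer, which puts the
      remainder \<open>r\<close> into the window of radius B/2.\<close>
    define h where "h = (2 * (n + p) + B) div (2 * B)"
    define r where "r = n + p - B * h"
    have B: "0 < B" "12 * M + 12 < B" "2 * B \<le> \<bar>n\<bar>" using J n by (auto simp: B_def)
    have "(2 * (n + p) + B) mod (2 * B) = 2 * (n + p) + B - 2 * B * h"
      by (simp add: h_def minus_mult_div_eq_mod)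
    then have "0 \<le> 2 * (n + p) + B - 2 * B * h" "2 * (n + p) + B - 2 * B * h < 2 * B"
      using pos_mod_sign [of "2 * B" "2 * (n + p) + B"] pos_mod_bound [of "2 * B" "2 * (n + p) + B"] B by auto
    then have r: "2 * \<bar>r\<bar> \<le> B" by (simp add: r_def abs_if)
    have "h \<noteq> 0"
    proof
      assume "h = 0"
      then have "r = n + p" by (simp add: r_def)
      then show False using r p(1) B by linarith
    qed
    have "n + p = B * h + r" by (simp add: r_def)
    then have r3: "3 * \<bar>r\<bar> < B"
      using riesz_coeff_nonzero_bound [of r J h] r p(2) by (simp add: B_def)
    \<comment> \<open>The single support point \<open>n + p\<close> fixes the high digits
      \<open>h\<close> for the whole window: \<open>\<theta>\<close> is the weight of
      \<open>h\<close> and \<open>q\<close> is \<open>r - p\<close>. Here |n| \<ge> 2 B has ensured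
      \<open>h \<noteq> 0\<close>.\<close>
    have "riesz_coeff (n + s) = riesz_coeff h * riesz_coeff ((r - p) + s)" if "\<bar>s\<bar> \<le> M" for s
    proof -
      have "n + s = B * h + ((r - p) + s)" by (simp add: r_def)
      moreover have "2 * \<bar>(r - p) + s\<bar> \<le> B"
      proof -
        have "\<bar>(r - p) + s\<bar> \<le> \<bar>r\<bar> + \<bar>p\<bar> + \<bar>s\<bar>" by (auto simp: abs_if)
        moreover have "2 * w \<le> B" if "w \<le> x + y + z" "3 * x < B" "y \<le> M" "z \<le> M" for w x y z
          using that B(1,2) by linarith
        ultimately show ?thesis using r3 p(1) that by blast
      qed
      ultimately show ?thesis using riesz_coeff_mult_split [of "(r - p) + s" J h] by (simp only: B_def)
    qed
    then show ?thesis
      using riesz_coeff_bounds [of h] \<open>h \<noteq> 0\<close>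
      by (intro exI [of _ "r - p"] exI [of _ "riesz_coeff h"]) auto
  next
    case False
    then show ?thesis by (intro exI [of _ 0]) auto
  qed
  then show ?thesis by blast
qed

text \<open>The partial Riesz product of order \<open>J\<close> is \<open>2\<^sup>-\<^sup>J \<bar>\<Prod>\<^sub>j (1 + z ^ 4\<^sup>j)\<bar>\<^sup>2\<close>; the list contains the
  exponents of the product over \<open>j < J\<close>.\<close>

fun digit_sums :: "nat \<Rightarrow> int list" where
  "digit_sums 0 = [0]"
| "digit_sums (Suc J) = concat (map (\<lambda>d. [4 * d, 4 * d + 1]) (digit_sums J))"

lemma sum_list_digit_sums_Suc:
  fixes f :: "int \<Rightarrow> real"
  shows "(\<Sum>d\<leftarrow>digit_sums (Suc J). f d) = (\<Sum>d\<leftarrow>digit_sums J. f (4 * d) + f (4 * d + 1))"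
proof -
  have "(\<Sum>d\<leftarrow>concat (map (\<lambda>d. [4 * d, 4 * d + 1]) xs). f d) = (\<Sum>d\<leftarrow>xs. f (4 * d) + f (4 * d + 1))"
    for xs by (induction xs) simp_all
  then show ?thesis by simp
qed

text \<open>This reads off the coefficient of z^n in the squared modulus of the product over j < J.
  A digit 0 of \<open>n\<close> comes from the pairs (0,0) and (1,1), a digit 1 or -1 from one pair
  only, so each digit contributes 2 times its weight.\<close>

lemma riesz_coeff_count:
  "2 * \<bar>n\<bar> \<le> 4 ^ J \<Longrightarrow>
   2 ^ J * riesz_coeff n = (\<Sum>d\<leftarrow>digit_sums J. \<Sum>e\<leftarrow>digit_sums J. of_bool (d - e = n))"
proof (induction J arbitrary: n)
  case (Suc J)
  have expand: "(\<Sum>d\<leftarrow>digit_sums (Suc J). \<Sum>e\<leftarrow>digit_sums (Suc J). of_bool (d - e = n)) =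
     (\<Sum>d\<leftarrow>digit_sums J. \<Sum>e\<leftarrow>digit_sums J. 2 * of_bool (4 * (d - e) = n) +
        of_bool (4 * (d - e) + 1 = n) + of_bool (4 * (d - e) - 1 = n) :: real)"
    unfolding sum_list_digit_sums_Suc sum_list_addf [symmetric]
    by (intro arg_cong [where f = sum_list] map_cong refl) (auto simp: algebra_simps)
  show ?case
  proof (cases n rule: int_digit4_cases)
    case (zero m)
    have eq: "(2 * of_bool (4 * k = n) + of_bool (4 * k + 1 = n) + of_bool (4 * k - 1 = n) :: real)
        = 2 * of_bool (k = m)" for k :: int
      unfolding zero by (simp, presburger)
    then show ?thesis using Suc.IH [of m] Suc.prems zero
      unfolding expand eq by (simp add: sum_list_const_mult riesz_coeff_digit)
  next
    case (one m)
    have eq: "(2 * of_bool (4 * k = n) + of_bool (4 * k + 1 = n) + of_bool (4 * k - 1 = n) :: real)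
        = of_bool (k = m)" for k :: int
      unfolding one by (simp, presburger)
    have "2 * \<bar>m\<bar> \<le> 4 ^ J" using Suc.prems digit4_bounds(1) [of "1" m "4 ^ J"] one by auto
    then show ?thesis using Suc.IH [of m] one
      unfolding expand eq by (simp add: sum_list_const_mult riesz_coeff_digit)
  next
    case (minus_one m)
    have eq: "(2 * of_bool (4 * k = n) + of_bool (4 * k + 1 = n) + of_bool (4 * k - 1 = n) :: real)
        = of_bool (k = m)" for k :: int
      unfolding minus_one by (simp, presburger)
    have "2 * \<bar>m\<bar> \<le> 4 ^ J" using Suc.prems digit4_bounds(1) [of "-1" m "4 ^ J"] minus_one by auto
    then show ?thesis using Suc.IH [of m] minus_one
      unfolding expand eq by (simp add: sum_list_const_mult riesz_coeff_digit)
  next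
    case (two m)
    have eq: "(2 * of_bool (4 * k = n) + of_bool (4 * k + 1 = n) + of_bool (4 * k - 1 = n) :: real) = 0"
      for k :: int
      unfolding two by (simp, presburger)
    show ?thesis using two unfolding expand eq by (simp add: riesz_coeff_digit)
  qed
next
  case 0
  then have "n = 0" by auto
  then show ?case by simp
qed

text \<open>The pairs with \<open>d - e = i - j\<close> are sorted by the common value l = d - i = e
  - j, which turns the count into a sum of products. The window consists of integers, so that
  translated blocks of indices can be compared later.\<close>

lemma riesz_coeff_gram:
  "\<exists>(F :: int set) v. finite F \<and>
     (\<forall>i j. \<bar>i\<bar> \<le> M \<longrightarrow> \<bar>j\<bar> \<le> M \<longrightarrow> riesz_coeff (i - j) = (\<Sum>l\<in>F. v l i * v l j))"
proof -
  obtain J where "of_int (4 * M) < (4::real) ^ J"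
    using real_arch_pow [of 4] by auto
  then have J: "4 * M < 4 ^ J"
    by (metis of_int_less_iff of_int_numeral of_int_power of_int_mult)
  have swap: "(\<Sum>d\<leftarrow>xs. \<Sum>e\<leftarrow>ys. \<Sum>l\<in>F. f d l * g e l) = (\<Sum>l\<in>F. (\<Sum>d\<leftarrow>xs. f d l) * (\<Sum>e\<leftarrow>ys. g e l))"
    for xs ys :: "int list" and F :: "int set" and f g :: "int \<Rightarrow> int \<Rightarrow> real"
    by (simp add: sum_list_sum_nth atLeast0LessThan sum_product sum.swap [of _ F])
  define c :: "int \<Rightarrow> real" where "c l = (\<Sum>d\<leftarrow>digit_sums J. of_bool (d = l))" for l
  \<comment> \<open>\<open>F\<close> contains every value l that a digit sum can produce inside the
    window.\<close>
  define F where "F = (\<Union>i\<in>{-M..M}. (\<lambda>d. d - i) ` set (digit_sums J))"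
  have "riesz_coeff (i - j) = (\<Sum>l\<in>F. (c (l + i) / sqrt (2 ^ J)) * (c (l + j) / sqrt (2 ^ J)))"
    if ij: "\<bar>i\<bar> \<le> M" "\<bar>j\<bar> \<le> M" for i j
  proof -
    have "2 * \<bar>i - j\<bar> \<le> 4 ^ J"
    proof -
      have "2 * w \<le> b" if "4 * M < b" "w \<le> x + y" "x \<le> M" "y \<le> M" for b w x y :: int
        using that by linarith
      then show ?thesis using J ij abs_triangle_ineq4 by blast
    qed
    then have "2 ^ J * riesz_coeff (i - j) =
        (\<Sum>d\<leftarrow>digit_sums J. \<Sum>e\<leftarrow>digit_sums J. of_bool (d - e = i - j))"
      by (rule riesz_coeff_count)
    also have "\<dots> = (\<Sum>d\<leftarrow>digit_sums J. \<Sum>e\<leftarrow>digit_sums J. \<Sum>l\<in>F. of_bool (d = l + i) * of_bool (e = l + j))"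
    proof (intro arg_cong [where f = sum_list] map_cong refl)
      fix d e assume "d \<in> set (digit_sums J)"
      then have "d - i \<in> F" using ij by (auto simp: F_def intro!: bexI [of _ i])
      moreover have "finite F" by (auto simp: F_def)
      moreover have "of_bool (d = l + i) * of_bool (e = l + j) =
          (if l = d - i then of_bool (d - e = i - j) else 0 :: real)" for l
        by auto
      ultimately show "of_bool (d - e = i - j) = (\<Sum>l\<in>F. of_bool (d = l + i) * of_bool (e = l + j) :: real)"
        by simp
    qed
    also have "\<dots> = (\<Sum>l\<in>F. c (l + i) * c (l + j))"
      unfolding c_def by (rule swap)
    finally have "riesz_coeff (i - j) = (\<Sum>l\<in>F. c (l + i) * c (l + j)) / 2 ^ J"
      by (simp add: field_simps)
    then show ?thesis by (simp add: sum_divide_distrib)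
  qed
  moreover have "finite F" by (auto simp: F_def)
  ultimately show ?thesis
    by (intro exI [of _ F] exI [of _ "\<lambda>l i. c (l + i) / sqrt (2 ^ J)"]) auto
qed

section \<open>Positive semidefinite kernels and Cholesky factorisation\<close>

definition psd_kernel :: "(nat \<Rightarrow> nat \<Rightarrow> real) \<Rightarrow> bool" where
  "psd_kernel K \<longleftrightarrow> (\<forall>i j. K i j = K j i) \<and> (\<forall>N c. 0 \<le> (\<Sum>i<N. \<Sum>j<N. c i * c j * K i j))"

lemma psd_kernelD:
  assumes "psd_kernel K"
  shows "K i j = K j i" and "0 \<le> (\<Sum>i<N. \<Sum>j<N. c i * c j * K i j)"
  using assms by (auto simp: psd_kernel_def)

lemma psd_kernel_diag: "psd_kernel K \<Longrightarrow> 0 \<le> K n n"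
proof -
  assume "psd_kernel K"
  then have "0 \<le> (\<Sum>i<Suc n. \<Sum>j<Suc n. of_bool (i = n) * of_bool (j = n) * K i j)"
    by (rule psd_kernelD(2))
  also have "\<dots> = K n n" by (simp add: mult.assoc)
  finally show ?thesis .
qed

text \<open>The quadratic form evaluated at c + t e_n. Since \<open>n\<close> may lie beyond
  \<open>N\<close>, both vectors are padded to a common length \<open>M\<close>.\<close>

lemma psd_kernel_quadratic:
  assumes K: "psd_kernel K"
  shows "0 \<le> (\<Sum>i<N. \<Sum>j<N. c i * c j * K i j) + 2 * t * (\<Sum>i<N. c i * K i n) + t\<^sup>2 * K n n"
proof -
  define M where "M = max N (Suc n)"
  define d where "d i = (if i < N then c i else 0)" for i
  have ext: "(\<Sum>i<M. d i * f i) = (\<Sum>i<N. c i * f i)" for f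
    by (rule sum.mono_neutral_cong_right) (auto simp: d_def M_def)
  have n: "(\<Sum>i<M. of_bool (i = n) * f i) = f n" for f :: "nat \<Rightarrow> real"
    by (simp add: M_def)
  have sym: "K i j = K j i" for i j by (rule psd_kernelD(1) [OF K])
  have "0 \<le> (\<Sum>i<M. \<Sum>j<M. (d i + t * of_bool (i = n)) * (d j + t * of_bool (j = n)) * K i j)"
    by (rule psd_kernelD(2) [OF K])
  also have "\<dots> = (\<Sum>i<M. \<Sum>j<M. d i * (d j * K i j) + d i * (of_bool (j = n) * (t * K i j)) +
      of_bool (i = n) * (d j * (t * K i j)) + of_bool (i = n) * (of_bool (j = n) * (t\<^sup>2 * K i j)))"
    by (intro sum.cong refl) (simp only: algebra_simps power2_eq_square)
  also have "\<dots> = (\<Sum>i<N. c i * (\<Sum>j<N. c j * K i j)) + (\<Sum>i<N. c i * (t * K i n)) +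
      (\<Sum>j<N. c j * (t * K n j)) + t\<^sup>2 * K n n"
    unfolding sum.distrib sum_distrib_left [symmetric] ext n ..
  also have "(\<Sum>i<N. c i * (\<Sum>j<N. c j * K i j)) = (\<Sum>i<N. \<Sum>j<N. c i * c j * K i j)"
    by (simp only: sum_distrib_left mult.assoc)
  also have "(\<Sum>i<N. c i * (t * K i n)) = t * (\<Sum>i<N. c i * K i n)"
    by (simp only: sum_distrib_left mult.left_commute)
  also have "(\<Sum>j<N. c j * (t * K n j)) = t * (\<Sum>i<N. c i * K i n)"
    by (simp only: sum_distrib_left mult.left_commute sym [of n])
  also have "(\<Sum>i<N. \<Sum>j<N. c i * c j * K i j) + t * (\<Sum>i<N. c i * K i n) + t * (\<Sum>i<N. c i * K i n) + t\<^sup>2 * K n n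
    = (\<Sum>i<N. \<Sum>j<N. c i * c j * K i j) + 2 * t * (\<Sum>i<N. c i * K i n) + t\<^sup>2 * K n n"
    by simp
  finally show ?thesis .
qed

text \<open>Cauchy--Schwarz for the semidefinite form, between \<open>c\<close> and the unit vector
  at \<open>n\<close>, from the sign of a quadratic polynomial in t.\<close>

lemma psd_kernel_column:
  assumes K: "psd_kernel K"
  shows "(\<Sum>i<N. c i * K i n)\<^sup>2 \<le> (\<Sum>i<N. \<Sum>j<N. c i * c j * K i j) * K n n"
    (is "?b\<^sup>2 \<le> ?a * ?d")
proof (cases "?d = 0")
  case True
  have "?b = 0"
  proof (rule ccontr)
    assume b: "?b \<noteq> 0"
    show False
      \<comment> \<open>For a vanishing diagonal entry the polynomial is affine in t; at this t it
        equals -1.\<close>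
      using psd_kernel_quadratic [OF K, where c = c and N = N and n = n and t = "- (?a + 1) / (2 * ?b)"] True b
      by (simp add: field_simps)
  qed
  then show ?thesis using True by simp
next
  case False
  then have d: "0 < ?d" using psd_kernel_diag [OF K, of n] by simp
  have "0 \<le> ?a + 2 * (- ?b / ?d) * ?b + (- ?b / ?d)\<^sup>2 * ?d"
    by (rule psd_kernel_quadratic [OF K])
  also have "\<dots> = ?a - ?b\<^sup>2 / ?d" using d by (simp add: power2_eq_square field_simps)
  finally show ?thesis using d by (simp add: field_simps)
qed

lemma psd_kernel_diag_zero:
  assumes K: "psd_kernel K" and "K n n = 0"
  shows "K i n = 0"
proof -
  have "(\<Sum>j<Suc i. of_bool (j = i) * K j n)\<^sup>2 \<le>
      (\<Sum>j<Suc i. \<Sum>k<Suc i. of_bool (j = i) * of_bool (k = i) * K j k) * K n n"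
    by (rule psd_kernel_column [OF K])
  then show ?thesis using assms(2) by simp
qed

text \<open>Symmetric Gaussian elimination: step \<open>n\<close> removes row and column
  \<open>n\<close>. A vanishing pivot subtracts nothing because x / 0 = 0, and then
  \<open>psd_kernel_diag_zero\<close> says that the row is already zero.\<close>

fun schur_step :: "(nat \<Rightarrow> nat \<Rightarrow> real) \<Rightarrow> nat \<Rightarrow> nat \<Rightarrow> nat \<Rightarrow> real" where
  "schur_step K 0 = K"
| "schur_step K (Suc n) =
    (\<lambda>i j. schur_step K n i j - schur_step K n i n * schur_step K n j n / schur_step K n n n)"

text \<open>The form loses exactly the square of the column term divided by the pivot, and
  \<open>psd_kernel_column\<close> bounds that loss by the form itself.\<close>

lemma psd_kernel_schur_step:
  assumes "psd_kernel K" shows "psd_kernel (schur_step K n)"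
proof (induction n)
  case (Suc n)
  let ?S = "schur_step K n"
  have sym: "?S i j = ?S j i" for i j by (rule psd_kernelD(1) [OF Suc])
  have "0 \<le> (\<Sum>i<N. \<Sum>j<N. c i * c j * (?S i j - ?S i n * ?S j n / ?S n n))" for N c
  proof -
    have eq: "(\<Sum>i<N. \<Sum>j<N. c i * c j * (?S i j - ?S i n * ?S j n / ?S n n)) =
      (\<Sum>i<N. \<Sum>j<N. c i * c j * ?S i j) - (\<Sum>i<N. c i * ?S i n)\<^sup>2 / ?S n n"
    proof -
      have "c i * c j * (?S i j - ?S i n * ?S j n / ?S n n) =
          c i * c j * ?S i j - (c i * ?S i n) * (c j * ?S j n) / ?S n n" for i j
        by (simp add: algebra_simps)
      then show ?thesis
        by (simp only: power2_eq_square sum_product sum_divide_distrib sum_subtractf)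
    qed
    have "(\<Sum>i<N. c i * ?S i n)\<^sup>2 \<le> (\<Sum>i<N. \<Sum>j<N. c i * c j * ?S i j) * ?S n n"
      by (rule psd_kernel_column [OF Suc])
    moreover have "0 \<le> (\<Sum>i<N. \<Sum>j<N. c i * c j * ?S i j)" "0 \<le> ?S n n"
      by (rule psd_kernelD(2) [OF Suc], rule psd_kernel_diag [OF Suc])
    ultimately show ?thesis unfolding eq by (cases "?S n n = 0") (simp_all add: divide_le_eq)
  qed
  then show ?case by (auto simp: psd_kernel_def sym mult.commute)
qed (use assms in simp)

lemma schur_step_zero:
  assumes K: "psd_kernel K"
  shows "i < n \<Longrightarrow> schur_step K n i j = 0"
proof (induction n arbitrary: i j)
  case (Suc n)
  let ?S = "schur_step K n"
  have S: "psd_kernel ?S" by (rule psd_kernel_schur_step [OF K])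
  show ?case
  proof (cases "i = n")
    case True
    have "?S n j = ?S j n" by (rule psd_kernelD(1) [OF S])
    then show ?thesis
      using True psd_kernel_diag_zero [OF S, of n j] by (cases "?S n n = 0") simp_all
  next
    case False
    then have "i < n" using Suc.prems by simp
    then show ?thesis using Suc.IH by simp
  qed
qed simp

text \<open>Column \<open>k\<close> of \<open>L\<close> is the normalised pivot column of step
  \<open>k\<close>. The products telescope to \<open>K - schur_step K N\<close>, and the rows below
  \<open>N\<close> of the last term vanish. One infinite factor serves all \<open>N\<close>, so a
  single noise sequence can carry the whole process.\<close>

lemma psd_kernel_cholesky:
  assumes K: "psd_kernel K"
  shows "\<exists>L. (\<forall>n k. n < k \<longrightarrow> L n k = 0) \<and> (\<forall>n m N. n < N \<longrightarrow> K n m = (\<Sum>k<N. L n k * L m k))"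
proof -
  define L where "L n k = schur_step K k n k / sqrt (schur_step K k k k)" for n k
  have LL: "L n k * L m k = schur_step K k n k * schur_step K k m k / schur_step K k k k" for n m k
    using psd_kernel_diag [OF psd_kernel_schur_step [OF K], of k k] by (simp add: L_def)
  have "(\<Sum>k<N. L n k * L m k) = K n m - schur_step K N n m" for n m N
    by (induction N) (simp_all add: LL)
  then show ?thesis
    using schur_step_zero [OF K] by (intro exI [of _ L]) (auto simp: L_def)
qed

section \<open>Powers and exponentials of Gram matrices\<close>

text \<open>The m-th power of an inner product is the inner product of m-fold tensor powers. The
  induction peels off one tensor factor by moving \<open>u l j\<close> and \<open>v l k\<close> into
  the coefficients, hence the generalisation over \<open>b\<close> and \<open>c\<close>.
  Cauchy--Schwarz is stated with the arithmetic mean because that form can be summed over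
  \<open>l\<close>.\<close>

lemma cmod_gram_power_le:
  fixes u v :: "'l \<Rightarrow> 'i \<Rightarrow> real" and b c :: "'i \<Rightarrow> complex"
  shows "cmod (\<Sum>j\<in>I. \<Sum>k\<in>I. b j * cnj (c k) * complex_of_real ((\<Sum>l\<in>F. u l j * v l k) ^ m)) \<le>
    (Re (\<Sum>j\<in>I. \<Sum>k\<in>I. b j * cnj (b k) * complex_of_real ((\<Sum>l\<in>F. u l j * u l k) ^ m)) +
     Re (\<Sum>j\<in>I. \<Sum>k\<in>I. c j * cnj (c k) * complex_of_real ((\<Sum>l\<in>F. v l j * v l k) ^ m))) / 2"
proof (induction m arbitrary: b c)
  case 0
  have "2 * cmod (sum b I) * cmod (sum c I) \<le> (cmod (sum b I))\<^sup>2 + (cmod (sum c I))\<^sup>2"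
    by (rule sum_squares_bound)
  moreover have "Re (z * cnj z) = (cmod z)\<^sup>2" for z
    by (simp add: cmod_power2 flip: power2_eq_square)
  ultimately show ?case
    by (simp add: sum_product [symmetric] cnj_sum [symmetric] norm_mult del: cnj_sum times_complex.sel)
next
  case (Suc m)
  have expand: "(\<Sum>j\<in>I. \<Sum>k\<in>I. b j * cnj (c k) * complex_of_real ((\<Sum>l\<in>F. u l j * v l k) ^ Suc m)) =
      (\<Sum>l\<in>F. \<Sum>j\<in>I. \<Sum>k\<in>I. (b j * u l j) * cnj (c k * v l k) * complex_of_real ((\<Sum>l\<in>F. u l j * v l k) ^ m))"
    for u v :: "'l \<Rightarrow> 'i \<Rightarrow> real" and b c :: "'i \<Rightarrow> complex"
  proof -
    have "b j * cnj (c k) * complex_of_real ((\<Sum>l\<in>F. u l j * v l k) ^ Suc m) =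
      (\<Sum>l\<in>F. (b j * u l j) * cnj (c k * v l k) * complex_of_real ((\<Sum>l\<in>F. u l j * v l k) ^ m))" for j k
    proof -
      have "b j * cnj (c k) * complex_of_real ((\<Sum>l\<in>F. u l j * v l k) ^ Suc m) =
        (\<Sum>l\<in>F. complex_of_real (u l j * v l k)) * (b j * cnj (c k) * complex_of_real ((\<Sum>l\<in>F. u l j * v l k) ^ m))"
        by (simp only: power_Suc of_real_mult of_real_sum ac_simps)
      then show ?thesis by (simp only: sum_distrib_right) (simp add: ac_simps)
    qed
    then show ?thesis by (simp only: sum.swap [of _ F])
  qed
  have "cmod (\<Sum>j\<in>I. \<Sum>k\<in>I. b j * cnj (c k) * complex_of_real ((\<Sum>l\<in>F. u l j * v l k) ^ Suc m)) \<le>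
     (\<Sum>l\<in>F. cmod (\<Sum>j\<in>I. \<Sum>k\<in>I. (b j * u l j) * cnj (c k * v l k) * complex_of_real ((\<Sum>l\<in>F. u l j * v l k) ^ m)))"
    unfolding expand by (rule norm_sum)
  also have "\<dots> \<le> (\<Sum>l\<in>F. (Re (\<Sum>j\<in>I. \<Sum>k\<in>I. (b j * u l j) * cnj (b k * u l k) * complex_of_real ((\<Sum>l\<in>F. u l j * u l k) ^ m)) +
     Re (\<Sum>j\<in>I. \<Sum>k\<in>I. (c j * v l j) * cnj (c k * v l k) * complex_of_real ((\<Sum>l\<in>F. v l j * v l k) ^ m))) / 2)"
    by (rule sum_mono) (rule Suc.IH)
  also have "\<dots> = (Re (\<Sum>j\<in>I. \<Sum>k\<in>I. b j * cnj (b k) * complex_of_real ((\<Sum>l\<in>F. u l j * u l k) ^ Suc m)) +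
     Re (\<Sum>j\<in>I. \<Sum>k\<in>I. c j * cnj (c k) * complex_of_real ((\<Sum>l\<in>F. v l j * v l k) ^ Suc m))) / 2"
    unfolding expand by (simp only: Re_sum sum.distrib sum_divide_distrib [symmetric])
  finally show ?case .
qed

lemma exp_minus_one_sums: "(\<lambda>m. x ^ Suc m / fact (Suc m)) sums (exp x - 1)" for x :: real
  using sums_split_initial_segment [OF exp_converges [of x], of 1]
  by (simp add: divide_inverse_commute scaleR_conv_of_real)

text \<open>The series of exp - 1 starts at order one, so every term admits the estimate \<theta>^m
  \<le> \<theta>. Equality of the two Gram matrices makes the arithmetic mean in
  \<open>cmod_gram_power_le\<close> collapse to a single term.\<close>

lemma cmod_gram_exp_le:
  fixes u v :: "'l \<Rightarrow> 'i \<Rightarrow> real" and b :: "'i \<Rightarrow> complex"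
  assumes \<theta>: "0 \<le> \<theta>" "\<theta> \<le> 1"
    and uv: "\<And>j k. j \<in> I \<Longrightarrow> k \<in> I \<Longrightarrow> (\<Sum>l\<in>F. v l j * v l k) = (\<Sum>l\<in>F. u l j * u l k)"
  shows "cmod (\<Sum>j\<in>I. \<Sum>k\<in>I. b j * cnj (b k) * complex_of_real (exp (\<theta> * (\<Sum>l\<in>F. u l j * v l k)) - 1)) \<le>
    \<theta> * Re (\<Sum>j\<in>I. \<Sum>k\<in>I. b j * cnj (b k) * complex_of_real (exp (\<Sum>l\<in>F. u l j * u l k) - 1))"
proof -
  define S where "S g = (\<Sum>j\<in>I. \<Sum>k\<in>I. b j * cnj (b k) * complex_of_real (g j k))" for g :: "'i \<Rightarrow> 'i \<Rightarrow> real"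
  define x where "x j k = (\<Sum>l\<in>F. u l j * v l k)" for j k
  define y where "y j k = (\<Sum>l\<in>F. u l j * u l k)" for j k
  have S_sums: "(\<lambda>m. S (\<lambda>j k. g j k ^ Suc m / fact (Suc m))) sums S (\<lambda>j k. exp (g j k) - 1)" for g
    unfolding S_def by (intro sums_sum sums_mult sums_of_real exp_minus_one_sums)
  have S_scale: "S (\<lambda>j k. r * g j k) = complex_of_real r * S g" for r g
    by (simp add: S_def sum_distrib_left ac_simps)
  have bound: "cmod (S (\<lambda>j k. (\<theta> * x j k) ^ Suc m / fact (Suc m))) \<le> \<theta> * Re (S (\<lambda>j k. y j k ^ Suc m / fact (Suc m)))"
    (is "?l \<le> ?r") for m
  proof -
    have "S (\<lambda>j k. (\<Sum>l\<in>F. v l j * v l k) ^ Suc m) = S (\<lambda>j k. y j k ^ Suc m)"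
      unfolding S_def y_def by (intro sum.cong refl) (simp only: uv)
    then have "cmod (S (\<lambda>j k. x j k ^ Suc m)) \<le> Re (S (\<lambda>j k. y j k ^ Suc m))"
      using cmod_gram_power_le [where I = I and b = b and c = b and F = F and u = u and v = v and m = "Suc m"]
      unfolding S_def x_def y_def by simp
    moreover have "\<theta> ^ Suc m \<le> \<theta>" using \<theta> by (simp add: mult_left_le power_le_one)
    ultimately have "\<theta> ^ Suc m * cmod (S (\<lambda>j k. x j k ^ Suc m)) / fact (Suc m)
        \<le> \<theta> * Re (S (\<lambda>j k. y j k ^ Suc m)) / fact (Suc m)"
      using \<theta> by (intro divide_right_mono mult_mono) auto
    moreover have "S (\<lambda>j k. (\<theta> * x j k) ^ Suc m / fact (Suc m)) =
        complex_of_real (\<theta> ^ Suc m / fact (Suc m)) * S (\<lambda>j k. x j k ^ Suc m)"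
      by (simp only: S_scale [symmetric] power_mult_distrib times_divide_eq_left)
    moreover have "S (\<lambda>j k. y j k ^ Suc m / fact (Suc m)) =
        complex_of_real (1 / fact (Suc m)) * S (\<lambda>j k. y j k ^ Suc m)"
      by (simp only: S_scale [symmetric] times_divide_eq_left mult_1)
    then have "Re (S (\<lambda>j k. y j k ^ Suc m / fact (Suc m))) = Re (S (\<lambda>j k. y j k ^ Suc m)) / fact (Suc m)"
      by (simp only: times_complex.sel Re_complex_of_real Im_complex_of_real) simp
    ultimately show ?thesis
      using \<theta> by (simp add: norm_mult norm_divide norm_power del: fact_Suc power_Suc)
  qed
  have sums: "(\<lambda>m. \<theta> * Re (S (\<lambda>j k. y j k ^ Suc m / fact (Suc m)))) sums (\<theta> * Re (S (\<lambda>j k. exp (y j k) - 1)))"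
    by (intro sums_mult sums_Re S_sums)
  have "cmod (S (\<lambda>j k. exp (\<theta> * x j k) - 1)) \<le> \<theta> * Re (S (\<lambda>j k. exp (y j k) - 1))"
    using norm_suminf_le [OF bound sums_summable [OF sums]] sums_unique [OF sums] sums_unique [OF S_sums [of "\<lambda>j k. \<theta> * x j k"]]
    by simp
  then show ?thesis by (simp only: S_def x_def y_def)
qed

section \<open>A weighted sequence space\<close>

lemma cmod_add_sq_le: "(cmod (a + b))\<^sup>2 \<le> 2 * (cmod a)\<^sup>2 + 2 * (cmod b)\<^sup>2"
proof -
  have "(cmod (a + b))\<^sup>2 \<le> (cmod a + cmod b)\<^sup>2"
    by (simp add: norm_triangle_ineq power_mono)
  also have "\<dots> \<le> 2 * (cmod a)\<^sup>2 + 2 * (cmod b)\<^sup>2"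
    using sum_squares_bound [of "cmod a" "cmod b"] by (simp add: power2_sum)
  finally show ?thesis .
qed

lemma cring_complex_field: "cring complex_field"
proof (intro cringI abelian_groupI comm_monoidI)
  fix x
  show "\<exists>y\<in>carrier complex_field. y \<oplus>\<^bsub>complex_field\<^esub> x = \<zero>\<^bsub>complex_field\<^esub>"
    by (rule bexI [of _ "- x"]) (simp_all add: complex_field_def)
qed (simp_all add: complex_field_def algebra_simps)

text \<open>In plain square summable sequences a nonzero stationary Gaussian sequence cannot live;
  the weights make room for it.\<close>

definition wl2_set :: "(nat \<Rightarrow> complex) set" where
  "wl2_set = {x. summable (\<lambda>n. (cmod (x n))\<^sup>2 / 2 ^ n)}"

definition wl2 :: "(nat \<Rightarrow> complex) complex_space" where
  "wl2 = \<lparr>carrier = wl2_set, mult = (\<lambda>x y. x), one = (\<lambda>n. 0), zero = (\<lambda>n. 0),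
     add = (\<lambda>x y n. x n + y n), smult = (\<lambda>a x n. a * x n),
     cinner = (\<lambda>x y. \<Sum>n. x n * cnj (y n) / 2 ^ n)\<rparr>"

lemma wl2_simps [simp]:
  "carrier wl2 = wl2_set" "zero wl2 = (\<lambda>n. 0)" "add wl2 x y = (\<lambda>n. x n + y n)"
  "smult wl2 a x = (\<lambda>n. a * x n)" "cinner wl2 x y = (\<Sum>n. x n * cnj (y n) / 2 ^ n)"
  by (simp_all add: wl2_def)

lemma wl2_zero: "(\<lambda>n. 0) \<in> wl2_set"
  by (simp add: wl2_set_def)

lemma wl2_scale: "x \<in> wl2_set \<Longrightarrow> (\<lambda>n. a * x n) \<in> wl2_set"
  using summable_mult [of "\<lambda>n. (cmod (x n))\<^sup>2 / 2 ^ n" "(cmod a)\<^sup>2"]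
  by (simp add: wl2_set_def norm_mult power_mult_distrib)

lemma wl2_add:
  assumes "x \<in> wl2_set" "y \<in> wl2_set" shows "(\<lambda>n. x n + y n) \<in> wl2_set"
proof -
  have bound: "(cmod (x n + y n))\<^sup>2 / 2 ^ n \<le> 2 * ((cmod (x n))\<^sup>2 / 2 ^ n) + 2 * ((cmod (y n))\<^sup>2 / 2 ^ n)" for n
    using cmod_add_sq_le [of "x n" "y n"] by (simp add: divide_right_mono flip: add_divide_distrib)
  have "summable (\<lambda>n. 2 * ((cmod (x n))\<^sup>2 / 2 ^ n) + 2 * ((cmod (y n))\<^sup>2 / 2 ^ n))"
    using assms unfolding wl2_set_def by (intro summable_add summable_mult) auto
  then show ?thesis
    unfolding wl2_set_def mem_Collect_eq by (rule summable_comparison_test_ev [rotated]) (use bound in auto)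
qed

lemma wl2_diff: "x \<in> wl2_set \<Longrightarrow> y \<in> wl2_set \<Longrightarrow> (\<lambda>n. x n - y n) \<in> wl2_set"
  using wl2_add [of x "\<lambda>n. - 1 * y n"] wl2_scale [of y "- 1"] by simp

lemma wl2_inner_summable:
  assumes "x \<in> wl2_set" "y \<in> wl2_set"
  shows "summable (\<lambda>n. x n * cnj (y n) / 2 ^ n)"
proof -
  have "summable (\<lambda>n. (cmod (x n))\<^sup>2 / 2 ^ n + (cmod (y n))\<^sup>2 / 2 ^ n)"
    using assms unfolding wl2_set_def by (intro summable_add) auto
  moreover have "norm (x n * cnj (y n) / 2 ^ n) \<le> (cmod (x n))\<^sup>2 / 2 ^ n + (cmod (y n))\<^sup>2 / 2 ^ n" for n
  proof -
    have "cmod (x n) * cmod (y n) \<le> (cmod (x n))\<^sup>2 + (cmod (y n))\<^sup>2"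
      using sum_squares_bound [of "cmod (x n)" "cmod (y n)"] mult_nonneg_nonneg [OF norm_ge_zero norm_ge_zero, of "x n" "y n"]
      by linarith
    then show ?thesis
      by (simp add: norm_mult norm_divide norm_power divide_right_mono flip: add_divide_distrib)
  qed
  ultimately show ?thesis by (rule summable_comparison_test')
qed

definition wl2_sqnorm :: "(nat \<Rightarrow> complex) \<Rightarrow> real" where
  "wl2_sqnorm x = (\<Sum>n. (cmod (x n))\<^sup>2 / 2 ^ n)"

lemma wl2_inner_self: "x \<in> wl2_set \<Longrightarrow> cinner wl2 x x = complex_of_real (wl2_sqnorm x)"
proof -
  assume "x \<in> wl2_set"
  then have "(\<lambda>n. complex_of_real ((cmod (x n))\<^sup>2 / 2 ^ n)) sums complex_of_real (wl2_sqnorm x)"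
    unfolding wl2_sqnorm_def wl2_set_def by (intro sums_of_real summable_sums) simp
  moreover have "complex_of_real ((cmod (x n))\<^sup>2 / 2 ^ n) = x n * cnj (x n) / 2 ^ n" for n
    by (metis complex_norm_square of_real_divide of_real_numeral of_real_power)
  ultimately show ?thesis by (simp add: sums_iff)
qed

lemma wl2_sqnorm_nonneg: "x \<in> wl2_set \<Longrightarrow> 0 \<le> wl2_sqnorm x"
  unfolding wl2_sqnorm_def wl2_set_def by (intro suminf_nonneg) auto

lemma wl2_coordinate_le:
  assumes "x \<in> wl2_set"
  shows "(\<Sum>i<N. (cmod (x i))\<^sup>2 / 2 ^ i) \<le> wl2_sqnorm x" and "(cmod (x i))\<^sup>2 \<le> 2 ^ i * wl2_sqnorm x"
proof -
  show *: "(\<Sum>i<N. (cmod (x i))\<^sup>2 / 2 ^ i) \<le> wl2_sqnorm x" for N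
    using assms unfolding wl2_sqnorm_def wl2_set_def by (intro sum_le_suminf) auto
  have "(cmod (x i))\<^sup>2 / 2 ^ i \<le> (\<Sum>i<Suc i. (cmod (x i))\<^sup>2 / 2 ^ i)"
    by (simp add: sum_nonneg)
  also have "\<dots> \<le> wl2_sqnorm x" by (rule *)
  finally show "(cmod (x i))\<^sup>2 \<le> 2 ^ i * wl2_sqnorm x"
    by (simp add: field_simps)
qed

lemma wl2_from_bounded_sums:
  assumes "\<And>N. (\<Sum>i<N. (cmod (x i))\<^sup>2 / 2 ^ i) \<le> B"
  shows "x \<in> wl2_set" "wl2_sqnorm x \<le> B"
proof -
  have "summable (\<lambda>i. (cmod (x i))\<^sup>2 / 2 ^ i)"
    by (rule summableI_nonneg_bounded [of _ B]) (use assms in auto)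
  then show "x \<in> wl2_set" "wl2_sqnorm x \<le> B"
    unfolding wl2_set_def wl2_sqnorm_def by (auto intro!: suminf_le_const assms)
qed

lemma wl2_inner_space: "complex_inner_space wl2"
proof (intro complex_inner_space.intro complex_inner_space_axioms.intro)
  show "Module.module complex_field wl2"
  proof (intro moduleI cring_complex_field abelian_groupI)
    fix x assume "x \<in> carrier wl2"
    then show "\<exists>y\<in>carrier wl2. y \<oplus>\<^bsub>wl2\<^esub> x = \<zero>\<^bsub>wl2\<^esub>"
      using wl2_scale [of x "- 1"] by (intro bexI [of _ "\<lambda>n. - x n"]) auto
  qed (auto simp: complex_field_def algebra_simps wl2_zero intro: wl2_scale wl2_add)
next
  fix x y z assume "x \<in> carrier wl2" "y \<in> carrier wl2" "z \<in> carrier wl2"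
  then show "cinner wl2 (x \<oplus>\<^bsub>wl2\<^esub> y) z = cinner wl2 x z + cinner wl2 y z"
    using suminf_add [OF wl2_inner_summable [of x z] wl2_inner_summable [of y z]]
    by (simp add: algebra_simps add_divide_distrib)
next
  fix a x y assume "x \<in> carrier wl2" "y \<in> carrier wl2"
  then show "cinner wl2 (a \<odot>\<^bsub>wl2\<^esub> x) y = a * cinner wl2 x y"
    using suminf_mult [OF wl2_inner_summable [of x y], of a] by (simp add: mult.assoc)
next
  fix x y assume "x \<in> carrier wl2" "y \<in> carrier wl2"
  then have "(\<lambda>n. y n * cnj (x n) / 2 ^ n) sums cinner wl2 y x"
    using summable_sums [OF wl2_inner_summable [of y x]] by simp
  then have "(\<lambda>n. cnj (y n * cnj (x n) / 2 ^ n)) sums cnj (cinner wl2 y x)"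
    by (simp only: sums_cnj)
  then show "cinner wl2 x y = cnj (cinner wl2 y x)"
    by (simp add: sums_iff mult.commute)
next
  fix x assume x: "x \<in> carrier wl2" "x \<noteq> \<zero>\<^bsub>wl2\<^esub>"
  then obtain i where "x i \<noteq> 0" by auto
  then have "0 < (cmod (x i))\<^sup>2" by simp
  also have "\<dots> \<le> 2 ^ i * wl2_sqnorm x" using x by (intro wl2_coordinate_le) simp
  finally show "0 < Re (cinner wl2 x x)"
    using wl2_inner_self [of x] x by (simp add: zero_less_mult_iff del: wl2_simps(5))
qed

lemma wl2_minus:
  assumes x: "x \<in> wl2_set" and y: "y \<in> wl2_set"
  shows "x \<ominus>\<^bsub>wl2\<^esub> y = (\<lambda>n. x n - y n)"
proof -
  have M: "abelian_group wl2"
    using wl2_inner_space by (simp add: complex_inner_space_def Module.module_def)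
  have "\<ominus>\<^bsub>wl2\<^esub> y = (\<lambda>n. - y n)"
    using wl2_scale [OF y, of "- 1"] y by (intro abelian_group.minus_equality [OF M]) auto
  then show ?thesis by (simp add: a_minus_def)
qed

interpretation wl2: Metric_space wl2_set "cdist wl2"
proof -
  interpret complex_inner_space wl2 by (rule wl2_inner_space)
  show "Metric_space wl2_set (cdist wl2)"
    using Metric_space_axioms unfolding wl2_simps .
qed

lemma wl2_norm: "x \<in> wl2_set \<Longrightarrow> cnorm wl2 x = sqrt (wl2_sqnorm x)"
  using wl2_inner_self [of x] by (simp add: cnorm_def del: wl2_simps(5))

lemma wl2_dist: "x \<in> wl2_set \<Longrightarrow> y \<in> wl2_set \<Longrightarrow> cdist wl2 x y = sqrt (wl2_sqnorm (\<lambda>n. x n - y n))"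
  by (simp add: cdist_def wl2_minus wl2_norm wl2_diff)

lemma wl2_topology: "norm_topology wl2 = wl2.mtopology"
  by (simp add: norm_topology_def)

lemma wl2_mcomplete: "wl2.mcomplete"
  unfolding wl2.mcomplete_def
proof (intro allI impI)
  fix \<sigma> assume C: "wl2.MCauchy \<sigma>"
  then have \<sigma>: "\<sigma> m \<in> wl2_set" for m unfolding wl2.MCauchy_def by blast
  have Cauchy: "\<exists>N. \<forall>m\<ge>N. \<forall>n\<ge>N. wl2_sqnorm (\<lambda>i. \<sigma> m i - \<sigma> n i) < e" if "0 < e" for e
  proof -
    have "0 < sqrt e" using that by simp
    then obtain N where "\<And>m n. N \<le> m \<Longrightarrow> N \<le> n \<Longrightarrow> cdist wl2 (\<sigma> m) (\<sigma> n) < sqrt e"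
      using C unfolding wl2.MCauchy_def by meson
    then show ?thesis by (auto simp: wl2_dist \<sigma>)
  qed
  have "Cauchy (\<lambda>m. \<sigma> m i)" for i
  proof (rule metric_CauchyI)
    fix e :: real assume "0 < e"
    then obtain N where N: "\<And>m n. N \<le> m \<Longrightarrow> N \<le> n \<Longrightarrow> wl2_sqnorm (\<lambda>i. \<sigma> m i - \<sigma> n i) < e\<^sup>2 / 2 ^ i"
      using Cauchy [of "e\<^sup>2 / 2 ^ i"] by auto
    have "dist (\<sigma> m i) (\<sigma> n i) < e" if "N \<le> m" "N \<le> n" for m n
    proof -
      have "(cmod (\<sigma> m i - \<sigma> n i))\<^sup>2 \<le> 2 ^ i * wl2_sqnorm (\<lambda>i. \<sigma> m i - \<sigma> n i)"
        by (rule wl2_coordinate_le(2) [OF wl2_diff [OF \<sigma> \<sigma>]])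
      also have "\<dots> < e\<^sup>2" using N [OF that] by (simp add: field_simps)
      finally show ?thesis using \<open>0 < e\<close> by (simp add: dist_norm power_less_imp_less_base)
    qed
    then show "\<exists>N. \<forall>m\<ge>N. \<forall>n\<ge>N. dist (\<sigma> m i) (\<sigma> n i) < e" by blast
  qed
  then have "\<exists>y. (\<lambda>m. \<sigma> m i) \<longlonglongrightarrow> y" for i
    by (simp add: Cauchy_convergent_iff convergent_def)
  then obtain y where y: "\<And>i. (\<lambda>m. \<sigma> m i) \<longlonglongrightarrow> y i" by metis
  have close: "\<exists>N. \<forall>m\<ge>N. (\<lambda>i. \<sigma> m i - y i) \<in> wl2_set \<and> wl2_sqnorm (\<lambda>i. \<sigma> m i - y i) \<le> e" if "0 < e" for e
  proof -
    obtain N where N: "\<And>m n. N \<le> m \<Longrightarrow> N \<le> n \<Longrightarrow> wl2_sqnorm (\<lambda>i. \<sigma> m i - \<sigma> n i) < e"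
      using Cauchy [OF \<open>0 < e\<close>] by auto
    have "(\<Sum>i<k. (cmod (\<sigma> m i - y i))\<^sup>2 / 2 ^ i) \<le> e" if m: "N \<le> m" for m k
    proof (rule LIMSEQ_le_const2)
      show "(\<lambda>n. \<Sum>i<k. (cmod (\<sigma> m i - \<sigma> n i))\<^sup>2 / 2 ^ i) \<longlonglongrightarrow> (\<Sum>i<k. (cmod (\<sigma> m i - y i))\<^sup>2 / 2 ^ i)"
        by (intro tendsto_intros y) auto
      have "(\<Sum>i<k. (cmod (\<sigma> m i - \<sigma> n i))\<^sup>2 / 2 ^ i) \<le> e" if "N \<le> n" for n
        using wl2_coordinate_le(1) [OF wl2_diff [OF \<sigma> \<sigma>]] N [OF m that] by (meson less_eq_real_def order_trans)
      then show "\<exists>N. \<forall>n\<ge>N. (\<Sum>i<k. (cmod (\<sigma> m i - \<sigma> n i))\<^sup>2 / 2 ^ i) \<le> e" by blast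
    qed
    then show ?thesis using wl2_from_bounded_sums [of "\<lambda>i. \<sigma> m i - y i" e for m] by blast
  qed
  obtain N where "(\<lambda>i. \<sigma> N i - y i) \<in> wl2_set" using close [of 1] by auto
  then have y_in: "y \<in> wl2_set" using wl2_diff [OF \<sigma> [of N], of "\<lambda>i. \<sigma> N i - y i"] by simp
  have "limitin wl2.mtopology \<sigma> y sequentially"
    unfolding wl2.limitin_metric
  proof (intro conjI allI impI)
    fix e :: real assume e: "0 < e"
    then obtain N where N: "\<And>m. N \<le> m \<Longrightarrow> wl2_sqnorm (\<lambda>i. \<sigma> m i - y i) \<le> (e / 2)\<^sup>2"
      using close [of "(e / 2)\<^sup>2"] by auto
    have "cdist wl2 (\<sigma> m) y < e" if "N \<le> m" for m
      using real_sqrt_le_mono [OF N [OF that]] e by (simp add: wl2_dist \<sigma> y_in)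
    then show "\<forall>\<^sub>F m in sequentially. \<sigma> m \<in> wl2_set \<and> cdist wl2 (\<sigma> m) y < e"
      using \<sigma> by (auto simp: eventually_sequentially)
  qed (use y_in in simp)
  then show "\<exists>x. limitin wl2.mtopology \<sigma> x sequentially"
    by (rule exI [of _ y])
qed

lemma wl2_hilbert: "complex_hilbert_space wl2"
  by (intro complex_hilbert_space.intro complex_hilbert_space_axioms.intro wl2_inner_space)
    (simp add: wl2_mcomplete)

section \<open>Truncation and separability\<close>

lemma wl2_finite_support: "(\<And>n. N \<le> n \<Longrightarrow> x n = 0) \<Longrightarrow> x \<in> wl2_set"
  unfolding wl2_set_def mem_Collect_eq by (rule summable_finite [of "{..<N}"]) auto

lemma wl2_truncate_tendsto:
  assumes x: "x \<in> wl2_set"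
  shows "(\<lambda>N. wl2_sqnorm (\<lambda>n. x n - (if n < N then x n else 0))) \<longlonglongrightarrow> 0"
proof -
  let ?f = "\<lambda>n. (cmod (x n))\<^sup>2 / 2 ^ n"
  have sum: "summable ?f" using x by (simp add: wl2_set_def)
  have "wl2_sqnorm (\<lambda>n. x n - (if n < N then x n else 0)) = suminf ?f - sum ?f {..<N}" for N
  proof -
    have "(\<lambda>n. if n < N then ?f n else 0) sums sum ?f {..<N}"
      using sums_If_finite [of "\<lambda>n. n < N" ?f] by (simp add: lessThan_def)
    then have "(\<lambda>n. ?f n - (if n < N then ?f n else 0)) sums (suminf ?f - sum ?f {..<N})"
      by (intro sums_diff summable_sums sum)
    moreover have "?f n - (if n < N then ?f n else 0) = (cmod (x n - (if n < N then x n else 0)))\<^sup>2 / 2 ^ n" for n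
      by simp
    ultimately show ?thesis by (simp add: wl2_sqnorm_def sums_iff)
  qed
  moreover have "(\<lambda>N. suminf ?f - sum ?f {..<N}) \<longlonglongrightarrow> suminf ?f - suminf ?f"
    by (intro tendsto_diff tendsto_const summable_LIMSEQ sum)
  ultimately show ?thesis by simp
qed

lemma wl2_truncate_limitin:
  assumes x: "x \<in> wl2_set"
  shows "limitin (norm_topology wl2) (\<lambda>N n. if n < N then x n else 0) x sequentially"
proof -
  have trunc: "(\<lambda>n. if n < N then x n else 0) \<in> wl2_set" for N
    by (rule wl2_finite_support [of N]) simp
  have "(\<lambda>N. sqrt (wl2_sqnorm (\<lambda>n. x n - (if n < N then x n else 0)))) \<longlonglongrightarrow> sqrt 0"
    by (intro tendsto_real_sqrt wl2_truncate_tendsto x)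
  then have "(\<lambda>N. cdist wl2 (\<lambda>n. if n < N then x n else 0) x) \<longlonglongrightarrow> 0"
    by (subst wl2.commute) (simp add: wl2_dist x trunc)
  then show ?thesis
    unfolding wl2_topology wl2.limitin_metric_dist_null by (simp add: x trunc)
qed

text \<open>Indexing by lists of rational pairs makes countability immediate. The finite support of
  the elements is used again for the full support of the law.\<close>

definition wl2_dense :: "(nat \<Rightarrow> complex) set" where
  "wl2_dense = range (\<lambda>(xs :: (rat \<times> rat) list) n.
     if n < length xs then Complex (of_rat (fst (xs ! n))) (of_rat (snd (xs ! n))) else 0)"

lemma countable_wl2_dense: "countable wl2_dense"
  by (simp add: wl2_dense_def)

lemma wl2_dense_subset: "wl2_dense \<subseteq> wl2_set"
proof
  fix x assume "x \<in> wl2_dense"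
  then obtain xs :: "(rat \<times> rat) list" where
    "x = (\<lambda>n. if n < length xs then Complex (of_rat (fst (xs ! n))) (of_rat (snd (xs ! n))) else 0)"
    by (auto simp: wl2_dense_def)
  then show "x \<in> wl2_set" by (intro wl2_finite_support [of "length xs"]) simp
qed

lemma rational_complex_approx:
  assumes "0 < e"
  shows "\<exists>q r. cmod (z - Complex (of_rat q) (of_rat r)) < e"
proof -
  obtain q where q: "Re z - e / 2 < of_rat q" "of_rat q < Re z" using of_rat_dense [of "Re z - e / 2" "Re z"] assms by auto
  obtain r where r: "Im z - e / 2 < of_rat r" "of_rat r < Im z" using of_rat_dense [of "Im z - e / 2" "Im z"] assms by auto
  have "cmod (z - Complex (of_rat q) (of_rat r)) \<le> \<bar>Re z - of_rat q\<bar> + \<bar>Im z - of_rat r\<bar>"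
    using cmod_le [of "z - Complex (of_rat q) (of_rat r)"] by simp
  also have "\<dots> < e" using q r by linarith
  finally show ?thesis by blast
qed

lemma wl2_dense_approx:
  assumes x: "x \<in> wl2_set" and e: "0 < e"
  shows "\<exists>y\<in>wl2_dense. cdist wl2 x y < e"
proof -
  have "\<forall>\<^sub>F N in sequentially. cdist wl2 (\<lambda>n. if n < N then x n else 0) x < e / 2"
    using wl2_truncate_limitin [OF x] e unfolding wl2_topology wl2.limitin_metric
    by (auto elim: eventually_mono dest!: spec [of _ "e / 2"])
  then obtain N where N: "cdist wl2 (\<lambda>n. if n < N then x n else 0) x < e / 2"
    unfolding eventually_sequentially by blast
  define t where "t n = (if n < N then x n else 0)" for n
  have t: "t \<in> wl2_set" by (rule wl2_finite_support [of N]) (simp add: t_def)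
  \<comment> \<open>\<open>N\<close> coordinates with error below \<open>d\<close> give a squared
    distance of at most N d^2 \<le> ((N + 1) d)^2 = (e / 4)^2; the \<open>+ 1\<close> covers
    \<open>N = 0\<close>.\<close>
  define d where "d = (e / 4) / (real N + 1)"
  have d: "0 < d" using e by (simp add: d_def)
  have "\<forall>n. \<exists>qr :: rat \<times> rat. cmod (x n - Complex (of_rat (fst qr)) (of_rat (snd qr))) < d"
    using rational_complex_approx [OF d] by auto
  then obtain f :: "nat \<Rightarrow> rat \<times> rat"
    where f: "\<And>n. cmod (x n - Complex (of_rat (fst (f n))) (of_rat (snd (f n)))) < d"
    using choice [of "\<lambda>n qr. cmod (x n - Complex (of_rat (fst qr)) (of_rat (snd qr))) < d"] by auto
  define y where "y n = (if n < N then Complex (of_rat (fst (f n))) (of_rat (snd (f n))) else 0)" for n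
  have y: "y \<in> wl2_dense"
    unfolding wl2_dense_def by (rule image_eqI [of _ _ "map f [0..<N]"]) (auto simp: y_def fun_eq_iff)
  have yw: "y \<in> wl2_set" using y wl2_dense_subset by blast
  have "wl2_sqnorm (\<lambda>n. t n - y n) \<le> (e / 4)\<^sup>2"
  proof (rule wl2_from_bounded_sums(2))
    fix M
    have "(cmod (t i - y i))\<^sup>2 / 2 ^ i \<le> (if i < N then d\<^sup>2 else 0)" for i
    proof (cases "i < N")
      case True
      have "(cmod (t i - y i))\<^sup>2 / 2 ^ i \<le> (cmod (t i - y i))\<^sup>2 / 1"
        by (rule divide_left_mono) auto
      also have "\<dots> \<le> d\<^sup>2"
        using f [of i] True by (simp add: t_def y_def power_mono)
      finally show ?thesis using True by simp
    qed (simp add: t_def y_def)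
    then have "(\<Sum>i<M. (cmod (t i - y i))\<^sup>2 / 2 ^ i) \<le> (\<Sum>i<M. if i < N then d\<^sup>2 else 0)"
      by (rule sum_mono)
    also have "\<dots> = (\<Sum>i\<in>{..<M} \<inter> {..<N}. d\<^sup>2)"
      by (intro sum.mono_neutral_cong_right) auto
    also have "\<dots> \<le> real N * d\<^sup>2"
      using card_mono [of "{..<N}" "{..<M} \<inter> {..<N}"] by (simp add: mult_right_mono)
    also have "\<dots> \<le> (real N + 1)\<^sup>2 * d\<^sup>2"
      by (intro mult_right_mono) (auto simp: power2_eq_square algebra_simps)
    also have "\<dots> = (e / 4)\<^sup>2"
    proof -
      have "(real N + 1) * d = e / 4"
      proof -
        have "m * ((e / 4) / m) = e / 4" if "m \<noteq> 0" for m :: real using that by simp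
        then show ?thesis unfolding d_def by (metis add_nonneg_eq_0_iff of_nat_0_le_iff zero_le_one zero_neq_one)
      qed
      then show ?thesis by (simp only: power_mult_distrib [symmetric])
    qed
    finally show "(\<Sum>i<M. (cmod (t i - y i))\<^sup>2 / 2 ^ i) \<le> (e / 4)\<^sup>2" .
  qed
  then have "cdist wl2 t y \<le> e / 4"
    using real_sqrt_le_mono e by (fastforce simp: wl2_dist t yw)
  moreover have "cdist wl2 x t < e / 2"
    using N by (simp add: t_def [abs_def] wl2.commute)
  ultimately have "cdist wl2 x y < e"
    using wl2.triangle [OF x t yw] e by linarith
  then show ?thesis using y by blast
qed

lemma wl2_separable: "separable_space (norm_topology wl2)"
  unfolding separable_space_def wl2_topology
proof (intro exI [of _ wl2_dense] conjI)
  show "wl2.mtopology closure_of wl2_dense = topspace wl2.mtopology"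
    using wl2_dense_approx wl2_dense_subset
    by (force simp: wl2.metric_closure_of wl2.in_mball)
qed (use countable_wl2_dense wl2_dense_subset in auto)

section \<open>The backward shift and continuous functionals\<close>

definition backward_shift :: "(nat \<Rightarrow> complex) \<Rightarrow> nat \<Rightarrow> complex" where
  "backward_shift x = (\<lambda>n. x (Suc n))"

lemma backward_shift_power: "(backward_shift ^^ k) x = (\<lambda>n. x (n + k))"
  by (induction k arbitrary: x) (simp_all add: backward_shift_def)

lemma backward_shift_sqnorm:
  assumes x: "x \<in> wl2_set"
  shows "backward_shift x \<in> wl2_set" "wl2_sqnorm (backward_shift x) \<le> 2 * wl2_sqnorm x"
proof -
  have "(\<Sum>i<N. (cmod (backward_shift x i))\<^sup>2 / 2 ^ i) \<le> 2 * wl2_sqnorm x" for N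
  proof -
    have "(\<Sum>i<N. (cmod (backward_shift x i))\<^sup>2 / 2 ^ i) = 2 * (\<Sum>i<N. (cmod (x (Suc i)))\<^sup>2 / 2 ^ Suc i)"
      by (simp add: sum_distrib_left backward_shift_def)
    also have "\<dots> \<le> 2 * (\<Sum>i<Suc N. (cmod (x i))\<^sup>2 / 2 ^ i)"
      unfolding sum.lessThan_Suc_shift by simp
    also have "\<dots> \<le> 2 * wl2_sqnorm x"
      using wl2_coordinate_le(1) [OF x, of "Suc N"] by (simp del: sum.lessThan_Suc)
    finally show ?thesis .
  qed
  then show "backward_shift x \<in> wl2_set" "wl2_sqnorm (backward_shift x) \<le> 2 * wl2_sqnorm x"
    by (rule wl2_from_bounded_sums)+
qed

lemma backward_shift_bounded: "backward_shift \<in> bounded_operators wl2"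
proof -
  have "cnorm wl2 (backward_shift x) \<le> sqrt 2 * cnorm wl2 x" if "x \<in> wl2_set" for x
    using backward_shift_sqnorm [OF that] that
    by (simp add: wl2_norm flip: real_sqrt_mult)
  then show ?thesis
    unfolding bounded_operators_def using backward_shift_sqnorm(1)
    by (auto simp: backward_shift_def)
qed

text \<open>Continuity along the truncations of \<open>x\<close> reduces a functional to finite
  combinations of coordinates; this takes the place of a Riesz representation.\<close>

lemma wl2_functional_limit:
  assumes \<phi>: "\<phi> \<in> continuous_functionals wl2" and x: "x \<in> wl2_set"
  shows "(\<lambda>N. \<Sum>n<N. x n * \<phi> (\<lambda>m. of_bool (m = n))) \<longlonglongrightarrow> \<phi> x"
proof -
  define e :: "nat \<Rightarrow> nat \<Rightarrow> complex" where "e n = (\<lambda>m. of_bool (m = n))" for n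
  have e: "e n \<in> wl2_set" for n by (rule wl2_finite_support [of "Suc n"]) (simp add: e_def)
  have add: "\<phi> (\<lambda>n. y n + z n) = \<phi> y + \<phi> z" if "y \<in> wl2_set" "z \<in> wl2_set" for y z
    using \<phi> that by (auto simp: continuous_functionals_def)
  have scale: "\<phi> (\<lambda>n. a * y n) = a * \<phi> y" if "y \<in> wl2_set" for a y
    using \<phi> that by (auto simp: continuous_functionals_def)
  have "\<phi> (\<lambda>n. if n < N then x n else 0) = (\<Sum>n<N. x n * \<phi> (e n))" for N
  proof (induction N)
    case 0
    show ?case using scale [OF wl2_zero, of 0] by simp
  next
    case (Suc N)
    have "(\<lambda>n. if n < N then x n else 0) \<in> wl2_set" by (rule wl2_finite_support [of N]) simp
    moreover have "(\<lambda>n. if n < Suc N then x n else 0) = (\<lambda>n. (if n < N then x n else 0) + x N * e N n)"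
      by (auto simp: e_def fun_eq_iff less_Suc_eq)
    ultimately show ?case using add wl2_scale [OF e] scale [OF e] Suc by simp
  qed
  moreover have "continuous_map (norm_topology wl2) euclidean \<phi>"
    using \<phi> by (simp add: continuous_functionals_def)
  then have "(\<lambda>N. \<phi> (\<lambda>n. if n < N then x n else 0)) \<longlonglongrightarrow> \<phi> x"
    using continuous_map_limit [OF _ wl2_truncate_limitin [OF x], of euclidean \<phi>]
    by (simp add: o_def limitin_canonical_iff)
  ultimately show ?thesis by (simp add: e_def)
qed

lemma wl2_coordinate_continuous: "continuous_map (norm_topology wl2) euclidean (\<lambda>x. x i)"
  unfolding wl2_topology
proof (subst wl2.metric_continuous_map [OF Met_TC.Metric_space_axioms, unfolded mtopology_is_euclidean])
  show "(\<lambda>x. x i) ` wl2_set \<subseteq> UNIV \<and>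
    (\<forall>a\<in>wl2_set. \<forall>\<epsilon>>0. \<exists>\<delta>>0. \<forall>x. x \<in> wl2_set \<and> cdist wl2 a x < \<delta> \<longrightarrow> dist (a i) (x i) < \<epsilon>)"
  proof (intro conjI ballI allI impI)
    fix a and \<epsilon> :: real assume a: "a \<in> wl2_set" and "0 < \<epsilon>"
    have "dist (a i) (x i) < \<epsilon>" if x: "x \<in> wl2_set" and "cdist wl2 a x < \<epsilon> / sqrt (2 ^ i)" for x
    proof -
      have "dist (a i) (x i) = sqrt ((cmod (a i - x i))\<^sup>2)" by (simp add: dist_norm)
      also have "\<dots> \<le> sqrt (2 ^ i * wl2_sqnorm (\<lambda>n. a n - x n))"
        using wl2_coordinate_le(2) [OF wl2_diff [OF a x], of i] by (rule real_sqrt_le_mono)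
      also have "\<dots> = sqrt (2 ^ i) * cdist wl2 a x" by (simp add: real_sqrt_mult wl2_dist a x)
      also have "\<dots> < \<epsilon>" using that by (simp add: field_simps)
      finally show ?thesis .
    qed
    then show "\<exists>\<delta>>0. \<forall>x. x \<in> wl2_set \<and> cdist wl2 a x < \<delta> \<longrightarrow> dist (a i) (x i) < \<epsilon>"
      using \<open>0 < \<epsilon>\<close> by (intro exI [of _ "\<epsilon> / sqrt (2 ^ i)"]) auto
  qed simp
qed

section \<open>Infinite dimension\<close>

text \<open>Gaussian elimination with the pivot \<open>s p\<close>: the reduced equations no longer
  involve the unknown \<open>p\<close>, whose value is recovered from the equation \<open>s\<close>.
  Equations that become equal under \<open>red\<close> only lower the number of equations.\<close>

lemma homogeneous_system_nontrivial:
  fixes S :: "('i \<Rightarrow> 'k :: field) set"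
  assumes "finite I" "finite S" "card S < card I"
  shows "\<exists>c. (\<exists>i\<in>I. c i \<noteq> 0) \<and> (\<forall>s\<in>S. (\<Sum>i\<in>I. c i * s i) = 0)"
  using assms
proof (induction "card S" arbitrary: S I rule: less_induct)
  case less
  show ?case
  proof (cases "\<exists>s\<in>S. \<exists>p\<in>I. s p \<noteq> 0")
    case False
    moreover obtain i where "i \<in> I" using less.prems by (metis card.empty ex_in_conv not_less_zero)
    ultimately show ?thesis by (intro exI [of _ "\<lambda>_. 1"]) auto
  next
    case True
    then obtain s p where sp: "s \<in> S" "p \<in> I" "s p \<noteq> 0" by blast
    define red where "red t i = t i - t p * s i / s p" for t :: "'i \<Rightarrow> 'k" and i
    define S' where "S' = red ` (S - {s})"
    have card: "card S' < card S"
      unfolding S'_def using less.prems sp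
      by (metis card_Diff1_less card_image_le finite_Diff le_less_trans)
    have "card S' \<le> card (S - {s})"
      unfolding S'_def using less.prems by (intro card_image_le) simp
    also have "\<dots> < card (I - {p})"
    proof -
      have "0 < card S" using less.prems sp by (auto simp: card_gt_0_iff)
      then show ?thesis using less.prems sp by (simp add: card_Diff_singleton diff_less_mono)
    qed
    finally have "\<exists>c. (\<exists>i\<in>I - {p}. c i \<noteq> 0) \<and> (\<forall>s\<in>S'. (\<Sum>i\<in>I - {p}. c i * s i) = 0)"
      using less.prems by (intro less.hyps card) (auto simp: S'_def)
    then obtain c where c: "\<exists>i\<in>I - {p}. c i \<noteq> 0" "\<And>t. t \<in> S' \<Longrightarrow> (\<Sum>i\<in>I - {p}. c i * t i) = 0"
      by blast
    define w where "w = (\<Sum>i\<in>I - {p}. c i * s i)"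
    define c' where "c' i = (if i = p then - w / s p else c i)" for i
    have sum: "(\<Sum>i\<in>I. c' i * t i) = (\<Sum>i\<in>I - {p}. c i * t i) - w * t p / s p" for t
    proof -
      have "(\<Sum>i\<in>I. c' i * t i) = c' p * t p + (\<Sum>i\<in>I - {p}. c' i * t i)"
        using less.prems sp by (intro sum.remove) auto
      also have "(\<Sum>i\<in>I - {p}. c' i * t i) = (\<Sum>i\<in>I - {p}. c i * t i)"
        by (intro sum.cong) (auto simp: c'_def)
      finally show ?thesis by (simp add: c'_def)
    qed
    have "(\<Sum>i\<in>I. c' i * t i) = 0" if t: "t \<in> S" for t
    proof (cases "t = s")
      case True
      then show ?thesis using sp by (simp add: sum w_def)
    next
      case False
      then have "0 = (\<Sum>i\<in>I - {p}. c i * red t i)" using c(2) [of "red t"] t by (simp add: S'_def)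
      also have "\<dots> = (\<Sum>i\<in>I - {p}. c i * t i - (c i * s i) * (t p / s p))"
        by (intro sum.cong refl) (simp add: red_def algebra_simps)
      also have "\<dots> = (\<Sum>i\<in>I - {p}. c i * t i) - w * (t p / s p)"
        by (simp only: sum_subtractf w_def sum_distrib_right)
      finally show ?thesis by (simp add: sum)
    qed
    moreover have "\<exists>i\<in>I. c' i \<noteq> 0" using c(1) by (auto simp: c'_def)
    ultimately show ?thesis by blast
  qed
qed

text \<open>Some nonzero vector \<open>a\<close> on the first card S + 1 coordinates annihilates a
  finite \<open>S\<close> and hence its span, but not the unit vector at an index \<open>i\<close>
  with \<open>a i \<noteq> 0\<close>.\<close>

lemma wl2_infinite_dimensional: "infinite_dimensional wl2"
  unfolding infinite_dimensional_def
proof (intro notI, elim exE conjE)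
  fix S assume S: "finite S" "S \<subseteq> carrier wl2"
    and span: "\<forall>x\<in>carrier wl2. \<exists>c. x = finsum wl2 (\<lambda>s. c s \<odot>\<^bsub>wl2\<^esub> s) S"
  have M: "abelian_monoid wl2"
    using wl2_inner_space by (simp add: complex_inner_space_def Module.module_def abelian_group_def)
  have finsum: "finsum wl2 (\<lambda>s. c s \<odot>\<^bsub>wl2\<^esub> s) S' = (\<lambda>i. \<Sum>s\<in>S'. c s * s i)"
    if "S' \<subseteq> carrier wl2" "finite S'" for c S'
    using that(2,1)
  proof (induction S')
    case empty
    then show ?case using abelian_monoid.finsum_empty [OF M] by simp
  next
    case (insert s S')
    then show ?case
      using abelian_monoid.finsum_insert [OF M insert.hyps, of "\<lambda>s. c s \<odot>\<^bsub>wl2\<^esub> s"]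
      by (auto simp: Pi_iff subset_iff intro!: wl2_scale)
  qed
  obtain a where a: "\<exists>i<Suc (card S). a i \<noteq> 0" "\<And>s. s \<in> S \<Longrightarrow> (\<Sum>i<Suc (card S). a i * s i) = 0"
    using homogeneous_system_nontrivial [OF finite_lessThan S(1), of "Suc (card S)"] by auto
  then obtain i where i: "i < Suc (card S)" "a i \<noteq> 0" by blast
  have "(\<lambda>m. of_bool (m = i)) \<in> carrier wl2"
    using wl2_finite_support [of "Suc i" "\<lambda>m. of_bool (m = i)"] by simp
  then obtain c where "(\<lambda>m. of_bool (m = i)) = finsum wl2 (\<lambda>s. c s \<odot>\<^bsub>wl2\<^esub> s) S"
    using span by blast
  then have c: "of_bool (m = i) = (\<Sum>s\<in>S. c s * s m)" for m
    using finsum [OF S(2,1), of c] by (metis (no_types))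
  have "a i = (\<Sum>m<Suc (card S). a m * of_bool (m = i))" using i by simp
  also have "\<dots> = (\<Sum>m<Suc (card S). \<Sum>s\<in>S. c s * (a m * s m))"
    unfolding c by (simp only: sum_distrib_left mult.left_commute)
  also have "\<dots> = (\<Sum>s\<in>S. c s * (\<Sum>m<Suc (card S). a m * s m))"
    by (subst sum.swap) (simp only: sum_distrib_left)
  also have "\<dots> = 0" by (intro sum.neutral) (simp add: a(2) del: sum.lessThan_Suc)
  finally show False using i by simp
qed

section \<open>The Borel sets of the sequence space\<close>

lemma borel_wl2_space [simp]: "space (borel_on wl2) = wl2_set"
  by (simp add: borel_on_def space_measure_of_conv)

lemma borel_wl2_openin: "openin (norm_topology wl2) U \<Longrightarrow> U \<in> sets (borel_on wl2)"
  using openin_subset [of "norm_topology wl2"]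
  by (auto simp: borel_on_def wl2_topology intro!: sigma_sets.Basic)

text \<open>Second countability in a concrete form: questions about open sets reduce to balls around
  the points of \<open>wl2_dense\<close>.\<close>

lemma wl2_open_countable_union:
  assumes "openin (norm_topology wl2) U"
  shows "U = (\<Union>(d, k)\<in>{(d, k). d \<in> wl2_dense \<and> wl2.mball d (1 / real (Suc k)) \<subseteq> U}. wl2.mball d (1 / real (Suc k)))"
proof (intro equalityI subsetI)
  fix x assume x: "x \<in> U"
  then obtain r where r: "0 < r" "wl2.mball x r \<subseteq> U"
    using assms unfolding wl2_topology wl2.openin_mtopology by blast
  have xw: "x \<in> wl2_set" using x assms openin_subset [of "norm_topology wl2" U] by (auto simp: wl2_topology)
  \<comment> \<open>A ball of radius below r/2 that contains \<open>x\<close> lies within distance r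
    of \<open>x\<close>, wherever its centre is.\<close>
  obtain k where k: "1 / real (Suc k) < r / 2" using reals_Archimedean [of "r / 2"] r(1) by (auto simp: inverse_eq_divide)
  obtain d where d: "d \<in> wl2_dense" "cdist wl2 x d < 1 / real (Suc k)"
    using wl2_dense_approx [OF xw, of "1 / real (Suc k)"] by auto
  have dw: "d \<in> wl2_set" using d(1) wl2_dense_subset by blast
  have "wl2.mball d (1 / real (Suc k)) \<subseteq> wl2.mball x r"
  proof
    fix y assume "y \<in> wl2.mball d (1 / real (Suc k))"
    then have y: "y \<in> wl2_set" "cdist wl2 d y < 1 / real (Suc k)" by (auto simp: wl2.in_mball)
    have "cdist wl2 x y < r" using wl2.triangle [OF xw dw y(1)] y(2) d(2) k by linarith
    then show "y \<in> wl2.mball x r" using xw y(1) by (simp add: wl2.in_mball)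
  qed
  moreover have "x \<in> wl2.mball d (1 / real (Suc k))"
    using d(2) xw dw by (simp add: wl2.in_mball wl2.commute)
  ultimately show "x \<in> (\<Union>(d, k)\<in>{(d, k). d \<in> wl2_dense \<and> wl2.mball d (1 / real (Suc k)) \<subseteq> U}. wl2.mball d (1 / real (Suc k)))"
    using r(2) d(1) by (intro UN_I [of "(d, k)"]) auto
qed auto

text \<open>The distance to a fixed point is a series in the coordinates, so preimages of balls are
  measurable, and countably many balls make up an open set.\<close>

lemma measurable_borel_wl2I:
  assumes F: "\<And>\<omega>. \<omega> \<in> space N \<Longrightarrow> F \<omega> \<in> wl2_set" and [measurable]: "\<And>i. (\<lambda>\<omega>. F \<omega> i) \<in> borel_measurable N"
  shows "F \<in> N \<rightarrow>\<^sub>M borel_on wl2"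
  unfolding borel_on_def
proof (rule measurable_measure_of)
  show "{U. openin (norm_topology wl2) U} \<subseteq> Pow (carrier wl2)"
    using openin_subset [of "norm_topology wl2"] by (auto simp: wl2_topology)
  show "F \<in> space N \<rightarrow> carrier wl2" using F by simp
  fix U assume "U \<in> {U. openin (norm_topology wl2) U}"
  then have U: "openin (norm_topology wl2) U" by simp
  have ball: "F -` wl2.mball d r \<inter> space N \<in> sets N" if d: "d \<in> wl2_set" for d r
  proof -
    have "F -` wl2.mball d r \<inter> space N = {\<omega> \<in> space N. sqrt (\<Sum>n. (cmod (d n - F \<omega> n))\<^sup>2 / 2 ^ n) < r}"
      using F d by (auto simp: wl2.in_mball wl2_dist wl2_sqnorm_def)
    also have "\<dots> \<in> sets N" by measurable
    finally show ?thesis .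
  qed
  define J where "J = {(d, k). d \<in> wl2_dense \<and> wl2.mball d (1 / real (Suc k)) \<subseteq> U}"
  have "J \<subseteq> wl2_dense \<times> UNIV" by (auto simp: J_def)
  then have "countable J" by (rule countable_subset) (simp add: countable_wl2_dense)
  have J: "fst p \<in> wl2_set" if "p \<in> J" for p
    using that wl2_dense_subset by (auto simp: J_def)
  have eq: "U = (\<Union>p\<in>J. wl2.mball (fst p) (1 / real (Suc (snd p))))"
    using wl2_open_countable_union [OF U] by (simp only: J_def case_prod_unfold)
  have "F -` U \<inter> space N = (\<Union>p\<in>J. F -` wl2.mball (fst p) (1 / real (Suc (snd p))) \<inter> space N)"
    by (subst eq) blast
  also have "\<dots> \<in> sets N"
    using \<open>countable J\<close> J by (intro sets.countable_UN') (auto intro: ball)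
  finally show "F -` U \<inter> space N \<in> sets N" .
qed

lemma wl2_coordinate_measurable: "(\<lambda>x. x i) \<in> borel_measurable (borel_on wl2)"
proof (rule borel_measurableI)
  fix S :: "complex set" assume "open S"
  then have "openin (norm_topology wl2) {x \<in> topspace (norm_topology wl2). x i \<in> S}"
    using wl2_coordinate_continuous [of i] by (simp add: continuous_map_def)
  moreover have "(\<lambda>x. x i) -` S \<inter> space (borel_on wl2) = {x \<in> topspace (norm_topology wl2). x i \<in> S}"
    by (auto simp: wl2_topology)
  ultimately show "(\<lambda>x. x i) -` S \<inter> space (borel_on wl2) \<in> sets (borel_on wl2)"
    using borel_wl2_openin by simp
qed

lemma functional_measurable:
  assumes "\<phi> \<in> continuous_functionals wl2"
  shows "\<phi> \<in> borel_measurable (borel_on wl2)"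
proof (rule borel_measurableI)
  fix S :: "complex set" assume "open S"
  then have "openin (norm_topology wl2) {x \<in> topspace (norm_topology wl2). \<phi> x \<in> S}"
    using assms by (simp add: continuous_map_def continuous_functionals_def)
  moreover have "\<phi> -` S \<inter> space (borel_on wl2) = {x \<in> topspace (norm_topology wl2). \<phi> x \<in> S}"
    by (auto simp: wl2_topology)
  ultimately show "\<phi> -` S \<inter> space (borel_on wl2) \<in> sets (borel_on wl2)"
    using borel_wl2_openin by simp
qed

section \<open>Stone--Weierstrass density and characteristic functions\<close>

context prob_space
begin

lemma square_integrableI_bounded:
  assumes "f \<in> borel_measurable M" "\<And>x. x \<in> space M \<Longrightarrow> cmod (f x) \<le> B"
  shows "f \<in> square_integrable M"
proof -
  have "AE x in M. norm ((cmod (f x))\<^sup>2) \<le> B\<^sup>2"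
    using assms(2) by (intro AE_I2) (simp add: power_mono)
  then show ?thesis
    using assms(1) unfolding square_integrable_def by (auto intro!: integrable_const_bound)
qed

lemma square_integrable_add:
  assumes "f \<in> square_integrable M" "g \<in> square_integrable M"
  shows "(\<lambda>x. f x + g x) \<in> square_integrable M"
proof -
  have [measurable]: "f \<in> borel_measurable M" "g \<in> borel_measurable M"
    using assms by (auto simp: square_integrable_def)
  have "integrable M (\<lambda>x. 2 * (cmod (f x))\<^sup>2 + 2 * (cmod (g x))\<^sup>2)"
    using assms by (auto simp: square_integrable_def)
  then have "integrable M (\<lambda>x. (cmod (f x + g x))\<^sup>2)"
    by (rule Bochner_Integration.integrable_bound) (use cmod_add_sq_le in auto)
  then show ?thesis by (simp add: square_integrable_def)
qed

lemma square_integrable_scale: "f \<in> square_integrable M \<Longrightarrow> (\<lambda>x. c * f x) \<in> square_integrable M"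
  by (auto simp: square_integrable_def norm_mult power_mult_distrib)

lemma square_integrable_diff:
  "f \<in> square_integrable M \<Longrightarrow> g \<in> square_integrable M \<Longrightarrow> (\<lambda>x. f x - g x) \<in> square_integrable M"
  using square_integrable_add [of f "\<lambda>x. - 1 * g x"] square_integrable_scale [of g "- 1"] by simp

lemma square_integrable_sum:
  "(\<And>i. i \<in> I \<Longrightarrow> f i \<in> square_integrable M) \<Longrightarrow> (\<lambda>x. \<Sum>i\<in>I. f i x) \<in> square_integrable M"
  by (induction I rule: infinite_finite_induct) (auto intro: square_integrable_add square_integrableI_bounded [of _ 0])

text \<open>A triangle inequality for squared distances. Its factor 2 is the reason for the errors e
  / 4 in the approximation arguments below.\<close>

lemma integral_sq_diff_le:
  assumes "f \<in> square_integrable M" "g \<in> square_integrable M" "h \<in> square_integrable M"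
  shows "(LINT x|M. (cmod (f x - h x))\<^sup>2) \<le> 2 * (LINT x|M. (cmod (f x - g x))\<^sup>2) + 2 * (LINT x|M. (cmod (g x - h x))\<^sup>2)"
proof -
  have int: "integrable M (\<lambda>x. (cmod (f x - g x))\<^sup>2)" "integrable M (\<lambda>x. (cmod (g x - h x))\<^sup>2)"
      "integrable M (\<lambda>x. (cmod (f x - h x))\<^sup>2)"
    using square_integrable_diff assms by (auto simp: square_integrable_def)
  have "(LINT x|M. (cmod (f x - h x))\<^sup>2) \<le> (LINT x|M. 2 * (cmod (f x - g x))\<^sup>2 + 2 * (cmod (g x - h x))\<^sup>2)"
    using int cmod_add_sq_le [of "f x - g x" "g x - h x" for x] by (intro integral_mono) auto
  then show ?thesis using int by simp
qed

lemma square_integrable_imp_L1: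
  assumes "u \<in> square_integrable M" shows "integrable M u"
proof -
  have [measurable]: "u \<in> borel_measurable M" and sq: "integrable M (\<lambda>x. (cmod (u x))\<^sup>2)"
    using assms by (auto simp: square_integrable_def)
  have "cmod (u x) \<le> 1 + (cmod (u x))\<^sup>2" for x
    using sum_squares_bound [of 1 "cmod (u x)"] norm_ge_zero [of "u x"] unfolding one_power2 by linarith
  then show ?thesis
    using sq by - (rule Bochner_Integration.integrable_bound [of M "\<lambda>x. 1 + (cmod (u x))\<^sup>2"], auto)
qed

lemma L1_le_L2:
  assumes u: "u \<in> square_integrable M" and e: "0 < e" and le: "(LINT x|M. (cmod (u x))\<^sup>2) \<le> e\<^sup>2"
  shows "(LINT x|M. cmod (u x)) \<le> e"
proof -
  have sq: "integrable M (\<lambda>x. (cmod (u x))\<^sup>2)" using u by (simp add: square_integrable_def)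
  have "cmod (u x) \<le> (e + (cmod (u x))\<^sup>2 / e) / 2" for x
    using sum_squares_bound [of e "cmod (u x)"] e by (simp add: field_simps power2_eq_square)
  then have "(LINT x|M. cmod (u x)) \<le> (LINT x|M. (e + (cmod (u x))\<^sup>2 / e) / 2)"
    using sq square_integrable_imp_L1 [OF u] by (intro integral_mono integrable_norm) simp_all
  also have "\<dots> = (e + (LINT x|M. (cmod (u x))\<^sup>2) / e) / 2"
    using sq by (simp add: prob_space)
  also have "\<dots> \<le> e" using le e by (simp add: field_simps power2_eq_square)
  finally show ?thesis .
qed

lemma bounded_limit_L2:
  fixes f :: "'a \<Rightarrow> complex"
  assumes [measurable]: "\<And>n. F n \<in> borel_measurable M" "f \<in> borel_measurable M"
    and B: "integrable M B" "\<And>n x. x \<in> space M \<Longrightarrow> (cmod (f x - F n x))\<^sup>2 \<le> B x"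
    and lim: "\<And>x. x \<in> space M \<Longrightarrow> (\<lambda>n. F n x) \<longlonglongrightarrow> f x"
  shows "(\<lambda>n. LINT x|M. (cmod (f x - F n x))\<^sup>2) \<longlonglongrightarrow> 0"
proof -
  have "(\<lambda>n. LINT x|M. (cmod (f x - F n x))\<^sup>2) \<longlonglongrightarrow> (LINT x|M. 0 :: real)"
  proof (rule integral_dominated_convergence [OF _ _ B(1)])
    have "(\<lambda>n. (cmod (f x - F n x))\<^sup>2) \<longlonglongrightarrow> (cmod (f x - f x))\<^sup>2" if "x \<in> space M" for x
      by (intro tendsto_intros lim that)
    then show "AE x in M. (\<lambda>n. (cmod (f x - F n x))\<^sup>2) \<longlonglongrightarrow> 0" by (auto intro!: AE_I2)
  qed (use B in auto)
  then show ?thesis by simp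
qed

text \<open>Simple functions bounded by twice |f| converge pointwise to \<open>f\<close>, and 9
  |f|^2 dominates the squared errors. The limit case asks only for approximation in mean square,
  which is how the rule is applied later.\<close>

lemma square_integrable_induct [consumes 1, case_names indicator add scale limit]:
  fixes f :: "'a \<Rightarrow> complex"
  assumes f: "f \<in> square_integrable M"
    and ind: "\<And>S. S \<in> sets M \<Longrightarrow> P (\<lambda>x. of_bool (x \<in> S))"
    and add: "\<And>f g. f \<in> square_integrable M \<Longrightarrow> g \<in> square_integrable M \<Longrightarrow> P f \<Longrightarrow> P g \<Longrightarrow> P (\<lambda>x. f x + g x)"
    and scale: "\<And>f c. f \<in> square_integrable M \<Longrightarrow> P f \<Longrightarrow> P (\<lambda>x. c * f x)"
    and limit: "\<And>f. f \<in> square_integrable M \<Longrightarrow>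
      (\<And>e. 0 < e \<Longrightarrow> \<exists>g\<in>square_integrable M. P g \<and> (LINT x|M. (cmod (f x - g x))\<^sup>2) < e) \<Longrightarrow> P f"
  shows "P f"
proof -
  have ind_sq: "(\<lambda>x. of_bool (x \<in> S)) \<in> square_integrable M" if "S \<in> sets M" for S
    using that by (intro square_integrableI_bounded [of _ 1]) auto
  have sum: "P (\<lambda>x. \<Sum>y\<in>Y. c y * of_bool (x \<in> S y))" if "finite Y" "\<And>y. y \<in> Y \<Longrightarrow> S y \<in> sets M" for c S and Y :: "complex set"
    using that
  proof (induction Y)
    case empty
    show ?case using scale [OF ind_sq ind, of "{}" 0] by simp
  next
    case (insert y Y)
    show ?case
      unfolding sum.insert [OF insert.hyps]
    proof (rule add)
      show "P (\<lambda>x. \<Sum>y\<in>Y. c y * of_bool (x \<in> S y))" using insert by simp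
    qed (use insert.prems in \<open>auto intro!: square_integrable_sum square_integrable_scale ind_sq scale ind\<close>)
  qed
  have [measurable]: "f \<in> borel_measurable M" using f by (simp add: square_integrable_def)
  have "\<exists>F. (\<forall>i. simple_function M (F i)) \<and> (\<forall>x\<in>space M. (\<lambda>i. F i x) \<longlonglongrightarrow> f x) \<and>
      (\<forall>i. \<forall>x\<in>space M. norm (F i x) \<le> 2 * norm (f x))"
    using borel_measurable_implies_sequence_metric [of f M 0] by simp
  then obtain F where F: "\<And>i. simple_function M (F i)" "\<And>x. x \<in> space M \<Longrightarrow> (\<lambda>i. F i x) \<longlonglongrightarrow> f x"
      "\<And>i x. x \<in> space M \<Longrightarrow> norm (F i x) \<le> 2 * norm (f x)"
    by blast
  have Fm [measurable]: "F i \<in> borel_measurable M" for i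
    using F(1) by (rule borel_measurable_simple_function)
  \<comment> \<open>\<open>P\<close> may depend on values off \<open>space M\<close>, where
    \<open>F i\<close> is not controlled. \<open>G i\<close> is literally a combination of
    indicators, and agrees with \<open>F i\<close> on the space.\<close>
  define G where "G i x = (\<Sum>y\<in>F i ` space M. y * of_bool (x \<in> F i -` {y} \<inter> space M))" for i x
  have G: "G i x = F i x" if "x \<in> space M" for i x
  proof -
    have "G i x = (\<Sum>y\<in>F i ` space M. if y = F i x then y else 0)"
      unfolding G_def using that by (intro sum.cong) auto
    also have "\<dots> = F i x"
      using simple_functionD(1) [OF F(1)] that by (simp add: sum.delta')
    finally show ?thesis .
  qed
  have GP: "P (G i)" for i
    unfolding G_def [abs_def] using simple_functionD [OF F(1)] by (intro sum) auto
  have Gsq: "G i \<in> square_integrable M" for i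
    unfolding G_def [abs_def] using simple_functionD [OF F(1)]
    by (intro square_integrable_sum square_integrable_scale ind_sq) auto
  have "(cmod (f x - F i x))\<^sup>2 \<le> 9 * (cmod (f x))\<^sup>2" if "x \<in> space M" for i x
  proof -
    have "cmod (f x - F i x) \<le> 3 * cmod (f x)"
      using norm_triangle_ineq4 [of "f x" "F i x"] F(3) [OF that, of i] by linarith
    then have "(cmod (f x - F i x))\<^sup>2 \<le> (3 * cmod (f x))\<^sup>2" by (rule power_mono) simp
    then show ?thesis by (simp add: power_mult_distrib)
  qed
  then have "(\<lambda>i. LINT x|M. (cmod (f x - F i x))\<^sup>2) \<longlonglongrightarrow> 0"
    using F(2) f by (intro bounded_limit_L2 [where B = "\<lambda>x. 9 * (cmod (f x))\<^sup>2"]) (auto simp: square_integrable_def)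
  moreover have "(LINT x|M. (cmod (f x - F i x))\<^sup>2) = (LINT x|M. (cmod (f x - G i x))\<^sup>2)" for i
    by (intro Bochner_Integration.integral_cong refl) (simp add: G)
  ultimately have lim: "(\<lambda>i. LINT x|M. (cmod (f x - G i x))\<^sup>2) \<longlonglongrightarrow> 0" by simp
  show ?thesis
  proof (rule limit [OF f])
    fix e :: real assume "0 < e"
    then have "\<forall>\<^sub>F i in sequentially. (LINT x|M. (cmod (f x - G i x))\<^sup>2) < e"
      using order_tendstoD(2) [OF lim] by simp
    then obtain i where "(LINT x|M. (cmod (f x - G i x))\<^sup>2) < e"
      unfolding eventually_sequentially by blast
    then show "\<exists>g\<in>square_integrable M. P g \<and> (LINT x|M. (cmod (f x - g x))\<^sup>2) < e"
      using GP Gsq by blast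
  qed
qed

end

text \<open>The Stone--Weierstrass argument behind the density of trigonometric polynomials is carried out
  for an arbitrary algebra \<open>T\<close> of bounded functions on a probability space.\<close>

locale bounded_function_algebra = prob_space M for M :: "'a measure" +
  fixes T :: "('a \<Rightarrow> complex) set"
  assumes T_measurable: "p \<in> T \<Longrightarrow> p \<in> borel_measurable M"
    and T_bounded: "p \<in> T \<Longrightarrow> \<exists>B. \<forall>x\<in>space M. cmod (p x) \<le> B"
    and T_const: "(\<lambda>x. c) \<in> T"
    and T_add: "p \<in> T \<Longrightarrow> q \<in> T \<Longrightarrow> (\<lambda>x. p x + q x) \<in> T"
    and T_mult: "p \<in> T \<Longrightarrow> q \<in> T \<Longrightarrow> (\<lambda>x. p x * q x) \<in> T"
begin

lemma T_square_integrable: "p \<in> T \<Longrightarrow> p \<in> square_integrable M"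
  using T_measurable T_bounded square_integrableI_bounded by blast

text \<open>Bounded functions in the L2 closure of \<open>T\<close>. Boundedness is part of the
  notion so that products stay inside.\<close>

definition approximable :: "('a \<Rightarrow> complex) \<Rightarrow> bool" where
  "approximable f \<longleftrightarrow> f \<in> borel_measurable M \<and> (\<exists>B. \<forall>x\<in>space M. cmod (f x) \<le> B) \<and>
     (\<forall>e>0. \<exists>p\<in>T. (LINT x|M. (cmod (f x - p x))\<^sup>2) < e)"

lemma approximable_square_integrable: "approximable f \<Longrightarrow> f \<in> square_integrable M"
  unfolding approximable_def using square_integrableI_bounded by blast

lemma approximable_T: "p \<in> T \<Longrightarrow> approximable p"
  unfolding approximable_def using T_measurable T_bounded by (auto intro!: bexI [of _ p])

lemma approximable_closed:
  assumes f: "f \<in> borel_measurable M" "\<And>x. x \<in> space M \<Longrightarrow> cmod (f x) \<le> B"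
    and ap: "\<And>e. 0 < e \<Longrightarrow> \<exists>g. approximable g \<and> (LINT x|M. (cmod (f x - g x))\<^sup>2) < e"
  shows "approximable f"
  unfolding approximable_def
proof (intro conjI allI impI)
  fix e :: real assume "0 < e"
  then obtain g where g: "approximable g" "(LINT x|M. (cmod (f x - g x))\<^sup>2) < e / 4"
    using ap [of "e / 4"] by auto
  then obtain p where p: "p \<in> T" "(LINT x|M. (cmod (g x - p x))\<^sup>2) < e / 4"
    using \<open>0 < e\<close> unfolding approximable_def by (meson divide_pos_pos zero_less_numeral)
  have "(LINT x|M. (cmod (f x - p x))\<^sup>2) < e"
    using integral_sq_diff_le [of f g p] g p T_square_integrable approximable_square_integrable
      square_integrableI_bounded [OF f] by fastforce
  then show "\<exists>p\<in>T. (LINT x|M. (cmod (f x - p x))\<^sup>2) < e" using p(1) by blast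
qed (use f in auto)

lemma approximable_cong:
  assumes "approximable f" "\<And>x. x \<in> space M \<Longrightarrow> f x = g x"
  shows "approximable g"
proof -
  have "f \<in> borel_measurable M \<longleftrightarrow> g \<in> borel_measurable M"
    using assms(2) by (rule measurable_cong)
  moreover have "(LINT x|M. (cmod (f x - p x))\<^sup>2) = (LINT x|M. (cmod (g x - p x))\<^sup>2)" for p
    using assms(2) by (intro Bochner_Integration.integral_cong) auto
  ultimately show ?thesis using assms unfolding approximable_def by simp
qed

lemma approximable_limit:
  assumes F: "\<And>n. approximable (F n)" "\<And>n x. x \<in> space M \<Longrightarrow> cmod (F n x) \<le> B"
    and f: "f \<in> borel_measurable M" and lim: "\<And>x. x \<in> space M \<Longrightarrow> (\<lambda>n. F n x) \<longlonglongrightarrow> f x"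
  shows "approximable f"
proof -
  have fB: "cmod (f x) \<le> B" if "x \<in> space M" for x
    by (rule LIMSEQ_le_const2 [OF tendsto_norm [OF lim [OF that]]]) (use F(2) that in auto)
  have Fm: "F n \<in> borel_measurable M" for n using F(1) by (auto simp: approximable_def)
  have "(cmod (f x - F n x))\<^sup>2 \<le> (2 * B)\<^sup>2" if "x \<in> space M" for n x
    using norm_triangle_ineq4 [of "f x" "F n x"] fB [OF that] F(2) [OF that, of n]
    by (intro power_mono) auto
  then have conv: "(\<lambda>n. LINT x|M. (cmod (f x - F n x))\<^sup>2) \<longlonglongrightarrow> 0"
    using Fm f lim by (intro bounded_limit_L2 [where B = "\<lambda>x. (2 * B)\<^sup>2"]) auto
  show ?thesis
  proof (rule approximable_closed [OF f fB])
    fix e :: real assume "0 < e"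
    then have "\<forall>\<^sub>F n in sequentially. (LINT x|M. (cmod (f x - F n x))\<^sup>2) < e"
      using order_tendstoD(2) [OF conv] by simp
    then obtain n where "(LINT x|M. (cmod (f x - F n x))\<^sup>2) < e"
      unfolding eventually_sequentially by blast
    then show "\<exists>g. approximable g \<and> (LINT x|M. (cmod (f x - g x))\<^sup>2) < e" using F(1) by blast
  qed
qed

lemma approximable_add:
  assumes f: "approximable f" and g: "approximable g"
  shows "approximable (\<lambda>x. f x + g x)"
  unfolding approximable_def
proof (intro conjI allI impI)
  show "(\<lambda>x. f x + g x) \<in> borel_measurable M" using assms by (auto simp: approximable_def)
  obtain B B' where "\<forall>x\<in>space M. cmod (f x) \<le> B" "\<forall>x\<in>space M. cmod (g x) \<le> B'"
    using assms unfolding approximable_def by blast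
  then show "\<exists>B. \<forall>x\<in>space M. cmod (f x + g x) \<le> B"
    by (intro exI [of _ "B + B'"]) (meson add_mono norm_triangle_le)
  fix e :: real assume "0 < e"
  then obtain p q where p: "p \<in> T" "(LINT x|M. (cmod (f x - p x))\<^sup>2) < e / 4"
    and q: "q \<in> T" "(LINT x|M. (cmod (g x - q x))\<^sup>2) < e / 4"
    using assms unfolding approximable_def by (meson divide_pos_pos zero_less_numeral)
  have "(LINT x|M. (cmod ((f x + g x) - (p x + q x)))\<^sup>2) \<le>
      2 * (LINT x|M. (cmod ((f x + g x) - (p x + g x)))\<^sup>2) + 2 * (LINT x|M. (cmod ((p x + g x) - (p x + q x)))\<^sup>2)"
    using assms p q T_square_integrable approximable_square_integrable
    by (intro integral_sq_diff_le square_integrable_add) auto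
  also have "\<dots> < e" using p q by simp
  finally show "\<exists>p\<in>T. (LINT x|M. (cmod ((f x + g x) - p x))\<^sup>2) < e"
    using T_add [OF p(1) q(1)] by (rule bexI [of _ "\<lambda>x. p x + q x"])
qed

text \<open>\<open>g\<close> is replaced by \<open>q\<close> against the bound of \<open>f\<close>,
  and \<open>f\<close> by \<open>p\<close> against the bound of \<open>q\<close>. The accuracy
  demanded of \<open>p\<close> depends on the chosen \<open>q\<close>, which dictates the
  order.\<close>

lemma approximable_mult:
  assumes f: "approximable f" and g: "approximable g"
  shows "approximable (\<lambda>x. f x * g x)"
  unfolding approximable_def
proof (intro conjI allI impI)
  show m: "(\<lambda>x. f x * g x) \<in> borel_measurable M" using assms by (auto simp: approximable_def)
  obtain B B' where B: "\<forall>x\<in>space M. cmod (f x) \<le> B" "\<forall>x\<in>space M. cmod (g x) \<le> B'"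
    using assms unfolding approximable_def by blast
  have bound: "cmod (f x * g x) \<le> B * B'" if "x \<in> space M" for x
    using B that unfolding norm_mult by (intro mult_mono) (auto intro: order_trans [OF norm_ge_zero])
  then show "\<exists>B. \<forall>x\<in>space M. cmod (f x * g x) \<le> B" by blast
  have scaled: "\<exists>p\<in>T. (LINT x|M. (cmod (h x * (u x - p x)))\<^sup>2) < e"
    if u: "approximable u" and h: "h \<in> borel_measurable M" "\<And>x. x \<in> space M \<Longrightarrow> cmod (h x) \<le> D" and e: "0 < e"
    for u h D and e :: real
  proof -
    have "0 < e / (D\<^sup>2 + 1)" using e by (simp add: add_nonneg_pos)
    then obtain p where p: "p \<in> T" "(LINT x|M. (cmod (u x - p x))\<^sup>2) < e / (D\<^sup>2 + 1)"
      using u unfolding approximable_def by blast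
    have usq: "(\<lambda>x. u x - p x) \<in> square_integrable M"
      using u p(1) by (intro square_integrable_diff approximable_square_integrable T_square_integrable)
    have le: "(cmod (h x * (u x - p x)))\<^sup>2 \<le> D\<^sup>2 * (cmod (u x - p x))\<^sup>2" if "x \<in> space M" for x
      unfolding norm_mult power_mult_distrib by (intro mult_right_mono power_mono h(2) that) auto
    have "(LINT x|M. (cmod (h x * (u x - p x)))\<^sup>2) \<le> (LINT x|M. D\<^sup>2 * (cmod (u x - p x))\<^sup>2)"
      using usq le by (intro integral_mono') (auto simp: square_integrable_def)
    also have "\<dots> = D\<^sup>2 * (LINT x|M. (cmod (u x - p x))\<^sup>2)" by simp
    also have "\<dots> \<le> (D\<^sup>2 + 1) * (LINT x|M. (cmod (u x - p x))\<^sup>2)"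
      by (intro mult_right_mono) auto
    also have "\<dots> < e" using p(2) add_nonneg_pos [of "D\<^sup>2" 1] by (simp add: field_simps)
    finally show ?thesis using p(1) by blast
  qed
  fix e :: real assume e: "0 < e"
  have "f \<in> borel_measurable M" using f by (auto simp: approximable_def)
  then obtain q where q: "q \<in> T" "(LINT x|M. (cmod (f x * (g x - q x)))\<^sup>2) < e / 4"
    using scaled [OF g, of f B "e / 4"] B e by auto
  obtain D where "\<forall>x\<in>space M. cmod (q x) \<le> D" using T_bounded [OF q(1)] by blast
  then obtain p where p: "p \<in> T" "(LINT x|M. (cmod (q x * (f x - p x)))\<^sup>2) < e / 4"
    using scaled [OF f, of q D "e / 4"] T_measurable [OF q(1)] e by auto
  have "approximable q" by (rule approximable_T [OF q(1)])
  then have "(\<lambda>x. f x * q x) \<in> square_integrable M"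
    using f \<open>\<forall>x\<in>space M. cmod (q x) \<le> D\<close> B
    by (intro square_integrableI_bounded [of _ "B * D"])
      (auto simp: approximable_def norm_mult intro!: mult_mono intro: order_trans [OF norm_ge_zero])
  then have "(LINT x|M. (cmod (f x * g x - p x * q x))\<^sup>2) \<le>
      2 * (LINT x|M. (cmod (f x * g x - f x * q x))\<^sup>2) + 2 * (LINT x|M. (cmod (f x * q x - p x * q x))\<^sup>2)"
    using square_integrableI_bounded [OF m bound] T_square_integrable [OF T_mult [OF p(1) q(1)]]
    by (intro integral_sq_diff_le)
  also have "\<dots> < e" using p q by (simp add: algebra_simps)
  finally show "\<exists>p\<in>T. (LINT x|M. (cmod ((f x * g x) - p x))\<^sup>2) < e"
    using T_mult [OF p(1) q(1)] by (rule bexI [of _ "\<lambda>x. p x * q x"])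
qed

lemma approximable_real_polynomial:
  assumes s: "approximable (\<lambda>x. complex_of_real (s x))" and g: "real_polynomial_function g"
  shows "approximable (\<lambda>x. complex_of_real (g (s x :: real)))"
  using g
proof (induction g rule: real_polynomial_function.induct)
  case (linear f)
  then have "f y = y * f 1" for y
    using linear_cmul [of f y 1] by (simp add: bounded_linear.linear)
  then have "approximable (\<lambda>x. complex_of_real (s x) * complex_of_real (f 1))"
    using s approximable_T [OF T_const] by (intro approximable_mult)
  then show ?case by (simp only: of_real_mult [symmetric] \<open>\<And>y. f y = y * f 1\<close> [of "s _", symmetric])
next
  case (const c)
  show ?case using approximable_T [OF T_const] .
next
  case (add f g)
  then show ?case using approximable_add [OF add.IH] by simp
next
  case (mult f g)
  then show ?case using approximable_mult [OF mult.IH] by simp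
qed

lemma approximable_continuous:
  assumes s: "approximable (\<lambda>x. complex_of_real (s x))" and r: "\<And>x. x \<in> space M \<Longrightarrow> s x \<in> {-1..1}"
    and h: "continuous_on UNIV h" and hB: "\<And>y. \<bar>h y\<bar> \<le> B"
  shows "approximable (\<lambda>x. complex_of_real (h (s x)))"
proof -
  have "\<exists>g. real_polynomial_function g \<and> (\<forall>y\<in>{-1..1}. \<bar>h y - g y\<bar> < 1 / real (Suc n))" for n
  proof (rule Stone_Weierstrass_real_polynomial_function [of "{-1..1::real}" h "1 / real (Suc n)"])
    show "continuous_on {-1..1} h" using h by (rule continuous_on_subset) simp
  qed auto
  then obtain g where g: "\<And>n. real_polynomial_function (g n)" "\<And>n y. y \<in> {-1..1} \<Longrightarrow> \<bar>h y - g n y\<bar> < 1 / real (Suc n)"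
    by metis
  have sm: "s \<in> borel_measurable M"
  proof -
    have "(\<lambda>x. complex_of_real (s x)) \<in> borel_measurable M" using s by (simp add: approximable_def)
    then have "(\<lambda>x. Re (complex_of_real (s x))) \<in> borel_measurable M" by measurable
    then show ?thesis by simp
  qed
  show ?thesis
  proof (rule approximable_limit [where F = "\<lambda>n x. complex_of_real (g n (s x))" and B = "B + 1"])
    show "approximable (\<lambda>x. complex_of_real (g n (s x)))" for n
      by (rule approximable_real_polynomial [OF s g(1)])
    show "cmod (complex_of_real (g n (s x))) \<le> B + 1" if "x \<in> space M" for n x
    proof -
      have "\<bar>h (s x) - g n (s x)\<bar> < 1 / real (Suc n)" by (rule g(2) [OF r [OF that]])
      moreover have "1 / real (Suc n) \<le> 1" by simp
      ultimately have "\<bar>g n (s x)\<bar> \<le> B + 1" using hB [of "s x"] by linarith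
      then show ?thesis by (simp only: norm_of_real)
    qed
    have "h \<in> borel_measurable borel" using h by (rule borel_measurable_continuous_onI)
    then show "(\<lambda>x. complex_of_real (h (s x))) \<in> borel_measurable M" using sm by measurable
    show "(\<lambda>n. complex_of_real (g n (s x))) \<longlonglongrightarrow> complex_of_real (h (s x))" if "x \<in> space M" for x
    proof (intro tendsto_of_real)
      have "(\<lambda>n. g n (s x) - h (s x)) \<longlonglongrightarrow> 0"
      proof (rule tendsto_rabs_zero_cancel, rule tendsto_sandwich [OF _ _ tendsto_const])
        show "(\<lambda>n. 1 / real (Suc n)) \<longlonglongrightarrow> 0" using LIMSEQ_inverse_real_of_nat by (simp add: inverse_eq_divide)
        show "\<forall>\<^sub>F n in sequentially. \<bar>g n (s x) - h (s x)\<bar> \<le> 1 / real (Suc n)"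
          using g(2) [OF r [OF that]] by (auto simp: abs_minus_commute less_imp_le)
      qed auto
      then show "(\<lambda>n. g n (s x)) \<longlonglongrightarrow> h (s x)" by (simp add: LIM_zero_iff)
    qed
  qed
qed

text \<open>\<open>X\<close> may be unbounded and only trigonometric functions of it lie in
  \<open>T\<close>. But sin(X / n) is in \<open>T\<close> with values in [-1, 1], where polynomial
  approximation works, and n sin(X / n) tends to \<open>X\<close>; continuity and boundedness of
  \<open>h\<close> finish the argument.\<close>

lemma approximable_bounded_continuous:
  assumes X: "\<And>t. (\<lambda>x. iexp (t * X x)) \<in> T" and Xm [measurable]: "X \<in> borel_measurable M"
    and h: "continuous_on UNIV h" and hB: "\<And>y. \<bar>h y\<bar> \<le> B"
  shows "approximable (\<lambda>x. complex_of_real (h (X x)))"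
proof (rule approximable_limit [where F = "\<lambda>n x. complex_of_real (h (real (Suc n) * sin (X x / real (Suc n))))" and B = B])
  show "approximable (\<lambda>x. complex_of_real (h (real (Suc n) * sin (X x / real (Suc n)))))" for n
  proof (rule approximable_continuous [where h = "\<lambda>y. h (real (Suc n) * y)" and B = B])
    define u where "u = 1 / real (Suc n)"
    have "(\<lambda>x. 1 / (2 * \<i>) * (iexp (u * X x) + - 1 * iexp (- u * X x))) \<in> T"
      by (intro T_mult T_add T_const X)
    moreover have "1 / (2 * \<i>) * (iexp (u * X x) + - 1 * iexp (- u * X x)) = complex_of_real (sin (X x / real (Suc n)))" for x
    proof -
      have "iexp (u * X x) + - 1 * iexp (- u * X x) = 2 * \<i> * complex_of_real (sin (u * X x))"
        unfolding cis_conv_exp [symmetric] by (simp add: complex_eq_iff)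
      then show ?thesis by (simp add: u_def)
    qed
    ultimately show "approximable (\<lambda>x. complex_of_real (sin (X x / real (Suc n))))"
      using approximable_T by simp
    show "continuous_on UNIV (\<lambda>y. h (real (Suc n) * y))"
      by (intro continuous_on_compose2 [OF h] continuous_intros) auto
  qed (use hB in auto)
  show "(\<lambda>n. complex_of_real (h (real (Suc n) * sin (X x / real (Suc n))))) \<longlonglongrightarrow> complex_of_real (h (X x))" for x
  proof (intro tendsto_of_real)
    have "((\<lambda>t. sin (X x * t)) has_real_derivative X x) (at 0)"
      by (auto intro!: derivative_eq_intros)
    then have "((\<lambda>t. sin (X x * t) / t) \<longlongrightarrow> X x) (at 0)"
      by (simp add: DERIV_def)
    moreover have "filterlim (\<lambda>n. 1 / real (Suc n)) (at 0) sequentially"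
      using LIMSEQ_inverse_real_of_nat by (auto simp: filterlim_at inverse_eq_divide)
    ultimately have "(\<lambda>n. sin (X x * (1 / real (Suc n))) / (1 / real (Suc n))) \<longlonglongrightarrow> X x"
      by (rule filterlim_compose)
    then have "(\<lambda>n. real (Suc n) * sin (X x / real (Suc n))) \<longlonglongrightarrow> X x"
      by (simp add: mult.commute)
    then show "(\<lambda>n. h (real (Suc n) * sin (X x / real (Suc n)))) \<longlonglongrightarrow> h (X x)"
      by (rule continuous_on_tendsto_compose [OF h]) auto
  qed
  have "h \<in> borel_measurable borel" using h by (rule borel_measurable_continuous_onI)
  then show "(\<lambda>x. complex_of_real (h (X x))) \<in> borel_measurable M" by measurable
qed (use hB in auto)

definition approx_set :: "'a set \<Rightarrow> bool" where
  "approx_set S \<longleftrightarrow> approximable (\<lambda>x. of_bool (x \<in> S))"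

text \<open>Ramps that are 0 up to \<open>a\<close> and have slope n until they reach 1 converge to
  the indicator of the open half-line, with value 0 at \<open>a\<close> itself.\<close>

lemma approx_set_superlevel:
  assumes X: "\<And>t. (\<lambda>x. iexp (t * X x)) \<in> T" and Xm [measurable]: "X \<in> borel_measurable M"
  shows "approx_set {x \<in> space M. a < X x}"
  unfolding approx_set_def
proof (rule approximable_limit [where F = "\<lambda>n x. complex_of_real (min 1 (max 0 (real n * (X x - a))))" and B = 1])
  show "approximable (\<lambda>x. complex_of_real (min 1 (max 0 (real n * (X x - a)))))" for n
    by (rule approximable_bounded_continuous [OF X Xm, where h = "\<lambda>y. min 1 (max 0 (real n * (y - a)))" and B = 1])
      (auto intro!: continuous_intros)
  show "(\<lambda>n. complex_of_real (min 1 (max 0 (real n * (X x - a))))) \<longlonglongrightarrow> of_bool (x \<in> {x \<in> space M. a < X x})"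
    if x: "x \<in> space M" for x
  proof (cases "a < X x")
    case True
    obtain N :: nat where N: "1 < real N * (X x - a)" using reals_Archimedean3 [of "X x - a"] True by auto
    have "min 1 (max 0 (real n * (X x - a))) = 1" if "N \<le> n" for n
    proof -
      have "real N * (X x - a) \<le> real n * (X x - a)" using that True by (intro mult_right_mono) auto
      then show ?thesis using N by simp
    qed
    then have "\<forall>\<^sub>F n in sequentially. complex_of_real (min 1 (max 0 (real n * (X x - a)))) = of_bool (x \<in> {x \<in> space M. a < X x})"
      using True x unfolding eventually_sequentially by auto
    then show ?thesis by (rule tendsto_eventually)
  next
    case False
    then have "max 0 (real n * (X x - a)) = 0" for n by (simp add: mult_nonneg_nonpos)
    then show ?thesis using False by simp
  qed
qed auto

lemma approx_set_compl: "approx_set S \<Longrightarrow> approx_set (space M - S)"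
proof -
  assume "approx_set S"
  then have "approximable (\<lambda>x. 1 + - 1 * of_bool (x \<in> S))"
    unfolding approx_set_def
    by (intro approximable_add approximable_mult approximable_T [OF T_const, of 1] approximable_T [OF T_const, of "- 1"])
  then show ?thesis unfolding approx_set_def by (rule approximable_cong) simp
qed

lemma approx_set_Int: "approx_set S \<Longrightarrow> approx_set S' \<Longrightarrow> approx_set (S \<inter> S')"
  unfolding approx_set_def using approximable_mult [of "\<lambda>x. of_bool (x \<in> S)" "\<lambda>x. of_bool (x \<in> S')"]
  by (simp add: of_bool_conj)

lemma approx_set_empty: "approx_set {}"
  unfolding approx_set_def using approximable_T [OF T_const, of 0] by simp

lemma approx_set_sets: "approx_set S \<Longrightarrow> S \<subseteq> space M \<Longrightarrow> S \<in> sets M"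
proof -
  assume "approx_set S" "S \<subseteq> space M"
  then have "(\<lambda>x. of_bool (x \<in> S) :: complex) \<in> borel_measurable M" by (simp add: approx_set_def approximable_def)
  then have "(\<lambda>x. of_bool (x \<in> S) :: complex) -` {1} \<inter> space M \<in> sets M" by (rule measurable_sets) simp
  moreover have "(\<lambda>x. of_bool (x \<in> S) :: complex) -` {1} \<inter> space M = S" using \<open>S \<subseteq> space M\<close> by auto
  ultimately show ?thesis by simp
qed

lemma approx_set_UN:
  assumes "\<And>n :: nat. approx_set (S n)" "\<And>n. S n \<subseteq> space M"
  shows "approx_set (\<Union>n. S n)"
proof -
  have fin: "approx_set (\<Union>i<n. S i)" for n
  proof (induction n)
    case (Suc n)
    have "approx_set (space M - ((space M - (\<Union>i<n. S i)) \<inter> (space M - S n)))"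
      by (intro approx_set_compl approx_set_Int Suc assms)
    moreover have "space M - ((space M - (\<Union>i<n. S i)) \<inter> (space M - S n)) = (\<Union>i<Suc n. S i)"
      using assms(2) by (auto simp: less_Suc_eq)
    ultimately show ?case by simp
  qed (simp add: approx_set_empty)
  have [measurable]: "\<And>n. S n \<in> sets M" using approx_set_sets assms by blast
  show ?thesis
    unfolding approx_set_def
  proof (rule approximable_limit [where F = "\<lambda>n x. of_bool (x \<in> (\<Union>i<n. S i))" and B = 1])
    show "approximable (\<lambda>x. of_bool (x \<in> (\<Union>i<n. S i)))" for n
      using fin unfolding approx_set_def .
    show "(\<lambda>n. of_bool (x \<in> (\<Union>i<n. S i)) :: complex) \<longlonglongrightarrow> of_bool (x \<in> (\<Union>n. S n))" for x
    proof (cases "x \<in> (\<Union>n. S n)")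
      case True
      then obtain N where "x \<in> S N" by blast
      then have *: "x \<in> (\<Union>i<n. S i)" if "Suc N \<le> n" for n using that by auto
      have "\<forall>\<^sub>F n in sequentially. (of_bool (x \<in> (\<Union>i<n. S i)) :: complex) = of_bool (x \<in> (\<Union>n. S n))"
        by (rule eventually_sequentiallyI [of "Suc N"]) (simp only: * True)
      then show ?thesis by (rule tendsto_eventually)
    next
      case False
      then show ?thesis by auto
    qed
    have "(\<lambda>x. indicator (\<Union>n. S n) x :: complex) \<in> borel_measurable M" by measurable
    then show "(\<lambda>x. of_bool (x \<in> (\<Union>n. S n)) :: complex) \<in> borel_measurable M"
      by (simp only: indicator_def)
  qed simp
qed

text \<open>Closure under products makes the approximable sets stable under intersection, so they
  form a \<sigma>-algebra directly and no Dynkin system argument is required.\<close>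

lemma approx_set_sigma_sets:
  assumes "\<And>S. S \<in> G \<Longrightarrow> approx_set S \<and> S \<subseteq> space M" "S \<in> sigma_sets (space M) G"
  shows "approx_set S \<and> S \<subseteq> space M"
  using assms(2)
proof (induction S rule: sigma_sets.induct)
  case (Basic S)
  then show ?case using assms(1) by blast
next
  case (Union S)
  then show ?case using approx_set_UN by blast
qed (auto simp: approx_set_empty approx_set_compl)

lemma approx_set_vimage:
  assumes X: "\<And>t. (\<lambda>x. iexp (t * X x)) \<in> T" and Xm: "X \<in> borel_measurable M" and B: "B \<in> sets borel"
  shows "approx_set (X -` B \<inter> space M)"
proof -
  have "B \<in> sigma_sets UNIV (range greaterThan)"
    using B by (simp add: borel_Ioi)
  then show ?thesis
  proof (induction B rule: sigma_sets.induct)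
    case (Basic B)
    then obtain a where "B = {a<..}" by blast
    then show ?case using approx_set_superlevel [OF X Xm, of a] by (simp add: vimage_def Int_def conj_commute)
  next
    case (Compl B)
    have "X -` (UNIV - B) \<inter> space M = space M - (X -` B \<inter> space M)" by auto
    then show ?case using approx_set_compl [OF Compl.IH] by simp
  next
    case (Union B)
    have "X -` (\<Union>i. B i) \<inter> space M = (\<Union>i. X -` B i \<inter> space M)" by auto
    then show ?case using approx_set_UN [of "\<lambda>i. X -` B i \<inter> space M"] Union.IH by simp
  qed (simp add: approx_set_empty)
qed

lemma dense_L2:
  assumes approx_set: "\<And>S. S \<in> sets M \<Longrightarrow> approx_set S" and f: "f \<in> square_integrable M" and e: "0 < e"
  shows "\<exists>p\<in>T. (LINT x|M. (cmod (f x - p x))\<^sup>2) < e"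
proof -
  have "\<forall>e>0. \<exists>p\<in>T. (LINT x|M. (cmod (f x - p x))\<^sup>2) < e"
    using f
  proof (induction f rule: square_integrable_induct)
    case (indicator S)
    then show ?case using approx_set unfolding approx_set_def approximable_def by blast
  next
    case (add f g)
    show ?case
    proof (intro allI impI)
      fix e :: real assume "0 < e"
      then obtain p q where p: "p \<in> T" "(LINT x|M. (cmod (f x - p x))\<^sup>2) < e / 4"
        and q: "q \<in> T" "(LINT x|M. (cmod (g x - q x))\<^sup>2) < e / 4"
        using add.IH by (meson divide_pos_pos zero_less_numeral)
      have "(LINT x|M. (cmod ((f x + g x) - (p x + q x)))\<^sup>2) \<le>
          2 * (LINT x|M. (cmod ((f x + g x) - (p x + g x)))\<^sup>2) + 2 * (LINT x|M. (cmod ((p x + g x) - (p x + q x)))\<^sup>2)"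
        using add.hyps p q T_square_integrable
        by (intro integral_sq_diff_le square_integrable_add) auto
      also have "\<dots> < e" using p q by simp
      finally show "\<exists>p\<in>T. (LINT x|M. (cmod ((f x + g x) - p x))\<^sup>2) < e"
        using T_add [OF p(1) q(1)] by (rule bexI [of _ "\<lambda>x. p x + q x"])
    qed
  next
    case (scale f c)
    show ?case
    proof (intro allI impI)
      fix e :: real assume e: "0 < e"
      have pos: "0 < (cmod c)\<^sup>2 + 1" by (simp add: add_nonneg_pos)
      then obtain p where p: "p \<in> T" "(LINT x|M. (cmod (f x - p x))\<^sup>2) < e / ((cmod c)\<^sup>2 + 1)"
        using scale.IH e by (meson divide_pos_pos)
      have "(LINT x|M. (cmod (c * f x - c * p x))\<^sup>2) = (cmod c)\<^sup>2 * (LINT x|M. (cmod (f x - p x))\<^sup>2)"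
        by (simp add: norm_mult power_mult_distrib flip: right_diff_distrib)
      also have "\<dots> \<le> ((cmod c)\<^sup>2 + 1) * (LINT x|M. (cmod (f x - p x))\<^sup>2)"
        by (intro mult_right_mono) auto
      also have "\<dots> < e" using p(2) pos by (simp add: field_simps)
      finally show "\<exists>p\<in>T. (LINT x|M. (cmod (c * f x - p x))\<^sup>2) < e"
        using T_mult [OF T_const p(1)] by (rule bexI [of _ "\<lambda>x. c * p x"])
    qed
  next
    case (limit f)
    show ?case
    proof (intro allI impI)
      fix e :: real assume e: "0 < e"
      obtain g where g: "g \<in> square_integrable M" "\<forall>e>0. \<exists>p\<in>T. (LINT x|M. (cmod (g x - p x))\<^sup>2) < e"
          "(LINT x|M. (cmod (f x - g x))\<^sup>2) < e / 4"
        using limit.IH [of "e / 4"] e by auto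
      obtain p where p: "p \<in> T" "(LINT x|M. (cmod (g x - p x))\<^sup>2) < e / 4"
        using g(2) e by (meson divide_pos_pos zero_less_numeral)
      have "(LINT x|M. (cmod (f x - p x))\<^sup>2) < e"
        using integral_sq_diff_le [OF limit.hyps g(1) T_square_integrable [OF p(1)]] g(3) p(2) by linarith
      then show "\<exists>p\<in>T. (LINT x|M. (cmod (f x - p x))\<^sup>2) < e" using p(1) by blast
    qed
  qed
  then show ?thesis using e by blast
qed

text \<open>The deviation from factorisation vanishes on \<open>T\<close> and changes by at most 2 D
  times the L1 distance. The lemma exchanges an exponential for an indicator in one factor while the
  other is held fixed.\<close>

lemma uncorrelated_approximable:
  assumes k [measurable]: "k \<in> borel_measurable M" and kD: "\<And>x. x \<in> space M \<Longrightarrow> cmod (k x) \<le> D"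
    and T: "\<And>p. p \<in> T \<Longrightarrow> (LINT x|M. p x * k x) = (LINT x|M. p x) * (LINT x|M. k x)"
    and f: "approximable f"
  shows "(LINT x|M. f x * k x) = (LINT x|M. f x) * (LINT x|M. k x)"
proof -
  define \<Phi> where "\<Phi> h = (LINT x|M. h x * k x) - (LINT x|M. h x) * (LINT x|M. k x)" for h
  obtain B where [measurable]: "f \<in> borel_measurable M" and B: "\<And>x. x \<in> space M \<Longrightarrow> cmod (f x) \<le> B"
    using f unfolding approximable_def by blast
  have int: "integrable M h" "integrable M (\<lambda>x. h x * k x)" if "h \<in> borel_measurable M" "\<And>x. x \<in> space M \<Longrightarrow> cmod (h x) \<le> C" for h C
  proof -
    have [measurable]: "h \<in> borel_measurable M" by fact
    show "integrable M h" using that(2) by (intro integrable_const_bound [of _ C]) auto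
    have "cmod (h x * k x) \<le> C * D" if "x \<in> space M" for x
      unfolding norm_mult using \<open>\<And>x. x \<in> space M \<Longrightarrow> cmod (h x) \<le> C\<close> kD that
      by (intro mult_mono) (auto intro: order_trans [OF norm_ge_zero])
    then show "integrable M (\<lambda>x. h x * k x)" by (intro integrable_const_bound [of _ "C * D"]) auto
  qed
  obtain x0 where "x0 \<in> space M" using not_empty by blast
  then have D: "0 \<le> D" using kD norm_ge_zero order_trans by blast
  have intk: "cmod (LINT x|M. k x) \<le> D"
  proof -
    have "cmod (LINT x|M. k x) \<le> (LINT x|M. cmod (k x))" by (rule integral_norm_bound)
    also have "\<dots> \<le> D" using kD by (intro integral_le_const integrable_norm integrable_const_bound [of _ D]) auto
    finally show ?thesis .
  qed
  have small: "cmod (\<Phi> f) \<le> 2 * D * e" if e: "0 < e" for e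
  proof -
    obtain p where p: "p \<in> T" "(LINT x|M. (cmod (f x - p x))\<^sup>2) < e\<^sup>2"
      using f e unfolding approximable_def by (meson zero_less_power)
    obtain C where C: "\<And>x. x \<in> space M \<Longrightarrow> cmod (p x) \<le> C" using T_bounded [OF p(1)] by blast
    note [measurable] = T_measurable [OF p(1)]
    define u where "u x = f x - p x" for x
    have [measurable]: "u \<in> borel_measurable M" by (simp add: u_def [abs_def])
    have uB: "cmod (u x) \<le> B + C" if "x \<in> space M" for x
      using norm_triangle_ineq4 [of "f x" "p x"] B [OF that] C [OF that] by (simp add: u_def)
    have usq: "u \<in> square_integrable M" using uB by (intro square_integrableI_bounded) auto
    have L1: "(LINT x|M. cmod (u x)) \<le> e"
      using p(2) e by (intro L1_le_L2 [OF usq]) (simp_all add: u_def)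
    have "\<Phi> p = 0" using T [OF p(1)] by (simp add: \<Phi>_def)
    moreover have "\<Phi> u = \<Phi> f - \<Phi> p"
    proof -
      have "(LINT x|M. u x * k x) = (LINT x|M. f x * k x) - (LINT x|M. p x * k x)"
        unfolding u_def left_diff_distrib
        by (rule Bochner_Integration.integral_diff) (rule int [OF _ B] int [OF _ C], measurable)+
      moreover have "(LINT x|M. u x) = (LINT x|M. f x) - (LINT x|M. p x)"
        unfolding u_def
        by (rule Bochner_Integration.integral_diff) (rule int [OF _ B] int [OF _ C], measurable)+
      ultimately show ?thesis by (simp add: \<Phi>_def left_diff_distrib)
    qed
    ultimately have "\<Phi> f = \<Phi> u" by simp
    then have "cmod (\<Phi> f) \<le> cmod (LINT x|M. u x * k x) + cmod ((LINT x|M. u x) * (LINT x|M. k x))"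
      by (simp add: \<Phi>_def norm_triangle_ineq4)
    also have "cmod (LINT x|M. u x * k x) \<le> (LINT x|M. cmod (u x * k x))" by (rule integral_norm_bound)
    also have "(LINT x|M. cmod (u x * k x)) \<le> (LINT x|M. cmod (u x) * D)"
    proof (rule integral_mono)
      show "integrable M (\<lambda>x. cmod (u x * k x))" using int(2) [of u "B + C"] uB by (intro integrable_norm) simp
      show "integrable M (\<lambda>x. cmod (u x) * D)"
        using int(1) [of u "B + C"] uB by (intro integrable_mult_left integrable_norm) simp
      show "cmod (u x * k x) \<le> cmod (u x) * D" if "x \<in> space M" for x
        unfolding norm_mult by (intro mult_left_mono kD that) simp
    qed
    also have "\<dots> \<le> e * D" using L1 D by (simp add: mult_right_mono)
    also have "cmod ((LINT x|M. u x) * (LINT x|M. k x)) \<le> e * D"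
      unfolding norm_mult using order_trans [OF integral_norm_bound [of M u] L1] intk e
      by (intro mult_mono) simp_all
    finally show ?thesis by (simp add: algebra_simps)
  qed
  have "cmod (\<Phi> f) \<le> 0 + e" if "0 < e" for e
  proof -
    \<comment> \<open>The denominator \<open>2 * D + 1\<close> also covers
      \<open>D = 0\<close>.\<close>
    have "cmod (\<Phi> f) \<le> 2 * D * (e / (2 * D + 1))" using D that by (intro small) auto
    also have "\<dots> \<le> e" using D that by (simp add: field_simps)
    finally show ?thesis by simp
  qed
  then have "cmod (\<Phi> f) \<le> 0" by (rule field_le_epsilon)
  then show ?thesis by (simp add: \<Phi>_def)
qed

end

section \<open>Trigonometric polynomials, independence and uniqueness of measures\<close>

inductive_set trig_span :: "('a \<Rightarrow> real) set \<Rightarrow> ('a \<Rightarrow> complex) set" for L where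
  exp: "l \<in> L \<Longrightarrow> (\<lambda>x. iexp (l x)) \<in> trig_span L"
| add: "p \<in> trig_span L \<Longrightarrow> q \<in> trig_span L \<Longrightarrow> (\<lambda>x. p x + q x) \<in> trig_span L"
| scale: "p \<in> trig_span L \<Longrightarrow> (\<lambda>x. c * p x) \<in> trig_span L"

lemma trig_span_mult:
  assumes L: "\<And>l l'. l \<in> L \<Longrightarrow> l' \<in> L \<Longrightarrow> (\<lambda>x. l x + l' x) \<in> L"
    and p: "p \<in> trig_span L" and q: "q \<in> trig_span L"
  shows "(\<lambda>x. p x * q x) \<in> trig_span L"
  using p
proof (induction p rule: trig_span.induct)
  case (exp l)
  show ?case
    using q
  proof (induction q rule: trig_span.induct)
    case (exp l')
    have "iexp (l x) * iexp (l' x) = iexp (l x + l' x)" for x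
      by (simp add: exp_add [symmetric] distrib_left)
    then show ?case using trig_span.exp [OF L [OF \<open>l \<in> L\<close> \<open>l' \<in> L\<close>]] by simp
  next
    case (add p q)
    then show ?case using trig_span.add [OF add.IH] by (simp add: distrib_left)
  next
    case (scale p c)
    then show ?case using trig_span.scale [OF scale.IH, of c] by (simp add: mult.left_commute)
  qed
next
  case (add p q)
  then show ?case using trig_span.add [OF add.IH] by (simp add: distrib_right)
next
  case (scale p c)
  then show ?case using trig_span.scale [OF scale.IH, of c] by (simp add: mult.assoc)
qed

lemma trig_span_sum:
  assumes "p \<in> trig_span L"
  shows "\<exists>(n::nat) c l. (\<forall>j<n. l j \<in> L) \<and> p = (\<lambda>x. \<Sum>j<n. c j * iexp (l j x))"
  using assms
proof (induction p rule: trig_span.induct)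
  case (exp l)
  then show ?case by (intro exI [of _ "Suc 0"] exI [of _ "\<lambda>_. 1"] exI [of _ "\<lambda>_. l"]) simp
next
  case (add p q)
  obtain n :: nat and c l where p: "\<forall>j<n. l j \<in> L" "p = (\<lambda>x. \<Sum>j<n. c j * iexp (l j x))"
    using add.IH(1) by (elim exE conjE) (rule that)
  obtain n' :: nat and c' l' where q: "\<forall>j<n'. l' j \<in> L" "q = (\<lambda>x. \<Sum>j<n'. c' j * iexp (l' j x))"
    using add.IH(2) by (elim exE conjE) (rule that)
  define d where "d j = (if j < n then c j else c' (j - n))" for j
  define m where "m j = (if j < n then l j else l' (j - n))" for j
  have "p x + q x = (\<Sum>j<n + n'. d j * iexp (m j x))" for x
  proof -
    have "(\<Sum>j<n + n'. d j * iexp (m j x)) = (\<Sum>j<n. d j * iexp (m j x)) + (\<Sum>j<n'. d (n + j) * iexp (m (n + j) x))"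
      by (induction n') (simp_all add: add.assoc)
    then show ?thesis by (simp add: p q d_def m_def)
  qed
  moreover have "\<forall>j<n + n'. m j \<in> L" using p q by (auto simp: m_def)
  ultimately show ?case by blast
next
  case (scale p a)
  obtain n :: nat and c l where p: "\<forall>j<n. l j \<in> L" "p = (\<lambda>x. \<Sum>j<n. c j * iexp (l j x))"
    using scale.IH by (elim exE conjE) (rule that)
  then have "(\<lambda>x. a * p x) = (\<lambda>x. \<Sum>j<n. (a * c j) * iexp (l j x))" by (simp add: sum_distrib_left mult.assoc)
  with p(1) show ?case by (intro exI [of _ n] exI [of _ "\<lambda>j. a * c j"] exI [of _ l] conjI)
qed

lemma (in prob_space) bounded_function_algebra_trig_span:
  assumes L: "\<And>l. l \<in> L \<Longrightarrow> l \<in> borel_measurable M" "\<And>l l'. l \<in> L \<Longrightarrow> l' \<in> L \<Longrightarrow> (\<lambda>x. l x + l' x) \<in> L" "(\<lambda>x. 0) \<in> L"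
  shows "bounded_function_algebra M (trig_span L)"
proof unfold_locales
  show "p \<in> borel_measurable M" if "p \<in> trig_span L" for p
    using that
  proof (induction p rule: trig_span.induct)
    case (exp l)
    then have [measurable]: "l \<in> borel_measurable M" by (rule L(1))
    show ?case by measurable
  qed auto
  show "\<exists>B. \<forall>x\<in>space M. cmod (p x) \<le> B" if "p \<in> trig_span L" for p
    using that
  proof (induction p rule: trig_span.induct)
    case (exp l)
    show ?case by (intro exI [of _ 1]) simp
  next
    case (add p q)
    then obtain B B' where "\<forall>x\<in>space M. cmod (p x) \<le> B" "\<forall>x\<in>space M. cmod (q x) \<le> B'" by blast
    then show ?case by (intro exI [of _ "B + B'"]) (meson add_mono norm_triangle_le)
  next
    case (scale p c)
    then obtain B where "\<forall>x\<in>space M. cmod (p x) \<le> B" by blast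
    then show ?case by (intro exI [of _ "cmod c * B"]) (auto simp: norm_mult intro: mult_left_mono)
  qed
  show "(\<lambda>x. c) \<in> trig_span L" for c
    using trig_span.scale [OF trig_span.exp [OF L(3)], of c] by simp
qed (intro trig_span.add trig_span_mult L(2); assumption)+

text \<open>Kac's criterion. The factorisation extends bilinearly from exponentials to trigonometric
  polynomials in \<open>X\<close> and in \<open>Y\<close>, and from there to indicators of events,
  one variable at a time.\<close>

lemma (in prob_space) indep_var_charI:
  fixes X Y :: "'a \<Rightarrow> real"
  assumes X [measurable]: "random_variable borel X" and Y [measurable]: "random_variable borel Y"
    and char: "\<And>s t. (LINT x|M. iexp (s * X x) * iexp (t * Y x)) = (LINT x|M. iexp (s * X x)) * (LINT x|M. iexp (t * Y x))"
  shows "indep_var borel X borel Y"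
proof -
  define L where "L Z = {\<lambda>x. t * Z x | t. True}" for Z :: "'a \<Rightarrow> real"
  have alg: "bounded_function_algebra M (trig_span (L Z))" if [measurable]: "random_variable borel Z" for Z
  proof (rule bounded_function_algebra_trig_span)
    show "(\<lambda>x. l x + l' x) \<in> L Z" if "l \<in> L Z" "l' \<in> L Z" for l l'
      using that unfolding L_def by (auto simp flip: distrib_right)
    show "(\<lambda>x. 0) \<in> L Z" unfolding L_def by (auto intro!: exI [of _ 0])
  qed (auto simp: L_def)
  interpret X: bounded_function_algebra M "trig_span (L X)" by (rule alg [OF X])
  interpret Y: bounded_function_algebra M "trig_span (L Y)" by (rule alg [OF Y])
  have inT: "(\<lambda>x. iexp (t * Z x)) \<in> trig_span (L Z)" for t Z
    by (rule trig_span.exp) (auto simp: L_def)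
  have pq: "(LINT x|M. p x * q x) = (LINT x|M. p x) * (LINT x|M. q x)"
    if p: "p \<in> trig_span (L X)" and q: "q \<in> trig_span (L Y)" for p q
  proof -
    have int: "integrable M p" "integrable M q" "integrable M (\<lambda>x. p x * q x)"
      if p: "p \<in> trig_span (L X)" and q: "q \<in> trig_span (L Y)" for p q
    proof -
      obtain B B' where B: "\<And>x. x \<in> space M \<Longrightarrow> cmod (p x) \<le> B" "\<And>x. x \<in> space M \<Longrightarrow> cmod (q x) \<le> B'"
        using X.T_bounded [OF p] Y.T_bounded [OF q] by blast
      note [measurable] = X.T_measurable [OF p] Y.T_measurable [OF q]
      show "integrable M p" "integrable M q"
        using B by (auto intro!: integrable_const_bound)
      have "cmod (p x * q x) \<le> B * B'" if "x \<in> space M" for x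
        unfolding norm_mult using B [OF that] by (intro mult_mono) (auto intro: order_trans [OF norm_ge_zero])
      then show "integrable M (\<lambda>x. p x * q x)" by (intro integrable_const_bound [of _ "B * B'"]) auto
    qed
    show ?thesis
      using p
    proof (induction p rule: trig_span.induct)
      case (exp l)
      then obtain s where l: "l = (\<lambda>x. s * X x)" by (auto simp: L_def)
      have e: "(\<lambda>x. iexp (l x)) \<in> trig_span (L X)" by (rule trig_span.exp [OF exp])
      show ?case
        using q
      proof (induction q rule: trig_span.induct)
        case (exp l')
        then obtain t where "l' = (\<lambda>x. t * Y x)" by (auto simp: L_def)
        then show ?case using char [of s t] by (simp only: l)
      next
        case (add q q')
        then show ?case using int [OF e add.hyps(1)] int [OF e add.hyps(2)] by (simp add: distrib_left)
      next
        case (scale q c)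
        have "(LINT x|M. iexp (l x) * (c * q x)) = (LINT x|M. c * (iexp (l x) * q x))"
          by (simp only: mult.left_commute)
        then show ?case using scale.IH by simp
      qed
    next
      case (add p p')
      then show ?case using int [OF add.hyps(1) q] int [OF add.hyps(2) q] by (simp add: distrib_right)
    next
      case (scale p c)
      then show ?case by (simp add: mult.assoc)
    qed
  qed
  have prob: "prob ((X -` A \<inter> space M) \<inter> (Y -` B \<inter> space M)) = prob (X -` A \<inter> space M) * prob (Y -` B \<inter> space M)"
    if A: "A \<in> sets borel" and B: "B \<in> sets borel" for A B
  proof -
    let ?f = "\<lambda>x. of_bool (x \<in> X -` A \<inter> space M) :: complex" and ?g = "\<lambda>x. of_bool (x \<in> Y -` B \<inter> space M) :: complex"
    have sets: "X -` A \<inter> space M \<in> events" "Y -` B \<inter> space M \<in> events"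
      using A B measurable_sets [OF X A] measurable_sets [OF Y B] by auto
    have f: "X.approximable ?f" using X.approx_set_vimage [OF inT X A] by (simp add: X.approx_set_def)
    have g: "Y.approximable ?g" using Y.approx_set_vimage [OF inT Y B] by (simp add: Y.approx_set_def)
    \<comment> \<open>The \<open>X\<close> side is now an indicator and the \<open>Y\<close> side
      still a trigonometric polynomial; the roles are exchanged below.\<close>
    have "(LINT x|M. ?f x * q x) = (LINT x|M. ?f x) * (LINT x|M. q x)" if q: "q \<in> trig_span (L Y)" for q
    proof -
      obtain D where "\<And>x. x \<in> space M \<Longrightarrow> cmod (q x) \<le> D" using Y.T_bounded [OF q] by blast
      then show ?thesis by (rule X.uncorrelated_approximable [OF Y.T_measurable [OF q] _ pq [OF _ q] f])
    qed
    then have "(LINT x|M. q x * ?f x) = (LINT x|M. q x) * (LINT x|M. ?f x)" if "q \<in> trig_span (L Y)" for q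
      using that by (simp only: mult.commute)
    note qf = this
    have fm: "?f \<in> borel_measurable M" using f by (simp add: X.approximable_def)
    have "(LINT x|M. ?g x * ?f x) = (LINT x|M. ?g x) * (LINT x|M. ?f x)"
      by (rule Y.uncorrelated_approximable [where k = ?f and D = 1 and f = ?g, OF fm _ qf g]) simp
    moreover have ind: "(LINT x|M. of_bool (x \<in> S) :: complex) = of_real (prob S)" if "S \<in> events" for S
    proof -
      have "(LINT x|M. of_bool (x \<in> S) :: complex) = (LINT x|M. of_real (indicator S x))"
        by (intro Bochner_Integration.integral_cong) (auto simp: indicator_def)
      also have "\<dots> = of_real (LINT x|M. indicator S x)"
        by (rule integral_of_real) (rule integrable_real_indicator [OF that], simp add: emeasure_eq_measure)
      finally show ?thesis using that sets.sets_into_space [OF that] by (simp add: Int_absorb1)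
    qed
    moreover have "?g x * ?f x = of_bool (x \<in> (X -` A \<inter> space M) \<inter> (Y -` B \<inter> space M))" for x by auto
    ultimately show ?thesis using sets
      by (simp only: ind sets.Int of_real_mult [symmetric] of_real_eq_iff mult.commute)
  qed
  show ?thesis
    unfolding indep_var_eq
  proof (intro conjI X Y indep_set_sigma_sets indep_setI)
    have "Int_stable {Z -` A \<inter> space M |A. A \<in> sets borel}" for Z :: "'a \<Rightarrow> real"
      unfolding Int_stable_def
    proof safe
      fix A B :: "real set" assume "A \<in> sets borel" "B \<in> sets borel"
      then show "\<exists>C. Z -` A \<inter> space M \<inter> (Z -` B \<inter> space M) = Z -` C \<inter> space M \<and> C \<in> sets borel"
        by (intro exI [of _ "A \<inter> B"]) auto
    qed
    then show "Int_stable {X -` A \<inter> space M |A. A \<in> sets borel}" "Int_stable {Y -` A \<inter> space M |A. A \<in> sets borel}"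
      by this+
  qed (use measurable_sets [OF X] measurable_sets [OF Y] prob in auto)
qed

lemma (in prob_space) trig_span_approx_set:
  assumes L: "\<And>l. l \<in> L \<Longrightarrow> l \<in> borel_measurable M" "\<And>l l'. l \<in> L \<Longrightarrow> l' \<in> L \<Longrightarrow> (\<lambda>x. l x + l' x) \<in> L"
      "(\<lambda>x. 0) \<in> L" "\<And>l t. l \<in> L \<Longrightarrow> (\<lambda>x. t * l x) \<in> L"
    and gen: "sets M \<subseteq> sigma_sets (space M) {{x \<in> space M. a < l x} | a l. l \<in> L}"
  shows "bounded_function_algebra M (trig_span L)"
    and "S \<in> sets M \<Longrightarrow> bounded_function_algebra.approx_set M (trig_span L) S"
proof -
  show "bounded_function_algebra M (trig_span L)"
    by (rule bounded_function_algebra_trig_span [OF L(1-3)])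
  then interpret bounded_function_algebra M "trig_span L" .
  show "approx_set S" if "S \<in> sets M"
  proof -
    have "approx_set {x \<in> space M. a < l x}" if l: "l \<in> L" for a l
      by (rule approx_set_superlevel [OF trig_span.exp [OF L(4) [OF l]] L(1) [OF l]])
    then show ?thesis
      using approx_set_sigma_sets [of "{{x \<in> space M. a < l x} | a l. l \<in> L}" S] that gen by blast
  qed
qed

text \<open>Approximation in \<open>L\<^sup>2\<close> of the mixture is approximation for both measures at once.\<close>

definition mixture :: "'a measure \<Rightarrow> 'a measure \<Rightarrow> 'a measure" where
  "mixture M N = measure_of (space M) (sets M) (\<lambda>A. (emeasure M A + emeasure N A) / 2)"

lemma sets_mixture [simp]: "sets (mixture M N) = sets M" and space_mixture [simp]: "space (mixture M N) = space M"
  by (simp_all add: mixture_def)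

lemma emeasure_mixture:
  assumes sets: "sets N = sets M" and A: "A \<in> sets M"
  shows "emeasure (mixture M N) A = (emeasure M A + emeasure N A) / 2"
  unfolding mixture_def
proof (rule emeasure_measure_of_sigma [OF sets.sigma_algebra_axioms _ _ A])
  show "positive (sets M) (\<lambda>A. (emeasure M A + emeasure N A) / 2)"
    by (simp add: positive_def)
  show "countably_additive (sets M) (\<lambda>A. (emeasure M A + emeasure N A) / 2)"
  proof (rule countably_additiveI)
    fix F :: "nat \<Rightarrow> 'a set" assume F: "range F \<subseteq> sets M" "disjoint_family F"
    have "(\<Sum>i. (emeasure M (F i) + emeasure N (F i)) / 2) = (\<Sum>i. emeasure M (F i) + emeasure N (F i)) / 2"
      by (simp add: divide_ennreal_def)
    also have "(\<Sum>i. emeasure M (F i) + emeasure N (F i)) = (\<Sum>i. emeasure M (F i)) + (\<Sum>i. emeasure N (F i))"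
      by (intro suminf_add [symmetric]) auto
    also have "\<dots> = emeasure M (\<Union>i. F i) + emeasure N (\<Union>i. F i)"
      using F sets by (simp add: suminf_emeasure)
    finally show "(\<Sum>i. (emeasure M (F i) + emeasure N (F i)) / 2) = (emeasure M (\<Union>i. F i) + emeasure N (\<Union>i. F i)) / 2" .
  qed
qed

lemma prob_space_mixture:
  assumes "prob_space M" "prob_space N" "sets N = sets M"
  shows "prob_space (mixture M N)"
proof
  have "emeasure M (space M) = 1" "emeasure N (space M) = 1"
    using assms prob_space.emeasure_space_1 [of M] prob_space.emeasure_space_1 [of N] sets_eq_imp_space_eq [of N M] by auto
  then show "emeasure (mixture M N) (space (mixture M N)) = 1"
    using assms(3) mult_divide_eq_ennreal [of 2 1] by (simp add: emeasure_mixture)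
qed

lemma nn_integral_mixture_ge:
  assumes sets: "sets N = sets M" and f: "f \<in> borel_measurable M"
  shows "integral\<^sup>N M f \<le> 2 * integral\<^sup>N (mixture M N) f" "integral\<^sup>N N f \<le> 2 * integral\<^sup>N (mixture M N) f"
proof -
  let ?Q = "scale_measure 2 (mixture M N)"
  have half: "2 * (z / 2) = z" for z :: ennreal
    using mult_divide_eq_ennreal [of 2 z] by (simp add: ennreal_times_divide mult.commute)
  have "emeasure ?Q A = emeasure M A + emeasure N A" if "A \<in> sets M" for A
    using that sets half [of "emeasure M A + emeasure N A"] by (simp add: emeasure_mixture)
  then have le: "M \<le> ?Q" "N \<le> ?Q"
    using sets by (subst le_measure; simp)+
  have "integral\<^sup>N M f \<le> integral\<^sup>N ?Q f"
    by (rule nn_integral_mono_measure [OF _ le(1)]) simp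
  moreover have "integral\<^sup>N N f \<le> integral\<^sup>N ?Q f"
    by (rule nn_integral_mono_measure [OF _ le(2)]) (simp add: sets)
  ultimately show "integral\<^sup>N M f \<le> 2 * integral\<^sup>N (mixture M N) f" "integral\<^sup>N N f \<le> 2 * integral\<^sup>N (mixture M N) f"
    using nn_integral_scale_measure [of f "mixture M N" 2] f by (simp_all cong: measurable_cong_sets)
qed

text \<open>Uniqueness of the characteristic functional on a space of possibly infinite dimension.
  Equal means of trigonometric polynomials help only if the same polynomial approximates an
  indicator under both measures, which approximation for the mixture provides.\<close>

lemma prob_measure_eqI_char:
  assumes M: "prob_space M" and N: "prob_space N" and sets: "sets N = sets M"
    and L: "\<And>l. l \<in> L \<Longrightarrow> l \<in> borel_measurable M" "\<And>l l'. l \<in> L \<Longrightarrow> l' \<in> L \<Longrightarrow> (\<lambda>x. l x + l' x) \<in> L"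
      "(\<lambda>x. 0) \<in> L" "\<And>l t. l \<in> L \<Longrightarrow> (\<lambda>x. t * l x) \<in> L"
    and gen: "sets M \<subseteq> sigma_sets (space M) {{x \<in> space M. a < l x} | a l. l \<in> L}"
    and char: "\<And>l. l \<in> L \<Longrightarrow> (LINT x|M. iexp (l x)) = (LINT x|N. iexp (l x))"
  shows "M = N"
proof -
  define Q where "Q = mixture M N"
  interpret M: prob_space M by (rule M)
  interpret N: prob_space N by (rule N)
  interpret Q: prob_space Q unfolding Q_def by (rule prob_space_mixture [OF M N sets])
  have setsQ: "sets Q = sets M" and spaceQ: "space Q = space M" by (simp_all add: Q_def)
  have meas: "borel_measurable Q = borel_measurable M" "borel_measurable N = borel_measurable M"
    using setsQ sets by (auto intro: measurable_cong_sets)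
  have spaceN: "space N = space M" using sets by (rule sets_eq_imp_space_eq)
  note approx_set = Q.trig_span_approx_set [of L, unfolded meas setsQ spaceQ]
  interpret bounded_function_algebra Q "trig_span L" by (rule approx_set(1)) (fact L gen)+
  have approx_setS: "approx_set S" if "S \<in> sets M" for S by (rule approx_set(2)) (fact L gen that)+
  have bounded: "p \<in> borel_measurable M" "\<exists>B. \<forall>x\<in>space M. cmod (p x) \<le> B" if "p \<in> trig_span L" for p
    using T_measurable [OF that] T_bounded [OF that] by (auto simp: meas spaceQ)
  have int: "integrable M p" "integrable N p" if p: "p \<in> trig_span L" for p
  proof -
    obtain B where B: "\<And>x. x \<in> space M \<Longrightarrow> cmod (p x) \<le> B" using bounded(2) [OF p] by blast
    show "integrable M p" using B bounded(1) [OF p] by (intro M.integrable_const_bound [of _ B]) auto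
    show "integrable N p" using B bounded(1) [OF p] by (intro N.integrable_const_bound [of _ B]) (auto simp: spaceN meas)
  qed
  have eq: "(LINT x|M. p x) = (LINT x|N. p x)" if "p \<in> trig_span L" for p
    using that
  proof (induction p rule: trig_span.induct)
    case (exp l)
    then show ?case by (rule char)
  next
    case (add p q)
    then show ?case using int [OF add.hyps(1)] int [OF add.hyps(2)] by simp
  next
    case (scale p c)
    then show ?case by simp
  qed
  show ?thesis
  proof (rule measure_eqI)
    fix S assume S: "S \<in> sets M"
    have close: "\<bar>M.prob S - N.prob S\<bar> \<le> 2 * e" if e: "0 < e" for e
    proof -
      have "approximable (\<lambda>x. of_bool (x \<in> S))" using approx_setS [OF S] by (simp add: approx_set_def)
      \<comment> \<open>Either measure is at most twice the mixture, so e^2 / 2 becomes e^2 for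
        both.\<close>
      then obtain p where p: "p \<in> trig_span L" and pQ: "(LINT x|Q. (cmod (of_bool (x \<in> S) - p x))\<^sup>2) < e\<^sup>2 / 2"
        using e unfolding approximable_def by (meson half_gt_zero zero_less_power)
      define u where "u x = of_bool (x \<in> S) - p x" for x
      obtain B where B: "\<And>x. x \<in> space M \<Longrightarrow> cmod (p x) \<le> B" using bounded(2) [OF p] by blast
      have um: "u \<in> borel_measurable M"
      proof -
        have "(\<lambda>x. indicator S x - p x) \<in> borel_measurable M"
          using S bounded(1) [OF p] by measurable
        then show ?thesis by (simp only: u_def [abs_def] indicator_def)
      qed
      have uB: "cmod (u x) \<le> 1 + B" if "x \<in> space M" for x
        using norm_triangle_ineq4 [of "of_bool (x \<in> S)" "p x"] B [OF that] by (simp add: u_def of_bool_def split: if_splits)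
      have part: "\<bar>Sigma_Algebra.measure P S - Re (LINT x|P. p x)\<bar> \<le> e"
        if P: "prob_space P" "sets P = sets M" "\<And>f. f \<in> borel_measurable M \<Longrightarrow> integral\<^sup>N P f \<le> 2 * integral\<^sup>N Q f" for P
      proof -
        interpret P: prob_space P by (rule P(1))
        have measP: "borel_measurable P = borel_measurable M" using P(2) by (auto intro: measurable_cong_sets)
        have spaceP: "space P = space M" using P(2) by (rule sets_eq_imp_space_eq)
        have usqP: "u \<in> square_integrable P"
          using um uB by (intro P.square_integrableI_bounded) (auto simp: measP spaceP)
        have usqQ: "u \<in> square_integrable Q"
          using um uB by (intro Q.square_integrableI_bounded) (auto simp: meas spaceQ)
        have "ennreal (LINT x|P. (cmod (u x))\<^sup>2) = (\<integral>\<^sup>+x. ennreal ((cmod (u x))\<^sup>2) \<partial>P)"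
          using usqP by (intro nn_integral_eq_integral [symmetric]) (auto simp: square_integrable_def)
        also have "\<dots> \<le> 2 * (\<integral>\<^sup>+x. ennreal ((cmod (u x))\<^sup>2) \<partial>Q)"
          using um by (intro P(3)) measurable
        also have "\<dots> = 2 * ennreal (LINT x|Q. (cmod (u x))\<^sup>2)"
          using usqQ by (subst nn_integral_eq_integral) (auto simp: square_integrable_def)
        also have "\<dots> = ennreal (2 * (LINT x|Q. (cmod (u x))\<^sup>2))"
          by (simp add: ennreal_mult)
        finally have "(LINT x|P. (cmod (u x))\<^sup>2) \<le> 2 * (LINT x|Q. (cmod (u x))\<^sup>2)"
          by (simp add: ennreal_le_iff)
        also have "\<dots> \<le> e\<^sup>2" using pQ by (simp add: u_def)
        finally have L1: "(LINT x|P. cmod (u x)) \<le> e"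
          by (rule P.L1_le_L2 [OF usqP e])
        have "(LINT x|P. u x) = (LINT x|P. of_real (indicator S x) - p x)"
          by (intro Bochner_Integration.integral_cong) (auto simp: u_def indicator_def)
        also have "\<dots> = (LINT x|P. of_real (indicator S x)) - (LINT x|P. p x)"
        proof (rule Bochner_Integration.integral_diff)
          show "integrable P (\<lambda>x. complex_of_real (indicator S x))"
            using S P(2) by (intro integrable_of_real integrable_real_indicator) (auto simp: P.emeasure_eq_measure)
          show "integrable P p"
            using B bounded(1) [OF p] by (intro P.integrable_const_bound [of _ B]) (auto simp: spaceP measP)
        qed
        also have "(LINT x|P. complex_of_real (indicator S x)) = of_real (P.prob S)"
        proof -
          have "(LINT x|P. complex_of_real (indicator S x)) = of_real (LINT x|P. indicator S x)"
            by (rule integral_complex_of_real)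
          then show ?thesis using S P(2) sets.sets_into_space [of S P] by (simp add: Int_absorb1)
        qed
        finally have "\<bar>P.prob S - Re (LINT x|P. p x)\<bar> = \<bar>Re (LINT x|P. u x)\<bar>" by simp
        also have "\<dots> \<le> e"
          using abs_Re_le_cmod [of "LINT x|P. u x"] integral_norm_bound [of P u] L1 by linarith
        finally show ?thesis .
      qed
      have "\<bar>M.prob S - Re (LINT x|M. p x)\<bar> \<le> e" "\<bar>N.prob S - Re (LINT x|N. p x)\<bar> \<le> e"
        using part [OF M refl] part [OF N sets] nn_integral_mixture_ge [OF sets] by (simp_all add: Q_def)
      then show ?thesis using eq [OF p] by simp
    qed
    have "\<bar>M.prob S - N.prob S\<bar> \<le> 0 + e" if "0 < e" for e
      using close [of "e / 2"] that by simp
    then have "\<bar>M.prob S - N.prob S\<bar> \<le> 0" by (rule field_le_epsilon)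
    then show "emeasure M S = emeasure N S" by (simp add: M.emeasure_eq_measure N.emeasure_eq_measure)
  qed (simp add: sets)
qed

section \<open>Gaussian sequences\<close>

abbreviation std_normal :: "real measure" where "std_normal \<equiv> std_normal_distribution"

interpretation std_normal: real_distribution std_normal
  by (rule real_dist_normal_dist)

interpretation noise: sequence_space std_normal
  by unfold_locales

abbreviation noise :: "(nat \<Rightarrow> real) measure" where "noise \<equiv> (\<Pi>\<^sub>M i\<in>UNIV. std_normal)"

lemma noise_coordinate_measurable [measurable]: "(\<lambda>\<omega>. \<omega> i) \<in> borel_measurable noise"
  using measurable_component_singleton [of i UNIV "\<lambda>_. std_normal"] by simp

text \<open>As scaled standard normals the degenerate and the nondegenerate laws have a common
  description, so later computations need no case distinction on \<sigma>.\<close>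

lemma centered_gaussian_scale: "centered_gaussian \<sigma> = distr std_normal borel (\<lambda>x. \<sigma> * x)" if "0 \<le> \<sigma>"
proof (cases "\<sigma> = 0")
  case True
  then show ?thesis by (simp add: centered_gaussian_def std_normal.distr_const)
next
  case False
  have "distributed std_normal lborel (\<lambda>x. x) std_normal_density"
    by (simp add: distributed_def distr_id2)
  then have "distributed std_normal lborel (\<lambda>x. 0 + \<sigma> * x) (normal_density (0 + \<sigma> * 0) (\<bar>\<sigma>\<bar> * 1))"
    using False by (intro std_normal.normal_density_affine) auto
  then have "distr std_normal lborel (\<lambda>x. \<sigma> * x) = density lborel (normal_density 0 \<sigma>)"
    using that by (simp add: distributed_def)
  moreover have "distr std_normal lborel (\<lambda>x. \<sigma> * x) = distr std_normal borel (\<lambda>x. \<sigma> * x)"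
    by (intro distr_cong) auto
  ultimately show ?thesis using False by (simp add: centered_gaussian_def)
qed

lemma real_distribution_centered_gaussian: "0 \<le> \<sigma> \<Longrightarrow> real_distribution (centered_gaussian \<sigma>)"
  unfolding centered_gaussian_scale by (intro std_normal.real_distribution_distr) simp

lemma char_centered_gaussian: "0 \<le> \<sigma> \<Longrightarrow> char (centered_gaussian \<sigma>) t = complex_of_real (exp (- (\<sigma>\<^sup>2 * t\<^sup>2) / 2))"
proof -
  assume "0 \<le> \<sigma>"
  then have "char (centered_gaussian \<sigma>) t = char std_normal (\<sigma> * t)"
    by (simp add: centered_gaussian_scale char_def integral_distr mult_ac)
  then show ?thesis by (simp add: char_std_normal_distribution power_mult_distrib)
qed

lemma centered_gaussian_second_moment:
  assumes "0 \<le> \<sigma>"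
  shows "integrable (centered_gaussian \<sigma>) (\<lambda>x. x\<^sup>2)" "(LINT x|centered_gaussian \<sigma>. x\<^sup>2) = \<sigma>\<^sup>2"
  using std_normal_distribution_even_moments [of 1] assms
  by (simp_all add: centered_gaussian_scale integrable_distr_eq integral_distr power_mult_distrib)

lemma (in prob_space) distr_centered_gaussianI:
  fixes X :: "'a \<Rightarrow> real"
  assumes X [measurable]: "random_variable borel X" and v: "0 \<le> v"
    and char: "\<And>t. (LINT x|M. iexp (t * X x)) = complex_of_real (exp (- (v * t\<^sup>2) / 2))"
  shows "distr M borel X = centered_gaussian (sqrt v)"
proof (rule Levy_uniqueness)
  show "real_distribution (distr M borel X)" by (rule real_distribution_distr) simp
  show "real_distribution (centered_gaussian (sqrt v))"
    using v by (intro real_distribution_centered_gaussian) simp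
  show "char (distr M borel X) = char (centered_gaussian (sqrt v))"
  proof
    fix t
    have "char (distr M borel X) t = (LINT x|M. iexp (t * X x))"
      unfolding char_def by (subst integral_distr) simp_all
    also have "\<dots> = complex_of_real (exp (- (v * t\<^sup>2) / 2))" by (rule char)
    also have "\<dots> = char (centered_gaussian (sqrt v)) t"
      using v char_centered_gaussian [of "sqrt v" t] by simp
    finally show "char (distr M borel X) t = char (centered_gaussian (sqrt v)) t" .
  qed
qed

lemma (in prob_space) gaussian_second_moment:
  fixes X :: "'a \<Rightarrow> real"
  assumes X [measurable]: "random_variable borel X" and v: "0 \<le> v"
    and char: "\<And>t. (LINT x|M. iexp (t * X x)) = complex_of_real (exp (- (v * t\<^sup>2) / 2))"
  shows "integrable M (\<lambda>x. (X x)\<^sup>2)" "(LINT x|M. (X x)\<^sup>2) = v"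
proof -
  have distr: "distr M borel X = centered_gaussian (sqrt v)"
    by (rule distr_centered_gaussianI [OF assms])
  have "integrable (distr M borel X) (\<lambda>x. x\<^sup>2)"
    unfolding distr using v by (intro centered_gaussian_second_moment) simp
  then show "integrable M (\<lambda>x. (X x)\<^sup>2)" by (simp add: integrable_distr_eq)
  have "(LINT x|M. (X x)\<^sup>2) = (LINT x|distr M borel X. x\<^sup>2)"
    by (subst integral_distr) simp_all
  also have "\<dots> = v"
    unfolding distr using centered_gaussian_second_moment(2) [of "sqrt v"] v by simp
  finally show "(LINT x|M. (X x)\<^sup>2) = v" .
qed

section \<open>Independent real and complex noise\<close>

lemma noise_indep: "noise.indep_vars (\<lambda>_. borel) (\<lambda>i \<omega>. \<omega> i) UNIV"
proof -
  have comp: "distr noise borel (\<lambda>\<omega>. \<omega> i) = std_normal" for i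
  proof -
    have "distr noise borel (\<lambda>\<omega>. \<omega> i) = distr noise std_normal (\<lambda>\<omega>. \<omega> i)"
      by (intro distr_cong) simp_all
    also have "\<dots> = std_normal" by (rule noise.PiM_component) simp
    finally show ?thesis .
  qed
  have "distr noise (\<Pi>\<^sub>M i\<in>UNIV. borel) (\<lambda>\<omega>. \<lambda>i\<in>UNIV. \<omega> i) = noise"
  proof -
    have "sets (\<Pi>\<^sub>M i\<in>UNIV. borel) = sets noise" by (intro sets_PiM_cong) simp_all
    then show ?thesis unfolding restrict_UNIV by (rule distr_id2)
  qed
  then show ?thesis
    by (subst noise.indep_vars_iff_distr_eq_PiM') (simp_all only: comp noise_coordinate_measurable UNIV_not_empty not_False_eq_True)
qed

lemma noise_char:
  assumes "finite I"
  shows "(LINT \<omega>|noise. iexp (\<Sum>i\<in>I. c i * \<omega> i)) = complex_of_real (exp (- (\<Sum>i\<in>I. (c i)\<^sup>2) / 2))"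
proof -
  have comp: "(LINT \<omega>|noise. iexp (c i * \<omega> i)) = complex_of_real (exp (- (c i)\<^sup>2 / 2))" for i
  proof -
    have "(LINT \<omega>|noise. iexp (c i * \<omega> i)) = (LINT x|distr noise std_normal (\<lambda>\<omega>. \<omega> i). iexp (c i * x))"
      by (rule integral_distr [symmetric]) simp_all
    also have "\<dots> = char std_normal (c i)"
      by (simp add: noise.PiM_component char_def)
    finally show ?thesis by (simp add: char_std_normal_distribution)
  qed
  have ind: "noise.indep_vars (\<lambda>_. borel) (\<lambda>i \<omega>. iexp (c i * \<omega> i)) I"
    using noise.indep_vars_compose2 [OF noise.indep_vars_subset [OF noise_indep subset_UNIV], of I "\<lambda>i x. iexp (c i * x)" "\<lambda>_. borel"]
    by simp
  have "iexp (\<Sum>i\<in>I. c i * \<omega> i) = (\<Prod>i\<in>I. iexp (c i * \<omega> i))" for \<omega>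
    using assms by (simp add: exp_sum sum_distrib_left)
  then have "(LINT \<omega>|noise. iexp (\<Sum>i\<in>I. c i * \<omega> i)) = (LINT \<omega>|noise. (\<Prod>i\<in>I. iexp (c i * \<omega> i)))"
    by simp
  also have "\<dots> = (\<Prod>i\<in>I. LINT \<omega>|noise. iexp (c i * \<omega> i))"
    using assms ind by (intro noise.indep_vars_lebesgue_integral noise.integrable_const_bound [of _ 1]) auto
  also have "\<dots> = complex_of_real (\<Prod>i\<in>I. exp (- (c i)\<^sup>2 / 2))"
    by (simp only: comp of_real_prod)
  also have "(\<Prod>i\<in>I. exp (- (c i)\<^sup>2 / 2)) = exp (- (\<Sum>i\<in>I. (c i)\<^sup>2) / 2)"
    using assms by (simp add: sum_negf sum_divide_distrib flip: exp_sum)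
  finally show ?thesis .
qed

text \<open>Both real components have variance 1, so the mean of the squared modulus is 2; this is
  the factor 2 in the second moments below.\<close>

definition cnoise :: "nat \<Rightarrow> (nat \<Rightarrow> real) \<Rightarrow> complex" where
  "cnoise k \<omega> = Complex (\<omega> (2 * k)) (\<omega> (2 * k + 1))"

lemma cnoise_measurable [measurable]: "cnoise k \<in> borel_measurable noise"
  unfolding cnoise_def complex_eq_iff borel_measurable_complex_iff by simp

lemma sum_lessThan_double: "(\<Sum>i<2 * (n::nat). f i) = (\<Sum>k<n. f (2 * k) + f (2 * k + 1) :: 'a :: comm_monoid_add)"
  by (induction n) (simp_all add: add.assoc)

lemma cnoise_char:
  "(LINT \<omega>|noise. iexp (Re (\<Sum>k<r. b k * cnoise k \<omega>))) = complex_of_real (exp (- (\<Sum>k<r. (cmod (b k))\<^sup>2) / 2))"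
proof -
  define c where "c i = (if even i then Re (b (i div 2)) else - Im (b (i div 2)))" for i
  have c: "c (2 * k) = Re (b k)" "c (Suc (2 * k)) = - Im (b k)" for k
    by (simp_all add: c_def)
  have "Re (\<Sum>k<r. b k * cnoise k \<omega>) = (\<Sum>i<2 * r. c i * \<omega> i)" for \<omega>
    unfolding sum_lessThan_double by (simp add: c cnoise_def)
  moreover have "(\<Sum>k<r. (cmod (b k))\<^sup>2) = (\<Sum>i<2 * r. (c i)\<^sup>2)"
    unfolding sum_lessThan_double by (simp add: c cmod_power2)
  ultimately show ?thesis using noise_char [of "{..<2 * r}" c] by simp
qed

lemma cnoise_second_moment:
  "integrable noise (\<lambda>\<omega>. (cmod (\<Sum>k<r. b k * cnoise k \<omega>))\<^sup>2)"
  "(LINT \<omega>|noise. (cmod (\<Sum>k<r. b k * cnoise k \<omega>))\<^sup>2) = 2 * (\<Sum>k<r. (cmod (b k))\<^sup>2)"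
proof -
  define Z where "Z \<omega> = (\<Sum>k<r. b k * cnoise k \<omega>)" for \<omega>
  have Z [measurable]: "Z \<in> borel_measurable noise" unfolding Z_def by measurable
  \<comment> \<open>The choices u = 1 and u = -\<i> make \<open>Re (u * Z \<omega>)\<close> the real
    and the imaginary part of \<open>Z \<omega>\<close>.\<close>
  have char: "(LINT \<omega>|noise. iexp (t * Re (u * Z \<omega>))) = complex_of_real (exp (- ((\<Sum>k<r. (cmod (b k))\<^sup>2) * t\<^sup>2) / 2))"
    if "cmod u = 1" for u t
  proof -
    have "t * Re (u * Z \<omega>) = Re (\<Sum>k<r. (of_real t * u * b k) * cnoise k \<omega>)" for \<omega>
    proof -
      have "t * Re (u * Z \<omega>) = Re (of_real t * (u * Z \<omega>))" by simp
      also have "of_real t * (u * Z \<omega>) = (\<Sum>k<r. (of_real t * u * b k) * cnoise k \<omega>)"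
        by (simp add: Z_def sum_distrib_left mult.assoc)
      finally show ?thesis .
    qed
    moreover have "(\<Sum>k<r. (cmod (of_real t * u * b k))\<^sup>2) = (\<Sum>k<r. (cmod (b k))\<^sup>2) * t\<^sup>2"
      using that by (simp add: norm_mult power_mult_distrib sum_distrib_left mult.commute)
    ultimately show ?thesis by (simp only: cnoise_char)
  qed
  have re: "integrable noise (\<lambda>\<omega>. (Re (Z \<omega>))\<^sup>2)" "(LINT \<omega>|noise. (Re (Z \<omega>))\<^sup>2) = (\<Sum>k<r. (cmod (b k))\<^sup>2)"
    using noise.gaussian_second_moment [of "\<lambda>\<omega>. Re (Z \<omega>)" "\<Sum>k<r. (cmod (b k))\<^sup>2"] char [of 1]
    by (simp_all add: sum_nonneg)
  have im: "integrable noise (\<lambda>\<omega>. (Im (Z \<omega>))\<^sup>2)" "(LINT \<omega>|noise. (Im (Z \<omega>))\<^sup>2) = (\<Sum>k<r. (cmod (b k))\<^sup>2)"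
    using noise.gaussian_second_moment [of "\<lambda>\<omega>. Im (Z \<omega>)" "\<Sum>k<r. (cmod (b k))\<^sup>2"] char [of "- \<i>"]
    by (simp_all add: sum_nonneg)
  show "integrable noise (\<lambda>\<omega>. (cmod (\<Sum>k<r. b k * cnoise k \<omega>))\<^sup>2)"
    "(LINT \<omega>|noise. (cmod (\<Sum>k<r. b k * cnoise k \<omega>))\<^sup>2) = 2 * (\<Sum>k<r. (cmod (b k))\<^sup>2)"
    using re im unfolding Z_def [symmetric] cmod_power2 by simp_all
qed

text \<open>Independence of the first \<open>m\<close> coordinates from the others, obtained from
  the fact that gluing two independent noise sequences with \<open>comb_seq m\<close> gives noise
  again.\<close>

lemma noise_splitting:
  assumes B [measurable]: "Measurable.pred noise P" and T [measurable]: "Measurable.pred noise Q"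
    and P: "\<And>\<omega> \<omega>'. (\<And>i. i < m \<Longrightarrow> \<omega> i = \<omega>' i) \<Longrightarrow> P \<omega> = P \<omega>'"
    and Q: "\<And>\<omega> \<omega>'. (\<And>i. m \<le> i \<Longrightarrow> \<omega> i = \<omega>' i) \<Longrightarrow> Q \<omega> = Q \<omega>'"
  shows "emeasure noise {\<omega> \<in> space noise. P \<omega> \<and> Q \<omega>} =
    emeasure noise {\<omega> \<in> space noise. P \<omega>} * emeasure noise {\<omega> \<in> space noise. Q \<omega>}"
proof -
  \<comment> \<open>\<open>Q\<close> ignores the first \<open>m\<close> coordinates, so zeros may be
    filled in. \<open>comb_seq\<close> moves the second sequence by \<open>m\<close> places, so
    \<open>Q'\<close> is a translated form of \<open>Q\<close>; the split for the trivial event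
    shows that the two have equal probability.\<close>
  define Q' where "Q' \<omega>' = Q (comb_seq m (\<lambda>_. 0) \<omega>')" for \<omega>'
  have space: "space noise = UNIV" by (simp add: space_PiM)
  have "(\<lambda>\<omega>'. comb_seq m (\<lambda>_. 0) \<omega>') \<in> noise \<rightarrow>\<^sub>M noise"
    by (rule measurable_comb_seq') (simp_all add: space_PiM)
  then have Q' [measurable]: "Measurable.pred noise Q'"
    unfolding Q'_def by measurable
  have comb: "P (comb_seq m \<omega> \<omega>') = P \<omega>" "Q (comb_seq m \<omega> \<omega>') = Q' \<omega>'" for \<omega> \<omega>'
    unfolding Q'_def by (auto intro!: P Q simp: comb_seq_def)
  have split: "emeasure noise {\<omega> \<in> space noise. R \<omega> \<and> Q \<omega>} =
      emeasure noise {\<omega> \<in> space noise. R \<omega>} * emeasure noise {\<omega> \<in> space noise. Q' \<omega>}"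
    if [measurable]: "Measurable.pred noise R" and R: "\<And>\<omega> \<omega>'. R (comb_seq m \<omega> \<omega>') = R \<omega>" for R
  proof -
    have "emeasure noise {\<omega> \<in> space noise. R \<omega> \<and> Q \<omega>} =
        emeasure (distr (noise \<Otimes>\<^sub>M noise) noise (\<lambda>(\<omega>, \<omega>'). comb_seq m \<omega> \<omega>')) {\<omega> \<in> space noise. R \<omega> \<and> Q \<omega>}"
      by (simp only: noise.PiM_comb_seq)
    also have "\<dots> = emeasure (noise \<Otimes>\<^sub>M noise)
        ((\<lambda>(\<omega>, \<omega>'). comb_seq m \<omega> \<omega>') -` {\<omega> \<in> space noise. R \<omega> \<and> Q \<omega>} \<inter> space (noise \<Otimes>\<^sub>M noise))"
      by (rule emeasure_distr) (auto intro: measurable_comb_seq)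
    also have "(\<lambda>(\<omega>, \<omega>'). comb_seq m \<omega> \<omega>') -` {\<omega> \<in> space noise. R \<omega> \<and> Q \<omega>} \<inter> space (noise \<Otimes>\<^sub>M noise) =
        {\<omega> \<in> space noise. R \<omega>} \<times> {\<omega> \<in> space noise. Q' \<omega>}"
      by (auto simp: space_pair_measure space R comb)
    also have "emeasure (noise \<Otimes>\<^sub>M noise) \<dots> =
        emeasure noise {\<omega> \<in> space noise. R \<omega>} * emeasure noise {\<omega> \<in> space noise. Q' \<omega>}"
      by (rule noise.emeasure_pair_measure_Times) measurable
    finally show ?thesis .
  qed
  have "emeasure noise {\<omega> \<in> space noise. Q \<omega>} = emeasure noise {\<omega> \<in> space noise. Q' \<omega>}"
    using split [of "\<lambda>_. True"] noise.emeasure_space_1 by simp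
  then show ?thesis using split [OF B comb(1)] by simp
qed

lemma std_normal_interval_pos:
  assumes "a < b" shows "0 < emeasure std_normal {a<..<b}"
proof (rule ccontr)
  assume "\<not> 0 < emeasure std_normal {a<..<b}"
  then have "{a<..<b} \<in> null_sets std_normal" by (auto simp: null_sets_def)
  then have "AE x in lborel. x \<in> {a<..<b} \<longrightarrow> ennreal (std_normal_density x) \<le> 0"
    by (subst (asm) null_sets_density_iff) auto
  then have "AE x in lborel. x \<notin> {a<..<b}"
    by (rule eventually_mono) (use normal_density_pos [of 1 0] in \<open>auto simp: ennreal_eq_0_iff not_le [symmetric]\<close>)
  then have "emeasure lborel {a<..<b} = 0"
    by (subst (asm) AE_iff_measurable [where N = "{a<..<b}"]) auto
  then show False using assms by simp
qed

lemma noise_box_pos: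
  assumes "finite J" "\<And>i. i \<in> J \<Longrightarrow> a i < b i"
  shows "0 < emeasure noise {\<omega> \<in> space noise. \<forall>i\<in>J. \<omega> i \<in> {a i<..<b i}}"
proof -
  have "emeasure noise {\<omega> \<in> space noise. \<forall>i\<in>J. \<omega> i \<in> {a i<..<b i}} = (\<Prod>i\<in>J. emeasure std_normal {a i<..<b i})"
    using assms(1) by (intro noise.emeasure_PiM_Collect) auto
  moreover have "(\<Prod>i\<in>J. emeasure std_normal {a i<..<b i}) \<noteq> 0"
    using assms std_normal_interval_pos by (force simp: prod_zero_iff)
  ultimately show ?thesis by (simp add: zero_less_iff_neq_zero)
qed

text \<open>As an \<open>ennreal\<close> series, membership is a measurable event, and a finite
  expectation yields it almost surely.\<close>

lemma wl2_set_iff: "x \<in> wl2_set \<longleftrightarrow> (\<Sum>n. ennreal ((cmod (x n))\<^sup>2 / 2 ^ n)) \<noteq> \<infinity>"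
  unfolding wl2_set_def infinity_ennreal_def by (auto simp: ennreal_suminf_neq_top intro!: summable_suminf_not_top)

section \<open>The Gaussian law of a row-finite matrix\<close>

text \<open>Row-finiteness makes each coordinate of the process a finite sum of noise variables,
  without any question of convergence. The uniform bound \<open>C\<close> on the variances is what
  puts almost every path into the weighted space.\<close>

locale gaussian_matrix =
  fixes A :: "nat \<Rightarrow> nat \<Rightarrow> real" and w :: "nat \<Rightarrow> nat" and C :: real
  assumes row_finite: "w n \<le> k \<Longrightarrow> A n k = 0"
    and row_bounded: "(\<Sum>k<w n. (A n k)\<^sup>2) \<le> C"
begin

text \<open>The covariance of the real parts of two coordinates of the process; the complex
  covariance is twice this.\<close>

definition cov :: "nat \<Rightarrow> nat \<Rightarrow> real" where
  "cov n m = (\<Sum>k<max (w n) (w m). A n k * A m k)"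

lemma cov_eq: "w n \<le> r \<Longrightarrow> w m \<le> r \<Longrightarrow> cov n m = (\<Sum>k<r. A n k * A m k)"
  unfolding cov_def by (rule sum.mono_neutral_left) (auto simp: row_finite)

definition process :: "(nat \<Rightarrow> real) \<Rightarrow> nat \<Rightarrow> complex" where
  "process \<omega> n = (\<Sum>k<w n. of_real (A n k) * cnoise k \<omega>)"

lemma process_measurable [measurable]: "(\<lambda>\<omega>. process \<omega> n) \<in> borel_measurable noise"
  unfolding process_def by measurable

lemma process_eq: "w n \<le> r \<Longrightarrow> process \<omega> n = (\<Sum>k<r. of_real (A n k) * cnoise k \<omega>)"
  unfolding process_def by (rule sum.mono_neutral_left) (auto simp: row_finite)

lemma process_char:
  assumes J: "finite J"
  shows "(LINT \<omega>|noise. iexp (Re (\<Sum>j\<in>J. b j * process \<omega> (s j)))) =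
    complex_of_real (exp (- (\<Sum>i\<in>J. \<Sum>j\<in>J. Re (b i * cnj (b j)) * cov (s i) (s j)) / 2))"
proof -
  define r where "r = Max (insert 0 ((w \<circ> s) ` J))"
  have r: "w (s j) \<le> r" if "j \<in> J" for j
    unfolding r_def using J that by (intro Max_ge) auto
  define c where "c k = (\<Sum>j\<in>J. b j * of_real (A (s j) k))" for k
  have "(\<Sum>j\<in>J. b j * process \<omega> (s j)) = (\<Sum>k<r. c k * cnoise k \<omega>)" for \<omega>
  proof -
    have "(\<Sum>j\<in>J. b j * process \<omega> (s j)) = (\<Sum>j\<in>J. \<Sum>k<r. b j * of_real (A (s j) k) * cnoise k \<omega>)"
      by (intro sum.cong refl) (simp only: process_eq [OF r] sum_distrib_left mult.assoc)
    also have "\<dots> = (\<Sum>k<r. c k * cnoise k \<omega>)"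
      by (subst sum.swap) (simp only: c_def sum_distrib_right)
    finally show ?thesis .
  qed
  moreover have "(\<Sum>k<r. (cmod (c k))\<^sup>2) = (\<Sum>i\<in>J. \<Sum>j\<in>J. Re (b i * cnj (b j)) * cov (s i) (s j))"
  proof -
    have "(cmod (c k))\<^sup>2 = (\<Sum>i\<in>J. \<Sum>j\<in>J. Re (b i * cnj (b j)) * (A (s i) k * A (s j) k))" for k
    proof -
      have "(cmod (c k))\<^sup>2 = Re (c k * cnj (c k))"
        by (simp add: cmod_power2 flip: power2_eq_square)
      also have "c k * cnj (c k) = (\<Sum>i\<in>J. \<Sum>j\<in>J. (b i * cnj (b j)) * of_real (A (s i) k * A (s j) k))"
        unfolding c_def cnj_sum sum_product by (intro sum.cong refl) (simp add: ac_simps)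
      finally show ?thesis by (simp only: Re_sum Re_complex_of_real Im_complex_of_real times_complex.sel mult_zero_right diff_zero)
    qed
    then have "(\<Sum>k<r. (cmod (c k))\<^sup>2) = (\<Sum>i\<in>J. \<Sum>j\<in>J. \<Sum>k<r. Re (b i * cnj (b j)) * (A (s i) k * A (s j) k))"
      by (simp only: sum.swap [of _ "{..<r}"])
    also have "\<dots> = (\<Sum>i\<in>J. \<Sum>j\<in>J. Re (b i * cnj (b j)) * cov (s i) (s j))"
      by (intro sum.cong refl) (simp only: cov_eq [OF r r] sum_distrib_left)
    finally show ?thesis .
  qed
  ultimately show ?thesis using cnoise_char [where r = r and b = c] by simp
qed

text \<open>The part of the process that does not see the first \<open>m\<close> noise variables.
  Zeroing the coefficients, instead of restricting the range, keeps the sum in the form treated by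
  \<open>cnoise_second_moment\<close>.\<close>

definition tail :: "nat \<Rightarrow> (nat \<Rightarrow> real) \<Rightarrow> nat \<Rightarrow> complex" where
  "tail m \<omega> n = (\<Sum>k<w n. of_real (if k < m then 0 else A n k) * cnoise k \<omega>)"

lemma tail_measurable [measurable]: "(\<lambda>\<omega>. tail m \<omega> n) \<in> borel_measurable noise"
  unfolding tail_def by measurable

lemma tail_nn_integral:
  "(\<integral>\<^sup>+\<omega>. (\<Sum>n. ennreal ((cmod (tail m \<omega> n))\<^sup>2 / 2 ^ n)) \<partial>noise) =
    (\<Sum>n. ennreal (2 * (\<Sum>k<w n. (if k < m then 0 else A n k)\<^sup>2) / 2 ^ n))"
proof -
  have "(\<integral>\<^sup>+\<omega>. ennreal ((cmod (tail m \<omega> n))\<^sup>2 / 2 ^ n) \<partial>noise) =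
      ennreal (2 * (\<Sum>k<w n. (if k < m then 0 else A n k)\<^sup>2) / 2 ^ n)" for n
  proof -
    let ?b = "\<lambda>k. complex_of_real (if k < m then 0 else A n k)"
    have "(\<integral>\<^sup>+\<omega>. ennreal ((cmod (tail m \<omega> n))\<^sup>2 / 2 ^ n) \<partial>noise) =
        ennreal (LINT \<omega>|noise. (cmod (tail m \<omega> n))\<^sup>2 / 2 ^ n)"
      using cnoise_second_moment(1) [where r = "w n" and b = ?b]
      by (intro nn_integral_eq_integral) (auto simp: tail_def)
    also have "(LINT \<omega>|noise. (cmod (tail m \<omega> n))\<^sup>2 / 2 ^ n) = 2 * (\<Sum>k<w n. (if k < m then 0 else A n k)\<^sup>2) / 2 ^ n"
      using cnoise_second_moment(2) [where r = "w n" and b = ?b] by (simp add: tail_def)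
    finally show ?thesis .
  qed
  then show ?thesis by (subst nn_integral_suminf) simp_all
qed

lemma row_tail_le: "(\<Sum>k<w n. (if k < m then 0 else A n k)\<^sup>2) \<le> C"
proof -
  have "(\<Sum>k<w n. (if k < m then 0 else A n k)\<^sup>2) \<le> (\<Sum>k<w n. (A n k)\<^sup>2)"
    by (rule sum_mono) simp
  then show ?thesis using row_bounded [of n] by linarith
qed

lemma bound_nonneg: "0 \<le> C"
  using row_bounded [of 0] sum_nonneg [of "{..<w 0}" "\<lambda>k. (A 0 k)\<^sup>2"] by simp

lemma summable_bound: "summable (\<lambda>n. 2 * C / 2 ^ n)"
proof -
  have "(\<lambda>n. 2 * C / 2 ^ n) = (\<lambda>n. 2 * C * (1 / 2) ^ n)" by (simp add: power_divide)
  then show ?thesis by (simp only:) (intro summable_mult summable_geometric, simp)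
qed

lemma tail_nn_integral_finite: "(\<integral>\<^sup>+\<omega>. (\<Sum>n. ennreal ((cmod (tail m \<omega> n))\<^sup>2 / 2 ^ n)) \<partial>noise) < \<infinity>"
proof -
  have "(\<Sum>n. ennreal (2 * (\<Sum>k<w n. (if k < m then 0 else A n k)\<^sup>2) / 2 ^ n)) \<le> (\<Sum>n. ennreal (2 * C / 2 ^ n))"
    using row_tail_le by (intro suminf_le ennreal_leI divide_right_mono) auto
  also have "\<dots> = ennreal (\<Sum>n. 2 * C / 2 ^ n)"
    using bound_nonneg summable_bound by (intro suminf_ennreal2) auto
  also have "\<dots> < \<infinity>" by simp
  finally show ?thesis by (simp add: tail_nn_integral)
qed

lemma AE_tail: "AE \<omega> in noise. tail m \<omega> \<in> wl2_set"
proof -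
  have "AE \<omega> in noise. (\<Sum>n. ennreal ((cmod (tail m \<omega> n))\<^sup>2 / 2 ^ n)) \<noteq> \<infinity>"
    using tail_nn_integral_finite [of m] by (intro nn_integral_PInf_AE) auto
  then show ?thesis
    by (rule eventually_mono) (simp add: wl2_set_iff)
qed

lemma tail_0: "tail 0 = process"
  by (auto simp: tail_def process_def fun_eq_iff)

lemma AE_process: "AE \<omega> in noise. process \<omega> \<in> wl2_set"
  using AE_tail [of 0] by (simp add: tail_0)

text \<open>A modification on a null set, so that every noise sequence is mapped into the
  space.\<close>

definition path :: "(nat \<Rightarrow> real) \<Rightarrow> nat \<Rightarrow> complex" where
  "path \<omega> = (if process \<omega> \<in> wl2_set then process \<omega> else (\<lambda>_. 0))"

lemma path_in: "path \<omega> \<in> wl2_set"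
  by (simp add: path_def wl2_zero)

lemma AE_path: "AE \<omega> in noise. path \<omega> = process \<omega>"
  using AE_process by (rule eventually_mono) (simp add: path_def)

lemma process_in_measurable [measurable]: "Measurable.pred noise (\<lambda>\<omega>. process \<omega> \<in> wl2_set)"
  unfolding wl2_set_iff by measurable

lemma path_measurable [measurable]: "path \<in> noise \<rightarrow>\<^sub>M borel_on wl2"
proof (rule measurable_borel_wl2I)
  show "(\<lambda>\<omega>. path \<omega> i) \<in> borel_measurable noise" for i
  proof -
    have "(\<lambda>\<omega>. if process \<omega> \<in> wl2_set then process \<omega> i else 0) \<in> borel_measurable noise"
      by measurable
    then show ?thesis by (simp add: path_def if_distrib [of "\<lambda>f. f i"])
  qed
qed (rule path_in)

definition law :: "(nat \<Rightarrow> complex) measure" where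
  "law = distr noise (borel_on wl2) path"

lemma sets_law [simp, measurable_cong]: "sets law = sets (borel_on wl2)" and space_law [simp]: "space law = wl2_set"
  by (simp_all add: law_def)

sublocale law: prob_space law
  unfolding law_def by (rule noise.prob_space_distr) measurable

lemma law_integral:
  fixes f :: "(nat \<Rightarrow> complex) \<Rightarrow> complex"
  assumes f: "f \<in> borel_measurable (borel_on wl2)"
    and g: "g \<in> borel_measurable noise" and fg: "\<And>\<omega>. path \<omega> = process \<omega> \<Longrightarrow> f (process \<omega>) = g \<omega>"
  shows "(LINT x|law. f x) = (LINT \<omega>|noise. g \<omega>)"
proof -
  have "(LINT x|law. f x) = (LINT \<omega>|noise. f (path \<omega>))"
    unfolding law_def using f by (intro integral_distr) measurable
  also have "\<dots> = (LINT \<omega>|noise. g \<omega>)"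
    using f g AE_path by (intro integral_cong_AE) (auto elim!: eventually_mono simp: fg)
  finally show ?thesis .
qed

lemma law_char:
  assumes J: "finite J"
  shows "(LINT x|law. iexp (Re (\<Sum>j\<in>J. b j * x (s j)))) =
    complex_of_real (exp (- (\<Sum>i\<in>J. \<Sum>j\<in>J. Re (b i * cnj (b j)) * cov (s i) (s j)) / 2))"
proof -
  note [measurable] = wl2_coordinate_measurable
  have "(LINT x|law. iexp (Re (\<Sum>j\<in>J. b j * x (s j)))) = (LINT \<omega>|noise. iexp (Re (\<Sum>j\<in>J. b j * process \<omega> (s j))))"
    by (rule law_integral) (auto simp del: of_real_sum Re_sum)
  then show ?thesis using process_char [OF J] by simp
qed

end

text \<open>A working substitute for the real dual: stable under sums and real multiples, computable
  by \<open>law_char\<close>, and rich enough to generate the Borel sets.\<close>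

definition linear_functionals :: "((nat \<Rightarrow> complex) \<Rightarrow> real) set" where
  "linear_functionals = {\<lambda>x. Re (\<Sum>n<N. a n * x n) | N a. True}"

lemma linear_functionals_Re: "(\<lambda>x. Re (\<Sum>n<N. a n * x n)) \<in> linear_functionals"
  unfolding linear_functionals_def by blast

lemma linear_functionals_pad:
  fixes N M :: nat and x :: "nat \<Rightarrow> complex"
  assumes "N \<le> M"
  shows "Re (\<Sum>n<N. a n * x n) = Re (\<Sum>n<M. (if n < N then a n else 0) * x n)"
  by (intro arg_cong [where f = Re] sum.mono_neutral_cong_left) (use assms in auto)

lemma linear_functionals_add:
  assumes "l \<in> linear_functionals" "l' \<in> linear_functionals"
  shows "(\<lambda>x. l x + l' x) \<in> linear_functionals"
proof -
  obtain N a N' a' where l: "l = (\<lambda>x. Re (\<Sum>n<N. a n * x n))" and l': "l' = (\<lambda>x. Re (\<Sum>n<N'. a' n * x n))"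
    using assms unfolding linear_functionals_def by blast
  have "l x + l' x = Re (\<Sum>n<max N N'. ((if n < N then a n else 0) + (if n < N' then a' n else 0)) * x n)" for x
    unfolding l l' linear_functionals_pad [OF max.cobounded1 [of N N']] linear_functionals_pad [OF max.cobounded2 [of N' N]]
    by (simp only: distrib_right sum.distrib plus_complex.sel)
  then show ?thesis using linear_functionals_Re by presburger
qed

lemma linear_functionals_scale:
  assumes "l \<in> linear_functionals" shows "(\<lambda>x. t * l x) \<in> linear_functionals"
proof -
  obtain N a where l: "l = (\<lambda>x. Re (\<Sum>n<N. a n * x n))"
    using assms unfolding linear_functionals_def by blast
  have "t * l x = Re (\<Sum>n<N. (of_real t * a n) * x n)" for x
  proof -
    have "t * l x = Re (of_real t * (\<Sum>n<N. a n * x n))" by (simp add: l)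
    then show ?thesis by (simp only: sum_distrib_left mult.assoc)
  qed
  then show ?thesis using linear_functionals_Re by presburger
qed

lemma linear_functionals_zero: "(\<lambda>x. 0) \<in> linear_functionals"
  using linear_functionals_Re [where N = 0 and a = "\<lambda>_. 0"] by simp

lemma linear_functionals_measurable:
  assumes "l \<in> linear_functionals" shows "l \<in> borel_measurable (borel_on wl2)"
proof -
  obtain N a where l: "l = (\<lambda>x. Re (\<Sum>n<N. a n * x n))"
    using assms unfolding linear_functionals_def by blast
  have "(\<lambda>x. \<Sum>n<N. a n * x n) \<in> borel_measurable (borel_on wl2)"
    by (intro borel_measurable_sum borel_measurable_times wl2_coordinate_measurable borel_measurable_const)
  then show ?thesis unfolding l by measurable
qed

text \<open>The identity map is measurable from the generated \<sigma>-algebra to the Borel sets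
  because its coordinates are; the factors u = 1 and u = -\<i> give their real and imaginary
  parts.\<close>

lemma borel_wl2_generated:
  "sets (borel_on wl2) \<subseteq> sigma_sets wl2_set {{x \<in> wl2_set. a < l x} | a l. l \<in> linear_functionals}"
proof -
  define G where "G = {{x \<in> wl2_set. a < l x} | a l. l \<in> linear_functionals}"
  have lin: "(\<lambda>x. Re (u * x i)) \<in> linear_functionals" for u i
  proof -
    have "Re (u * x i) = Re (\<Sum>n<Suc i. (if n = i then u else 0) * x n)" for x :: "nat \<Rightarrow> complex"
      by (simp add: if_distrib [of "\<lambda>z. z * _"] cong: if_cong)
    then show ?thesis using linear_functionals_Re by presburger
  qed
  have "(\<lambda>x. x) \<in> sigma wl2_set G \<rightarrow>\<^sub>M borel_on wl2"
  proof (rule measurable_borel_wl2I)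
    have G: "G \<subseteq> Pow wl2_set" by (auto simp: G_def)
    have l: "(\<lambda>x. Re (u * x i)) \<in> borel_measurable (sigma wl2_set G)" for u i
      unfolding borel_measurable_iff_greater
    proof (intro allI)
      fix a
      have "{x \<in> wl2_set. a < Re (u * x i)} \<in> G" 
        unfolding G_def mem_Collect_eq by (intro exI [of _ a] exI [of _ "\<lambda>x. Re (u * x i)"] conjI refl lin)
      then show "{w \<in> space (sigma wl2_set G). a < Re (u * w i)} \<in> sets (sigma wl2_set G)"
        using G by (simp add: space_measure_of sets_measure_of)
    qed
    show "(\<lambda>x. x i) \<in> borel_measurable (sigma wl2_set G)" for i
      using l [of 1 i] l [of "- \<i>" i] by (simp add: borel_measurable_complex_iff)
  qed (simp add: space_measure_of_conv)
  moreover have "space (borel_on wl2) = space (sigma wl2_set G)" by (simp add: space_measure_of_conv)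
  ultimately have "sets (borel_on wl2) \<subseteq> sets (sigma wl2_set G)"
    using measurable_sets [of "\<lambda>x. x" "sigma wl2_set G" "borel_on wl2"] sets.sets_into_space [of _ "borel_on wl2"]
    by (fastforce simp: Int_absorb2)
  also have "\<dots> = sigma_sets wl2_set G" by (intro sets_measure_of) (auto simp: G_def)
  finally show ?thesis by (simp add: G_def)
qed

section \<open>Gaussianity, invariance and full support\<close>

context gaussian_matrix
begin

lemma prob_law [simp]: "law.prob wl2_set = 1"
  using law.prob_space by simp

text \<open>\<phi> is the pointwise limit of finite combinations of coordinates, whose
  characteristic functions are Gaussian with variances \<open>vN\<close>. The obstacle is that these
  variances might diverge; continuity of the limit function at 0 excludes it.\<close>

lemma law_functional_char:
  assumes \<phi>: "\<phi> \<in> continuous_functionals wl2"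
  shows "\<exists>v\<ge>0. \<forall>u. (LINT x|law. iexp (Re (u * \<phi> x))) = complex_of_real (exp (- (v * (cmod u)\<^sup>2) / 2))"
proof -
  define c where "c n = \<phi> (\<lambda>m. of_bool (m = n))" for n
  define vN where "vN N = (\<Sum>i<N. \<Sum>j<N. Re (c i * cnj (c j)) * cov i j)" for N :: nat
  define G where "G u = (LINT x|law. iexp (Re (u * \<phi> x)))" for u
  have \<phi>m [measurable]: "\<phi> \<in> borel_measurable law"
    using functional_measurable [OF \<phi>] by (simp cong: measurable_cong_sets)
  have coord: "(\<lambda>x. x i) \<in> borel_measurable law" for i
    using wl2_coordinate_measurable by (simp cong: measurable_cong_sets)
  define S where "S N x = (\<Sum>n<N. x n * c n)" for N :: nat and x
  have [measurable]: "S N \<in> borel_measurable law" for N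
    unfolding S_def by (intro borel_measurable_sum borel_measurable_times coord borel_measurable_const)
  have finite: "(LINT x|law. iexp (Re (u * S N x))) = complex_of_real (exp (- (vN N * (cmod u)\<^sup>2) / 2))" for u N
  proof -
    have "u * S N x = (\<Sum>n<N. (u * c n) * x n)" for x :: "nat \<Rightarrow> complex"
      by (simp only: S_def sum_distrib_left) (simp add: ac_simps)
    moreover have "(\<Sum>i<N. \<Sum>j<N. Re ((u * c i) * cnj (u * c j)) * cov i j) = vN N * (cmod u)\<^sup>2"
    proof -
      have "Re ((u * c i) * cnj (u * c j)) = Re (c i * cnj (c j)) * (cmod u)\<^sup>2" for i j
      proof -
        have "(u * c i) * cnj (u * c j) = (u * cnj u) * (c i * cnj (c j))" by simp
        also have "u * cnj u = of_real ((cmod u)\<^sup>2)" by (simp only: complex_norm_square)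
        finally show ?thesis by (simp only: times_complex.sel Re_complex_of_real Im_complex_of_real) simp
      qed
      then show ?thesis by (simp only: vN_def sum_distrib_right) (simp add: ac_simps)
    qed
    ultimately show ?thesis
      using law_char [of "{..<N}" "\<lambda>n. u * c n" "\<lambda>n. n"] by simp
  qed
  have lim: "(\<lambda>N. complex_of_real (exp (- (vN N * (cmod u)\<^sup>2) / 2))) \<longlonglongrightarrow> G u" for u
    unfolding finite [symmetric] G_def
  proof (rule integral_dominated_convergence [where w = "\<lambda>_. 1"])
    have "(\<lambda>N. iexp (Re (u * S N x))) \<longlonglongrightarrow> iexp (Re (u * \<phi> x))" if "x \<in> wl2_set" for x
      using wl2_functional_limit [OF \<phi> that] unfolding S_def c_def by (intro tendsto_intros)
    then show "AE x in law. (\<lambda>N. iexp (Re (u * S N x))) \<longlonglongrightarrow> iexp (Re (u * \<phi> x))"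
      by (intro AE_I2) simp
    show "(\<lambda>x. iexp (Re (u * S N x))) \<in> borel_measurable law" for N by measurable
  qed simp_all
  \<comment> \<open>Continuity at 0 along 1 / (k + 1) produces one real t > 0 at which the limit is
    nonzero, whereas divergent variances would force 0 there.\<close>
  have "(\<lambda>k. G (of_real (1 / real (Suc k)))) \<longlonglongrightarrow> (LINT x|law. iexp (Re (0 * \<phi> x)))"
    unfolding G_def
  proof (rule integral_dominated_convergence [where w = "\<lambda>_. 1"])
    have "(\<lambda>k. 1 / real (Suc k)) \<longlonglongrightarrow> 0"
      using LIMSEQ_inverse_real_of_nat by (simp add: inverse_eq_divide)
    then have "(\<lambda>k. iexp (Re (of_real (1 / real (Suc k)) * \<phi> x))) \<longlonglongrightarrow> iexp (Re (of_real 0 * \<phi> x))" for x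
      by (intro tendsto_intros)
    then show "AE x in law. (\<lambda>k. iexp (Re (of_real (1 / real (Suc k)) * \<phi> x))) \<longlonglongrightarrow> iexp (Re (0 * \<phi> x))"
      by simp
    show "(\<lambda>x. iexp (Re (of_real (1 / real (Suc k)) * \<phi> x))) \<in> borel_measurable law" for k by measurable
    show "(\<lambda>x. iexp (Re (0 * \<phi> x))) \<in> borel_measurable law" by simp
  qed simp_all
  then have "(\<lambda>k. G (of_real (1 / real (Suc k)))) \<longlonglongrightarrow> 1" by simp
  then have "\<forall>\<^sub>F k in sequentially. G (of_real (1 / real (Suc k))) \<noteq> 0"
    by (rule tendsto_imp_eventually_ne) simp
  then obtain k where k: "G (of_real (1 / real (Suc k))) \<noteq> 0" unfolding eventually_sequentially by blast
  define t where "t = 1 / real (Suc k)"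
  have t: "0 < t" "G (of_real t) \<noteq> 0" using k by (simp_all add: t_def)
  define g where "g = Re (G (of_real t))"
  have limt: "(\<lambda>N. exp (- (vN N * t\<^sup>2) / 2)) \<longlonglongrightarrow> g"
    using tendsto_Re [OF lim [of "of_real t"]] t(1) by (simp add: g_def)
  have "(\<lambda>N. 0) \<longlonglongrightarrow> Im (G (of_real t))"
    using tendsto_Im [OF lim [of "of_real t"]] by (simp only: Im_complex_of_real)
  then have "Im (G (of_real t)) = 0" by (simp add: tendsto_const_iff)
  then have "g \<noteq> 0" using t(2) by (auto simp: g_def complex_eq_iff)
  moreover have "0 \<le> g" by (rule LIMSEQ_le_const [OF limt]) auto
  ultimately have "0 < g" by simp
  \<comment> \<open>As the limit at this t is positive, logarithms give convergence of the variances
    themselves, which then determines \<open>G u\<close> for all \<open>u\<close>.\<close>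
  then have "(\<lambda>N. - 2 / t\<^sup>2 * ln (exp (- (vN N * t\<^sup>2) / 2))) \<longlonglongrightarrow> - 2 / t\<^sup>2 * ln g"
    by (intro tendsto_intros limt) simp
  then have v: "vN \<longlonglongrightarrow> - 2 / t\<^sup>2 * ln g" using t(1) by simp
  define v where "v = - 2 / t\<^sup>2 * ln g"
  have Gv: "G u = complex_of_real (exp (- (v * (cmod u)\<^sup>2) / 2))" for u
  proof (rule LIMSEQ_unique [OF lim])
    show "(\<lambda>N. complex_of_real (exp (- (vN N * (cmod u)\<^sup>2) / 2))) \<longlonglongrightarrow> complex_of_real (exp (- (v * (cmod u)\<^sup>2) / 2))"
      using v unfolding v_def by (intro tendsto_intros) auto
  qed
  have "cmod (G 1) \<le> 1"
  proof -
    have "cmod (G 1) \<le> (LINT x|law. cmod (iexp (Re (1 * \<phi> x))))" unfolding G_def by (rule integral_norm_bound)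
    also have "\<dots> = 1" by simp
    finally show ?thesis .
  qed
  then have "0 \<le> v" by (simp add: Gv)
  then show ?thesis using Gv unfolding G_def by blast
qed

text \<open>The characteristic function depends on \<open>u\<close> through |u| only. With u = s -
  \<i> t this is s^2 + t^2, so the joint characteristic function of the two parts factorises and
  both have the same variance.\<close>

lemma law_gaussian: "gaussian_measure wl2 law"
  unfolding gaussian_measure_def
proof (intro conjI ballI)
  fix \<phi> assume \<phi>: "\<phi> \<in> continuous_functionals wl2"
  have [measurable]: "\<phi> \<in> borel_measurable law"
    using functional_measurable [OF \<phi>] by (simp cong: measurable_cong_sets)
  obtain v where v: "0 \<le> v"
    and char: "\<And>u. (LINT x|law. iexp (Re (u * \<phi> x))) = complex_of_real (exp (- (v * (cmod u)\<^sup>2) / 2))"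
    using law_functional_char [OF \<phi>] by blast
  have re: "(LINT x|law. iexp (t * Re (\<phi> x))) = complex_of_real (exp (- (v * t\<^sup>2) / 2))" for t
    using char [of "of_real t"] by simp
  have im: "(LINT x|law. iexp (t * Im (\<phi> x))) = complex_of_real (exp (- (v * t\<^sup>2) / 2))" for t
    using char [of "- \<i> * of_real t"] by (simp add: norm_mult)
  have "law.indep_var borel (\<lambda>x. Re (\<phi> x)) borel (\<lambda>x. Im (\<phi> x))"
  proof (rule law.indep_var_charI)
    fix s t
    have "iexp (s * Re (\<phi> x)) * iexp (t * Im (\<phi> x)) = iexp (Re (Complex s (- t) * \<phi> x))" for x
      by (simp add: exp_add [symmetric] algebra_simps)
    then have "(LINT x|law. iexp (s * Re (\<phi> x)) * iexp (t * Im (\<phi> x))) = complex_of_real (exp (- (v * (s\<^sup>2 + t\<^sup>2)) / 2))"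
      using char [of "Complex s (- t)"] by (simp add: cmod_power2)
    also have "\<dots> = (LINT x|law. iexp (s * Re (\<phi> x))) * (LINT x|law. iexp (t * Im (\<phi> x)))"
      unfolding re im by (simp add: exp_add [symmetric] field_simps flip: of_real_mult)
    finally show "(LINT x|law. iexp (s * Re (\<phi> x)) * iexp (t * Im (\<phi> x))) =
      (LINT x|law. iexp (s * Re (\<phi> x))) * (LINT x|law. iexp (t * Im (\<phi> x)))" .
  qed measurable
  moreover have "distr law borel (\<lambda>x. Re (\<phi> x)) = centered_gaussian (sqrt v)"
    by (rule law.distr_centered_gaussianI [OF _ v re]) measurable
  moreover have "distr law borel (\<lambda>x. Im (\<phi> x)) = centered_gaussian (sqrt v)"
    by (rule law.distr_centered_gaussianI [OF _ v im]) measurable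
  ultimately show "symmetric_complex_gaussian law \<phi>"
    unfolding symmetric_complex_gaussian_def using v by (intro conjI exI [of _ "sqrt v"]) simp_all
qed (use law.prob_space_axioms in simp_all)

text \<open>On characteristic functionals the shift merely moves the indices of the
  covariance.\<close>

lemma law_shift_invariant:
  assumes cov: "\<And>n m. cov (Suc n) (Suc m) = cov n m"
  shows "invariant_measure law backward_shift"
proof -
  have "backward_shift \<in> borel_on wl2 \<rightarrow>\<^sub>M borel_on wl2"
    using backward_shift_sqnorm(1) wl2_coordinate_measurable
    by (intro measurable_borel_wl2I) (simp_all add: backward_shift_def)
  then have T [measurable]: "backward_shift \<in> law \<rightarrow>\<^sub>M law"
    by (simp cong: measurable_cong_sets)
  have meas: "l \<in> borel_measurable law" if "l \<in> linear_functionals" for l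
    using linear_functionals_measurable [OF that] by (simp cong: measurable_cong_sets)
  have "law = distr law law backward_shift"
  proof (rule prob_measure_eqI_char [where L = linear_functionals])
    show "prob_space law" by (rule law.prob_space_axioms)
    show "prob_space (distr law law backward_shift)" by (rule law.prob_space_distr [OF T])
    show "sets law \<subseteq> sigma_sets (space law) {{x \<in> space law. a < l x} |a l. l \<in> linear_functionals}"
      using borel_wl2_generated by simp
    fix l assume l: "l \<in> linear_functionals"
    then obtain N a where l_eq: "l = (\<lambda>x. Re (\<Sum>n<N. a n * x n))" unfolding linear_functionals_def by blast
    have [measurable]: "l \<in> borel_measurable law" by (rule meas [OF l])
    have "(LINT x|distr law law backward_shift. iexp (l x)) = (LINT x|law. iexp (l (backward_shift x)))"
      by (rule integral_distr) measurable
    also have "\<dots> = (LINT x|law. iexp (Re (\<Sum>n<N. a n * x (Suc n))))"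
      by (simp add: l_eq backward_shift_def)
    also have "\<dots> = (LINT x|law. iexp (Re (\<Sum>n<N. a n * x n)))"
      using law_char [of "{..<N}" a Suc] law_char [of "{..<N}" a "\<lambda>n. n"] by (simp add: cov)
    finally show "(LINT x|law. iexp (l x)) = (LINT x|distr law law backward_shift. iexp (l x))"
      by (simp add: l_eq)
  qed (simp_all add: linear_functionals_add linear_functionals_scale linear_functionals_zero meas)
  then show ?thesis using T by (simp add: invariant_measure_def)
qed

text \<open>The coordinates from \<open>n0\<close> on contribute little because of the weights, and
  the finitely many earlier ones involve only finitely many noise variables, all of which a large
  \<open>m\<close> removes.\<close>

lemma tail_nn_integral_small:
  assumes "0 < \<epsilon>"
  shows "\<exists>m0. \<forall>m\<ge>m0. (\<integral>\<^sup>+\<omega>. (\<Sum>n. ennreal ((cmod (tail m \<omega> n))\<^sup>2 / 2 ^ n)) \<partial>noise) < ennreal \<epsilon>"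
proof -
  obtain n0 where n0: "norm (\<Sum>n. 2 * C / 2 ^ (n + n0)) < \<epsilon>"
    using suminf_exist_split [OF assms summable_bound] by blast
  have "(\<integral>\<^sup>+\<omega>. (\<Sum>n. ennreal ((cmod (tail m \<omega> n))\<^sup>2 / 2 ^ n)) \<partial>noise) < ennreal \<epsilon>"
    \<comment> \<open>The sum is a convenient upper bound for every \<open>w n\<close> with
      \<open>n < n0\<close>.\<close>
    if m: "(\<Sum>n<n0. w n) \<le> m" for m
  proof -
    define f where "f n = 2 * (\<Sum>k<w n. (if k < m then 0 else A n k)\<^sup>2) / 2 ^ n" for n
    have f: "0 \<le> f n" "f n \<le> 2 * C / 2 ^ n" for n
    proof -
      show "0 \<le> f n" by (simp add: f_def sum_nonneg)
      show "f n \<le> 2 * C / 2 ^ n"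
        unfolding f_def by (intro divide_right_mono mult_left_mono row_tail_le) simp_all
    qed
    have sumf: "summable f"
      by (rule summable_comparison_test' [OF summable_bound, of 0]) (use f in auto)
    have zero: "f n = 0" if "n < n0" for n
    proof -
      have "w n \<le> (\<Sum>n<n0. w n)" using that by (intro member_le_sum) auto
      then show ?thesis using m by (simp add: f_def)
    qed
    have "suminf f = (\<Sum>n. f (n + n0)) + (\<Sum>n<n0. f n)" by (rule suminf_split_initial_segment [OF sumf])
    also have "\<dots> = (\<Sum>n. f (n + n0))" using zero by simp
    also have "\<dots> \<le> (\<Sum>n. 2 * C / 2 ^ (n + n0))"
      using f(2) summable_ignore_initial_segment [OF sumf] summable_ignore_initial_segment [OF summable_bound]
      by (intro suminf_le) auto
    also have "\<dots> < \<epsilon>" using n0 by simp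
    finally have "suminf f < \<epsilon>" .
    moreover have "(\<integral>\<^sup>+\<omega>. (\<Sum>n. ennreal ((cmod (tail m \<omega> n))\<^sup>2 / 2 ^ n)) \<partial>noise) = ennreal (suminf f)"
      unfolding tail_nn_integral f_def [symmetric] using f(1) sumf by (rule suminf_ennreal2)
    ultimately show ?thesis using assms by (simp add: ennreal_lessI)
  qed
  then show ?thesis by blast
qed

lemma matrix_entry_bound: "(A n k)\<^sup>2 \<le> C"
proof (cases "k < w n")
  case True
  then have "(A n k)\<^sup>2 \<le> (\<Sum>k<w n. (A n k)\<^sup>2)" by (intro member_le_sum) auto
  then show ?thesis using row_bounded [of n] by linarith
next
  case False
  then show ?thesis using bound_nonneg by (simp add: row_finite)
qed

lemma process_split: "process \<omega> n = (\<Sum>k<m. of_real (A n k) * cnoise k \<omega>) + tail m \<omega> n"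
proof -
  let ?r = "max m (w n)"
  have "process \<omega> n = (\<Sum>k<?r. of_real (A n k) * cnoise k \<omega>)" by (rule process_eq) simp
  also have "\<dots> = (\<Sum>k<?r. (if k < m then of_real (A n k) * cnoise k \<omega> else 0) + of_real (if k < m then 0 else A n k) * cnoise k \<omega>)"
    by (intro sum.cong) auto
  also have "\<dots> = (\<Sum>k<?r. if k < m then of_real (A n k) * cnoise k \<omega> else 0) + (\<Sum>k<?r. of_real (if k < m then 0 else A n k) * cnoise k \<omega>)"
    by (rule sum.distrib)
  also have "(\<Sum>k<?r. if k < m then of_real (A n k) * cnoise k \<omega> else 0) = (\<Sum>k<m. of_real (A n k) * cnoise k \<omega>)"
    by (rule sum.mono_neutral_cong_right) auto
  also have "(\<Sum>k<?r. of_real (if k < m then 0 else A n k) * cnoise k \<omega>) = tail m \<omega> n"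
    unfolding tail_def by (rule sum.mono_neutral_right) (auto simp: row_finite)
  finally show ?thesis .
qed

lemma head_sqnorm_le:
  assumes d: "\<And>k. k < m \<Longrightarrow> cmod (d k) \<le> \<delta>" and "0 \<le> \<delta>"
  shows "(\<lambda>n. \<Sum>k<m. of_real (A n k) * d k) \<in> wl2_set"
    and "wl2_sqnorm (\<lambda>n. \<Sum>k<m. of_real (A n k) * d k) \<le> 2 * ((real m)\<^sup>2 * C * \<delta>\<^sup>2)"
proof -
  have sq: "(cmod (\<Sum>k<m. of_real (A n k) * d k))\<^sup>2 \<le> (real m)\<^sup>2 * C * \<delta>\<^sup>2" for n
  proof -
    have "\<bar>A n k\<bar> \<le> sqrt C" for k using matrix_entry_bound [of n k] real_le_rsqrt by fastforce
    then have "cmod (\<Sum>k<m. of_real (A n k) * d k) \<le> (\<Sum>k<m. sqrt C * \<delta>)"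
      using d bound_nonneg by (intro sum_norm_le) (auto simp: norm_mult intro!: mult_mono)
    then have "(cmod (\<Sum>k<m. of_real (A n k) * d k))\<^sup>2 \<le> (\<Sum>k<m. sqrt C * \<delta>)\<^sup>2"
      by (rule power_mono) simp
    also have "\<dots> = (real m)\<^sup>2 * C * \<delta>\<^sup>2" using bound_nonneg by (simp add: power_mult_distrib)
    finally show ?thesis .
  qed
  have "(\<Sum>n<N. (cmod (\<Sum>k<m. of_real (A n k) * d k))\<^sup>2 / 2 ^ n) \<le> 2 * ((real m)\<^sup>2 * C * \<delta>\<^sup>2)" for N
  proof -
    have "(\<Sum>n<N. (cmod (\<Sum>k<m. of_real (A n k) * d k))\<^sup>2 / 2 ^ n) \<le> (\<Sum>n<N. (real m)\<^sup>2 * C * \<delta>\<^sup>2 * (1 / 2) ^ n)"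
      using sq by (intro sum_mono) (simp add: power_divide divide_right_mono)
    also have "\<dots> = (real m)\<^sup>2 * C * \<delta>\<^sup>2 * (\<Sum>n<N. (1 / 2) ^ n)" by (simp only: sum_distrib_left)
    also have "\<dots> \<le> (real m)\<^sup>2 * C * \<delta>\<^sup>2 * 2"
      using bound_nonneg geometric_sum [of "1 / 2 :: real" N] by (intro mult_left_mono) auto
    finally show ?thesis by simp
  qed
  then show "(\<lambda>n. \<Sum>k<m. of_real (A n k) * d k) \<in> wl2_set"
    and "wl2_sqnorm (\<lambda>n. \<Sum>k<m. of_real (A n k) * d k) \<le> 2 * ((real m)\<^sup>2 * C * \<delta>\<^sup>2)"
    by (rule wl2_from_bounded_sums)+
qed

text \<open>Each coordinate owns a noise variable that no other coordinate sees, so a finitely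
  supported target \<open>y\<close> is hit exactly by prescribing finitely many noise variables.
  Having these nearly correct is an event of positive probability, so is a small tail, and the two
  events are independent.\<close>

lemma full_support_law:
  assumes unit_column: "\<And>n j. A n (2 * j + 1) = of_bool (n = j)"
  shows "full_support wl2 law"
  unfolding full_support_def
proof (intro allI impI, elim conjE)
  fix U assume U: "openin (norm_topology wl2) U" "U \<noteq> {}"
  obtain y0 where y0: "y0 \<in> U" using U(2) by blast
  have "\<exists>p\<in>{(d, k). d \<in> wl2_dense \<and> wl2.mball d (1 / real (Suc k)) \<subseteq> U}. y0 \<in> wl2.mball (fst p) (1 / real (Suc (snd p)))"
    using wl2_open_countable_union [OF U(1)] y0 by (force simp: case_prod_unfold)
  then obtain y k0 where y: "y \<in> wl2_dense" "wl2.mball y (1 / real (Suc k0)) \<subseteq> U" by auto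
  define r where "r = 1 / real (Suc k0)"
  have r: "0 < r" "wl2.mball y r \<subseteq> U" using y(2) by (simp_all add: r_def)
  have yw: "y \<in> wl2_set" using y(1) wl2_dense_subset by blast
  obtain N where N: "\<And>n. N \<le> n \<Longrightarrow> y n = 0"
  proof -
    obtain xs :: "(rat \<times> rat) list" where
      "y = (\<lambda>n. if n < length xs then Complex (of_rat (fst (xs ! n))) (of_rat (snd (xs ! n))) else 0)"
      using y(1) by (auto simp: wl2_dense_def)
    then show thesis using that [of "length xs"] by simp
  qed
  \<comment> \<open>Head error and tail both have squared norm below \<epsilon>, and the squared
    norm of their sum is at most 2\<epsilon> + 2\<epsilon> = r^2, with strict inequality.\<close>
  define \<epsilon> where "\<epsilon> = r\<^sup>2 / 4"
  have \<epsilon>: "0 < \<epsilon>" using r by (simp add: \<epsilon>_def)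
  obtain m0 where m0: "\<And>m. m0 \<le> m \<Longrightarrow> (\<integral>\<^sup>+\<omega>. (\<Sum>n. ennreal ((cmod (tail m \<omega> n))\<^sup>2 / 2 ^ n)) \<partial>noise) < ennreal \<epsilon>"
    using tail_nn_integral_small [OF \<epsilon>] by blast
  \<comment> \<open>The second bound puts the private columns 2n + 1, n < N, of the support of
    \<open>y\<close> among the first \<open>m\<close>.\<close>
  define m where "m = max m0 (2 * N)"
  define h where "h k = (if odd k then y (k div 2) else 0)" for k
  have head: "(\<Sum>k<m. of_real (A n k) * h k) = y n" for n
  proof -
    have "of_real (A n k) * h k = (if k = 2 * n + 1 then y n else 0)" for k
    proof (cases "odd k")
      case True
      then obtain j where "k = 2 * j + 1" by (elim oddE)
      then show ?thesis using unit_column [of n j] by (auto simp: h_def)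
    qed (auto simp: h_def)
    then have "(\<Sum>k<m. of_real (A n k) * h k) = (if 2 * n + 1 < m then y n else 0)" by simp
    then show ?thesis using N [of n] by (auto simp: m_def)
  qed
  define D where "D = 2 * (real m)\<^sup>2 * C"
  have D: "0 \<le> D" using bound_nonneg by (simp add: D_def)
  \<comment> \<open>By \<open>head_sqnorm_le\<close> the head error has squared norm at most D
    \<delta>^2, which this choice keeps below \<epsilon>, also for \<open>D = 0\<close>.\<close>
  define \<delta> where "\<delta> = sqrt (\<epsilon> / (D + 1))"
  have \<delta>: "0 < \<delta>" using \<epsilon> D by (simp add: \<delta>_def)
  have D\<delta>: "D * \<delta>\<^sup>2 < \<epsilon>"
  proof -
    have "\<delta>\<^sup>2 = \<epsilon> / (D + 1)" using \<epsilon> D by (simp add: \<delta>_def)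
    then have "\<delta>\<^sup>2 + D * \<delta>\<^sup>2 = \<epsilon>" using D by (simp add: field_simps)
    then show ?thesis using zero_less_power [OF \<delta>, of 2] by linarith
  qed
  define c where "c i = (if even i then Re (h (i div 2)) else Im (h (i div 2)))" for i
  \<comment> \<open>A complex noise variable uses two real ones, hence \<open>2 * m\<close>
    conditions; two errors below \<delta>/2 give a modulus of at most \<delta>.\<close>
  define P where "P \<omega> \<longleftrightarrow> (\<forall>i\<in>{..<2 * m}. \<omega> i \<in> {c i - \<delta> / 2<..<c i + \<delta> / 2})" for \<omega> :: "nat \<Rightarrow> real"
  define Q where "Q \<omega> \<longleftrightarrow> (\<Sum>n. ennreal ((cmod (tail m \<omega> n))\<^sup>2 / 2 ^ n)) < ennreal \<epsilon>" for \<omega>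
  have Pm [measurable]: "Measurable.pred noise P" unfolding P_def by measurable
  have Qm [measurable]: "Measurable.pred noise Q" unfolding Q_def by measurable
  have "emeasure noise {\<omega> \<in> space noise. P \<omega> \<and> Q \<omega>} =
      emeasure noise {\<omega> \<in> space noise. P \<omega>} * emeasure noise {\<omega> \<in> space noise. Q \<omega>}"
  proof (rule noise_splitting [OF Pm Qm, of "2 * m"])
    show "P \<omega> = P \<omega>'" if "\<And>i. i < 2 * m \<Longrightarrow> \<omega> i = \<omega>' i" for \<omega> \<omega>'
      using that by (simp add: P_def)
    show "Q \<omega> = Q \<omega>'" if "\<And>i. 2 * m \<le> i \<Longrightarrow> \<omega> i = \<omega>' i" for \<omega> \<omega>'
    proof -
      have "tail m \<omega> n = tail m \<omega>' n" for n
        unfolding tail_def using that by (intro sum.cong) (auto simp: cnoise_def)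
      then show ?thesis by (simp add: Q_def)
    qed
  qed
  moreover have "emeasure noise {\<omega> \<in> space noise. P \<omega>} \<noteq> 0"
    using noise_box_pos [of "{..<2 * m}" "\<lambda>i. c i - \<delta> / 2" "\<lambda>i. c i + \<delta> / 2"] \<delta> by (simp add: P_def)
  \<comment> \<open>If the tail were almost surely at least \<epsilon>, so would be its mean,
    against the choice of \<open>m0\<close>.\<close>
  moreover have "emeasure noise {\<omega> \<in> space noise. Q \<omega>} \<noteq> 0"
  proof
    assume "emeasure noise {\<omega> \<in> space noise. Q \<omega>} = 0"
    then have "AE \<omega> in noise. \<not> Q \<omega>"
      by (subst AE_iff_measurable [OF _ refl]) auto
    then have "(\<integral>\<^sup>+\<omega>. ennreal \<epsilon> \<partial>noise) \<le> (\<integral>\<^sup>+\<omega>. (\<Sum>n. ennreal ((cmod (tail m \<omega> n))\<^sup>2 / 2 ^ n)) \<partial>noise)"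
      by (intro nn_integral_mono_AE) (auto simp: Q_def not_less elim: eventually_mono)
    also have "\<dots> < ennreal \<epsilon>" by (rule m0) (simp add: m_def)
    finally show False by (simp add: noise.emeasure_space_1)
  qed
  ultimately have "0 < emeasure noise {\<omega> \<in> space noise. P \<omega> \<and> Q \<omega>}"
    by (simp add: zero_less_iff_neq_zero)
  also have "\<dots> \<le> emeasure noise (path -` U \<inter> space noise)"
  proof (rule emeasure_mono)
    show "path -` U \<inter> space noise \<in> sets noise"
      using borel_wl2_openin [OF U(1)] by (rule measurable_sets [OF path_measurable])
    show "{\<omega> \<in> space noise. P \<omega> \<and> Q \<omega>} \<subseteq> path -` U \<inter> space noise"
    proof (rule subsetI)
      fix \<omega> assume \<omega>: "\<omega> \<in> {\<omega> \<in> space noise. P \<omega> \<and> Q \<omega>}"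
      then have P: "P \<omega>" and Q: "Q \<omega>" by auto
      define d where "d k = cnoise k \<omega> - h k" for k
      have "cmod (d k) \<le> \<delta>" if "k < m" for k
      proof -
        have "\<omega> (2 * k) \<in> {c (2 * k) - \<delta> / 2<..<c (2 * k) + \<delta> / 2}"
          "\<omega> (2 * k + 1) \<in> {c (2 * k + 1) - \<delta> / 2<..<c (2 * k + 1) + \<delta> / 2}"
          using P that unfolding P_def by auto
        then have "\<bar>\<omega> (2 * k) - Re (h k)\<bar> < \<delta> / 2" "\<bar>\<omega> (2 * k + 1) - Im (h k)\<bar> < \<delta> / 2"
          by (auto simp: c_def abs_if)
        then show ?thesis
          using cmod_le [of "d k"] by (simp add: d_def cnoise_def)
      qed
      note hd = head_sqnorm_le [of m d \<delta>, OF this less_imp_le [OF \<delta>]]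
      define H where "H n = (\<Sum>k<m. of_real (A n k) * d k)" for n
      have H: "H \<in> wl2_set" "wl2_sqnorm H < \<epsilon>"
        using hd D\<delta> by (simp_all add: H_def [abs_def] D_def mult.assoc)
      have t: "tail m \<omega> \<in> wl2_set"
        using Q unfolding wl2_set_iff Q_def by auto
      have tn: "wl2_sqnorm (tail m \<omega>) < \<epsilon>"
      proof -
        have "ennreal (wl2_sqnorm (tail m \<omega>)) = (\<Sum>n. ennreal ((cmod (tail m \<omega> n))\<^sup>2 / 2 ^ n))"
          using t unfolding wl2_sqnorm_def wl2_set_def by (intro suminf_ennreal2 [symmetric]) auto
        then have "ennreal (wl2_sqnorm (tail m \<omega>)) < ennreal \<epsilon>" using Q by (simp only: Q_def)
        then show ?thesis using wl2_sqnorm_nonneg [OF t] by (simp only: ennreal_less_iff)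
      qed
      have eq: "process \<omega> n - y n = H n + tail m \<omega> n" for n
        unfolding process_split [of _ _ m] head [of n, symmetric]
        by (simp add: H_def d_def right_diff_distrib sum_subtractf)
      have diff: "(\<lambda>n. process \<omega> n - y n) \<in> wl2_set"
        unfolding eq by (rule wl2_add [OF H(1) t])
      then have "process \<omega> \<in> wl2_set" using wl2_add [OF diff yw] by simp
      then have path: "path \<omega> = process \<omega>" by (simp add: path_def)
      have "wl2_sqnorm (\<lambda>n. process \<omega> n - y n) \<le> 2 * wl2_sqnorm H + 2 * wl2_sqnorm (tail m \<omega>)"
      proof (rule wl2_from_bounded_sums(2))
        fix K
        have "(\<Sum>n<K. (cmod (process \<omega> n - y n))\<^sup>2 / 2 ^ n) \<le>
            (\<Sum>n<K. 2 * ((cmod (H n))\<^sup>2 / 2 ^ n) + 2 * ((cmod (tail m \<omega> n))\<^sup>2 / 2 ^ n))"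
          unfolding eq using cmod_add_sq_le
          by (intro sum_mono) (simp add: divide_right_mono flip: add_divide_distrib)
        also have "\<dots> = 2 * (\<Sum>n<K. (cmod (H n))\<^sup>2 / 2 ^ n) + 2 * (\<Sum>n<K. (cmod (tail m \<omega> n))\<^sup>2 / 2 ^ n)"
          by (simp add: sum.distrib sum_distrib_left)
        also have "\<dots> \<le> 2 * wl2_sqnorm H + 2 * wl2_sqnorm (tail m \<omega>)"
          using wl2_coordinate_le(1) [OF H(1), of K] wl2_coordinate_le(1) [OF t, of K] by linarith
        finally show "(\<Sum>n<K. (cmod (process \<omega> n - y n))\<^sup>2 / 2 ^ n) \<le> 2 * wl2_sqnorm H + 2 * wl2_sqnorm (tail m \<omega>)" .
      qed
      also have "\<dots> < r\<^sup>2" using H(2) tn by (simp add: \<epsilon>_def)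
      finally have "sqrt (wl2_sqnorm (\<lambda>n. process \<omega> n - y n)) < r"
        using r(1) by (simp add: real_sqrt_less_iff real_less_lsqrt wl2_sqnorm_nonneg [OF diff])
      then have "cdist wl2 y (path \<omega>) < r"
        using yw \<open>process \<omega> \<in> wl2_set\<close> by (subst wl2.commute) (simp add: path wl2_dist)
      then have "path \<omega> \<in> U" using r(2) yw path_in by (auto simp: wl2.in_mball subset_iff)
      then show "\<omega> \<in> path -` U \<inter> space noise" using \<omega> by simp
    qed
  qed
  also have "\<dots> = emeasure law U"
    unfolding law_def using borel_wl2_openin [OF U(1)] by (intro emeasure_distr [symmetric] path_measurable) 
  finally show "0 < emeasure law U" .
qed

end

section \<open>Mixing\<close>

definition stationary_cov :: "int \<Rightarrow> real" where
  "stationary_cov n = riesz_coeff n + of_bool (n = 0)"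

text \<open>The covariance of \<open>Re (\<Sum>n<N. a n * x (n + k))\<close> and
  \<open>Re (\<Sum>m<N. b m * x m)\<close> under a law with covariance
  \<open>stationary_cov\<close>.\<close>

definition shifted_cov :: "nat \<Rightarrow> nat \<Rightarrow> (nat \<Rightarrow> complex) \<Rightarrow> (nat \<Rightarrow> complex) \<Rightarrow> real" where
  "shifted_cov N k a b = (\<Sum>n<N. \<Sum>m<N. Re (a n * cnj (b m)) * stationary_cov (int n + int k - int m))"

text \<open>Selecting the component by a \<open>bool\<close> lets the two real components of a
  complex vector serve as further indices of a Gram sum.\<close>

definition re_im :: "bool \<Rightarrow> complex \<Rightarrow> real" where
  "re_im s z = (if s then Re z else Im z)"

lemma Re_mult_cnj_re_im: "Re (a * cnj b) = (\<Sum>s\<in>UNIV. re_im s a * re_im s b)"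
  by (simp add: UNIV_bool re_im_def)

text \<open>This brings a Hermitian form with complex coefficients into the shape of real inner
  products that \<open>cmod_gram_exp_le\<close> expects.\<close>

lemma gram_bilinear:
  fixes \<xi> \<eta> :: "'l \<Rightarrow> nat \<Rightarrow> real"
  assumes "finite F"
  shows "(\<Sum>n<N. \<Sum>m<N. Re (a n * cnj (b m)) * (\<Sum>l\<in>F. \<xi> l n * \<eta> l m)) =
    (\<Sum>(l, s)\<in>F \<times> UNIV. (\<Sum>n<N. re_im s (a n) * \<xi> l n) * (\<Sum>m<N. re_im s (b m) * \<eta> l m))"
proof -
  have "(\<Sum>(l, s)\<in>F \<times> UNIV. (\<Sum>n<N. re_im s (a n) * \<xi> l n) * (\<Sum>m<N. re_im s (b m) * \<eta> l m)) =
      (\<Sum>l\<in>F. \<Sum>s\<in>UNIV. \<Sum>n<N. \<Sum>m<N. (re_im s (a n) * \<xi> l n) * (re_im s (b m) * \<eta> l m))"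
    by (simp only: sum.cartesian_product [symmetric] sum_product)
  also have "\<dots> = (\<Sum>n<N. \<Sum>m<N. \<Sum>l\<in>F. \<Sum>s\<in>UNIV. (re_im s (a n) * \<xi> l n) * (re_im s (b m) * \<eta> l m))"
    by (simp only: sum.swap [of _ "{..<N}" F] sum.swap [of _ "{..<N}" UNIV])
  also have "\<dots> = (\<Sum>n<N. \<Sum>m<N. Re (a n * cnj (b m)) * (\<Sum>l\<in>F. \<xi> l n * \<eta> l m))"
    unfolding Re_mult_cnj_re_im sum_product
    by (intro sum.cong refl) (simp add: sum.swap [of _ F UNIV] mult_ac)
  finally show ?thesis by simp
qed

lemma shifted_cov_diag:
  fixes a b :: "nat \<Rightarrow> complex"
  shows
  "(\<Sum>n<N. \<Sum>m<N. Re (a n * cnj (b m)) * of_bool (n = m)) = (\<Sum>(n, s)\<in>{..<N} \<times> UNIV. re_im s (a n) * re_im s (b n))"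
proof -
  have "(\<Sum>m<N. Re (a n * cnj (b m)) * of_bool (n = m)) = (\<Sum>s\<in>UNIV. re_im s (a n) * re_im s (b n))" if "n < N" for n
  proof -
    have "(\<Sum>m<N. Re (a n * cnj (b m)) * of_bool (n = m)) = (\<Sum>m<N. if m = n then Re (a n * cnj (b n)) else 0)"
      by (intro sum.cong) auto
    also have "\<dots> = Re (a n * cnj (b n))" using that by simp
    finally show ?thesis by (simp only: Re_mult_cnj_re_im)
  qed
  then show ?thesis unfolding sum.cartesian_product [symmetric] by (intro sum.cong refl) simp
qed

lemma shifted_cov_0_gram:
  fixes \<xi> :: "int \<Rightarrow> nat \<Rightarrow> real"
  assumes F: "finite F" and \<xi>: "\<And>n m. n < N \<Longrightarrow> m < N \<Longrightarrow> riesz_coeff (int n - int m) = (\<Sum>l\<in>F. \<xi> l n * \<xi> l m)"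
  shows "shifted_cov N 0 a b = (\<Sum>(l, s)\<in>F \<times> UNIV. (\<Sum>n<N. re_im s (a n) * \<xi> l n) * (\<Sum>m<N. re_im s (b m) * \<xi> l m)) +
    (\<Sum>(n, s)\<in>{..<N} \<times> UNIV. re_im s (a n) * re_im s (b n))"
proof -
  have "shifted_cov N 0 a b = (\<Sum>n<N. \<Sum>m<N. Re (a n * cnj (b m)) * (\<Sum>l\<in>F. \<xi> l n * \<xi> l m)) +
      (\<Sum>n<N. \<Sum>m<N. Re (a n * cnj (b m)) * of_bool (n = m))"
    unfolding shifted_cov_def sum.distrib [symmetric]
    by (intro sum.cong refl) (simp add: stationary_cov_def \<xi> distrib_left del: times_complex.sel)
  then show ?thesis by (simp only: gram_bilinear [OF F] shifted_cov_diag)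
qed

text \<open>At a far lag the covariances are \<theta> times a mixed Gram matrix of two families of
  vectors, one placed at \<open>q\<close> and one at 0. By stationarity each family by itself has
  the Gram matrix of lag 0, so \<open>cmod_gram_exp_le\<close> applies.\<close>

lemma shifted_cov_contraction:
  fixes a :: "nat \<Rightarrow> nat \<Rightarrow> complex"
  shows "\<exists>K. \<forall>k\<ge>K. \<forall>J \<beta>.
    cmod (\<Sum>i<J. \<Sum>j<J. \<beta> i * cnj (\<beta> j) * complex_of_real (exp (shifted_cov N k (a i) (a j)) - 1)) \<le>
    1 / 2 * Re (\<Sum>i<(J::nat). \<Sum>j<J. \<beta> i * cnj (\<beta> j) * complex_of_real (exp (shifted_cov N 0 (a i) (a j)) - 1))"
proof -
  obtain K0 where K0: "\<And>n. K0 \<le> \<bar>n\<bar> \<Longrightarrow> \<exists>q \<theta>. 0 \<le> \<theta> \<and> \<theta> \<le> 1 / 2 \<and>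
      (\<forall>p. \<bar>p\<bar> \<le> int N \<longrightarrow> riesz_coeff (n + p) = \<theta> * riesz_coeff (q + p))"
    using riesz_coeff_tail [of "int N"] by blast
  have "cmod (\<Sum>i<J. \<Sum>j<J. \<beta> i * cnj (\<beta> j) * complex_of_real (exp (shifted_cov N k (a i) (a j)) - 1)) \<le>
    1 / 2 * Re (\<Sum>i<J. \<Sum>j<J. \<beta> i * cnj (\<beta> j) * complex_of_real (exp (shifted_cov N 0 (a i) (a j)) - 1))"
    \<comment> \<open>The bound \<open>N \<le> k\<close> makes n + k - m positive, so the white
      noise does not contribute to the shifted covariance.\<close>
    if k: "max N (nat K0) \<le> k" for k J :: nat and \<beta>
  proof -
    obtain q \<theta> where \<theta>: "0 \<le> \<theta>" "\<theta> \<le> 1 / 2"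
      and q: "\<And>p. \<bar>p\<bar> \<le> int N \<Longrightarrow> riesz_coeff (int k + p) = \<theta> * riesz_coeff (q + p)"
    proof -
      have "K0 \<le> \<bar>int k\<bar>" using k by linarith
      then show thesis using K0 that by blast
    qed
    \<comment> \<open>One representation on a window that contains both blocks of indices, the one
      starting at \<open>q\<close> and the one starting at 0, provides both families.\<close>
    obtain F :: "int set" and v where F: "finite F"
      and v: "\<And>i j. \<bar>i\<bar> \<le> \<bar>q\<bar> + int N \<Longrightarrow> \<bar>j\<bar> \<le> \<bar>q\<bar> + int N \<Longrightarrow> riesz_coeff (i - j) = (\<Sum>l\<in>F. v l i * v l j)"
      using riesz_coeff_gram [of "\<bar>q\<bar> + int N"] by blast
    define \<xi> where "\<xi> l n = v l (q + int n)" for l and n :: nat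
    define \<eta> where "\<eta> l n = v l (int n)" for l and n :: nat
    have \<xi>\<xi>: "riesz_coeff (int n - int m) = (\<Sum>l\<in>F. \<xi> l n * \<xi> l m)" if "n < N" "m < N" for n m
      using v [of "q + int n" "q + int m"] that by (simp add: \<xi>_def)
    have \<eta>\<eta>: "riesz_coeff (int n - int m) = (\<Sum>l\<in>F. \<eta> l n * \<eta> l m)" if "n < N" "m < N" for n m
      using v [of "int n" "int m"] that by (simp add: \<eta>_def)
    have \<xi>\<eta>: "stationary_cov (int n + int k - int m) = \<theta> * (\<Sum>l\<in>F. \<xi> l n * \<eta> l m)" if "n < N" "m < N" for n m
      using v [of "q + int n" "int m"] q [of "int n - int m"] that k
      by (simp add: \<xi>_def \<eta>_def stationary_cov_def algebra_simps)
    \<comment> \<open>The left summand carries the Gram vectors of \<kappa>. The right one carries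
      the white noise twice: copy \<open>True\<close> belongs to \<open>u'\<close>, copy
      \<open>False\<close> to \<open>v'\<close>. It thus enters both Gram matrices and is orthogonal
      in the mixed one.\<close>
    define G where "G = (F \<times> (UNIV :: bool set)) <+> (UNIV :: bool set) \<times> ({..<N} \<times> (UNIV :: bool set))"
    define u' where "u' p i = (case p of Inl (l, s) \<Rightarrow> \<Sum>n<N. re_im s (a i n) * \<xi> l n
       | Inr (t, n, s) \<Rightarrow> if t then re_im s (a i n) else 0)" for p i
    define v' where "v' p i = (case p of Inl (l, s) \<Rightarrow> \<Sum>n<N. re_im s (a i n) * \<eta> l n
       | Inr (t, n, s) \<Rightarrow> if t then 0 else re_im s (a i n))" for p i
    have split: "(\<Sum>p\<in>G. f p) = (\<Sum>(l, s)\<in>F \<times> UNIV. f (Inl (l, s))) + ((\<Sum>(n, s)\<in>{..<N} \<times> UNIV. f (Inr (True, n, s))) + (\<Sum>(n, s)\<in>{..<N} \<times> UNIV. f (Inr (False, n, s))))"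
      for f :: "_ \<Rightarrow> real"
    proof -
      have "(\<Sum>p\<in>(UNIV :: bool set) \<times> ({..<N} \<times> (UNIV :: bool set)). f (Inr p)) =
          (\<Sum>t\<in>UNIV. \<Sum>x\<in>{..<N} \<times> UNIV. f (Inr (t, x)))"
        by (simp only: sum.cartesian_product) (simp add: case_prod_beta)
      then show ?thesis
        unfolding G_def using F by (subst sum.Plus) (simp_all add: UNIV_bool case_prod_unfold)
    qed
    have uu: "(\<Sum>p\<in>G. u' p i * u' p j) = shifted_cov N 0 (a i) (a j)" for i j
      using shifted_cov_0_gram [where F = F and \<xi> = \<xi> and N = N and a = "a i" and b = "a j"] F \<xi>\<xi>
      unfolding split by (simp add: u'_def)
    have vv: "(\<Sum>p\<in>G. v' p i * v' p j) = shifted_cov N 0 (a i) (a j)" for i j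
      using shifted_cov_0_gram [where F = F and \<xi> = \<eta> and N = N and a = "a i" and b = "a j"] F \<eta>\<eta>
      unfolding split by (simp add: v'_def)
    have uv: "\<theta> * (\<Sum>p\<in>G. u' p i * v' p j) = shifted_cov N k (a i) (a j)" for i j
    proof -
      have "(\<Sum>p\<in>G. u' p i * v' p j) = (\<Sum>n<N. \<Sum>m<N. Re (a i n * cnj (a j m)) * (\<Sum>l\<in>F. \<xi> l n * \<eta> l m))"
        unfolding split gram_bilinear [OF F] by (simp add: u'_def v'_def)
      moreover have "shifted_cov N k (a i) (a j) = (\<Sum>n<N. \<Sum>m<N. \<theta> * (Re (a i n * cnj (a j m)) * (\<Sum>l\<in>F. \<xi> l n * \<eta> l m)))"
        unfolding shifted_cov_def by (intro sum.cong refl) (simp only: \<xi>\<eta> lessThan_iff mult.left_commute)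
      ultimately show ?thesis by (simp only: sum_distrib_left)
    qed
    have "cmod (\<Sum>i<J. \<Sum>j<J. \<beta> i * cnj (\<beta> j) * complex_of_real (exp (\<theta> * (\<Sum>p\<in>G. u' p i * v' p j)) - 1)) \<le>
      \<theta> * Re (\<Sum>i<J. \<Sum>j<J. \<beta> i * cnj (\<beta> j) * complex_of_real (exp (\<Sum>p\<in>G. u' p i * u' p j) - 1))"
      using \<theta> by (intro cmod_gram_exp_le) (simp_all add: uu vv)
    also have "\<dots> \<le> 1 / 2 * Re (\<Sum>i<J. \<Sum>j<J. \<beta> i * cnj (\<beta> j) * complex_of_real (exp (\<Sum>p\<in>G. u' p i * u' p j) - 1))"
    proof (rule mult_right_mono [OF \<theta>(2)])
      \<comment> \<open>Replacing \<theta> by 1/2 needs a nonnegative right-hand side; the case of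
        factor 1 bounds a modulus by that real part.\<close>
      have "cmod (\<Sum>i<J. \<Sum>j<J. \<beta> i * cnj (\<beta> j) * complex_of_real (exp (1 * (\<Sum>p\<in>G. u' p i * v' p j)) - 1)) \<le>
        1 * Re (\<Sum>i<J. \<Sum>j<J. \<beta> i * cnj (\<beta> j) * complex_of_real (exp (\<Sum>p\<in>G. u' p i * u' p j) - 1))"
        by (intro cmod_gram_exp_le) (simp_all add: uu vv)
      then show "0 \<le> Re (\<Sum>i<J. \<Sum>j<J. \<beta> i * cnj (\<beta> j) * complex_of_real (exp (\<Sum>p\<in>G. u' p i * u' p j) - 1))"
        unfolding mult_1 by (rule order_trans [OF norm_ge_zero])
    qed
    finally show ?thesis by (simp only: uu uv)
  qed
  then show ?thesis by blast
qed

section \<open>The stationary law and its correlations\<close>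

lemma borel_measurable_cnj [measurable (raw)]:
  assumes "f \<in> borel_measurable M" shows "(\<lambda>x. cnj (f x)) \<in> borel_measurable M"
proof -
  have "cnj \<in> borel_measurable borel"
    by (intro borel_measurable_continuous_onI continuous_intros)
  then show ?thesis using assms by (rule measurable_compose [rotated])
qed

lemma psd_kernel_riesz: "psd_kernel (\<lambda>i j. riesz_coeff (int i - int j))"
  unfolding psd_kernel_def
proof (intro conjI allI)
  show "riesz_coeff (int i - int j) = riesz_coeff (int j - int i)" for i j
    using riesz_coeff_uminus [of "int i - int j"] by simp
  fix N :: nat and c :: "nat \<Rightarrow> real"
  obtain F :: "int set" and v where F: "finite F"
    and v: "\<And>i j. \<bar>i\<bar> \<le> int N \<Longrightarrow> \<bar>j\<bar> \<le> int N \<Longrightarrow> riesz_coeff (i - j) = (\<Sum>l\<in>F. v l i * v l j)"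
    using riesz_coeff_gram [of "int N"] by blast
  have "(\<Sum>i<N. \<Sum>j<N. c i * c j * riesz_coeff (int i - int j)) =
      (\<Sum>i<N. \<Sum>j<N. \<Sum>l\<in>F. (c i * v l (int i)) * (c j * v l (int j)))"
    by (intro sum.cong refl) (simp add: v sum_distrib_left mult_ac)
  also have "\<dots> = (\<Sum>l\<in>F. (\<Sum>i<N. c i * v l (int i))\<^sup>2)"
    by (simp only: power2_eq_square sum_product sum.swap [of _ F])
  finally show "0 \<le> (\<Sum>i<N. \<Sum>j<N. c i * c j * riesz_coeff (int i - int j))"
    by (simp add: sum_nonneg)
qed

locale stationary_gaussian_matrix = gaussian_matrix +
  assumes cov_stationary: "cov n m = stationary_cov (int n - int m)"
    and unit_column: "A n (2 * j + 1) = of_bool (n = j)"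

lemma stationary_gaussian_matrix_exists: "\<exists>A w C. stationary_gaussian_matrix A w C"
proof -
  obtain L where L0: "\<And>n k. n < k \<Longrightarrow> L n k = 0"
    and L: "\<And>n m N. n < N \<Longrightarrow> riesz_coeff (int n - int m) = (\<Sum>k<N. L n k * L m k)"
    using psd_kernel_cholesky [OF psd_kernel_riesz] by blast
  txt \<open>The even columns form a Cholesky factor of \<open>\<kappa>\<close>, the odd ones add the white noise.\<close>
  define A where "A n k = (if even k then L n (k div 2) else of_bool (n = k div 2))" for n k :: nat
  define w where "w n = 2 * Suc n" for n :: nat
  have sum: "(\<Sum>k<2 * N. A n k * A m k) = stationary_cov (int n - int m)" if "n < N" for n m N
  proof -
    have "(\<Sum>k<2 * N. A n k * A m k) = (\<Sum>k<N. L n k * L m k) + (\<Sum>k<N. of_bool (n = k) * of_bool (m = k))"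
      unfolding sum_lessThan_double sum.distrib [symmetric] by (intro sum.cong refl) (simp add: A_def)
    also have "(\<Sum>k<N. of_bool (n = k) * of_bool (m = k)) = (\<Sum>k<N. if k = n then of_bool (n = m) else (0 :: real))"
      by (intro sum.cong) auto
    also have "\<dots> = of_bool (n = m)" using that by simp
    also have "(\<Sum>k<N. L n k * L m k) = riesz_coeff (int n - int m)"
      using L [OF that] by simp
    finally show ?thesis by (simp add: stationary_cov_def)
  qed
  \<comment> \<open>The bound 2 is \<open>stationary_cov 0\<close>: \<kappa>(0) = 1 plus the
    variance 1 of the white noise.\<close>
  interpret gaussian_matrix A w 2
  proof
    show "A n k = 0" if "w n \<le> k" for n k using that L0 by (auto simp: A_def w_def)
    show "(\<Sum>k<w n. (A n k)\<^sup>2) \<le> 2" for n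
      using sum [of n "Suc n" n] by (simp add: w_def power2_eq_square stationary_cov_def)
  qed
  have "stationary_gaussian_matrix A w 2"
  proof
    show "cov n m = stationary_cov (int n - int m)" for n m
      using cov_eq [of n "2 * Suc (max n m)" m] sum [of n "Suc (max n m)" m] by (simp add: w_def)
    show "A n (2 * j + 1) = of_bool (n = j)" for n j by (simp add: A_def)
  qed
  then show ?thesis by blast
qed

lemma trig_span_linear_functionals:
  assumes "p \<in> trig_span linear_functionals"
  shows "\<exists>(J::nat) N c a. p = (\<lambda>x. \<Sum>j<J. c j * iexp (Re (\<Sum>n<N. a j n * x n)))"
proof -
  obtain J :: nat and c l where l: "\<forall>j<J. l j \<in> linear_functionals" and p: "p = (\<lambda>x. \<Sum>j<J. c j * iexp (l j x))"
    using trig_span_sum [OF assms] by (elim exE conjE) (rule that)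
  have "\<forall>j. \<exists>N a. j < J \<longrightarrow> l j = (\<lambda>x. Re (\<Sum>n<N. a n * x n))"
    using l unfolding linear_functionals_def by blast
  then obtain N a where Na: "\<And>j. j < J \<Longrightarrow> l j = (\<lambda>x. Re (\<Sum>n<N j. a j n * x n))"
    by metis
  define M where "M = (\<Sum>j<J. N j)"
  define b where "b j n = (if n < N j then a j n else 0)" for j n
  have "l j x = Re (\<Sum>n<M. b j n * x n)" if "j < J" for j x
  proof -
    have "N j \<le> M" unfolding M_def using that by (intro member_le_sum) auto
    then show ?thesis unfolding Na [OF that] b_def by (rule linear_functionals_pad)
  qed
  then have "p = (\<lambda>x. \<Sum>j<J. c j * iexp (Re (\<Sum>n<M. b j n * x n)))"
    unfolding p by (intro ext sum.cong refl) simp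
  then show ?thesis by blast
qed

context stationary_gaussian_matrix
begin

lemma law_invariant: "invariant_measure law backward_shift"
  by (rule law_shift_invariant) (simp add: cov_stationary)

lemma lin_mean:
  "(LINT x|law. iexp (Re (\<Sum>n<N. a n * x n))) = complex_of_real (exp (- shifted_cov N 0 a a / 2))"
  using law_char [of "{..<N}" a "\<lambda>n. n"] by (simp add: shifted_cov_def cov_stationary del: times_complex.sel)

text \<open>The product of the two exponentials is the exponential of one functional over the
  disjoint union of the index sets, with times shifted by \<open>k\<close> on the left and a sign
  from the conjugate on the right. The mixed terms agree because the covariance is even.\<close>

lemma lin_correlation:
  "(LINT x|law. iexp (Re (\<Sum>n<N. a n * (backward_shift ^^ k) x n)) * cnj (iexp (Re (\<Sum>n<N. b n * x n)))) =
    complex_of_real (exp (- shifted_cov N 0 a a / 2) * exp (- shifted_cov N 0 b b / 2) * exp (shifted_cov N k a b))"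
proof -
  define J :: "(nat + nat) set" where "J = {..<N} <+> {..<N}"
  define c where "c j = (case j of Inl n \<Rightarrow> a n | Inr n \<Rightarrow> - b n)" for j :: "nat + nat"
  define s where "s j = (case j of Inl n \<Rightarrow> n + k | Inr n \<Rightarrow> n)" for j :: "nat + nat"
  have sumJ: "(\<Sum>j\<in>J. f j) = (\<Sum>n<N. f (Inl n)) + (\<Sum>n<N. f (Inr n))" for f :: "_ \<Rightarrow> 'z :: comm_monoid_add"
    unfolding J_def by (simp add: sum.Plus)
  have "iexp (Re (\<Sum>n<N. a n * (backward_shift ^^ k) x n)) * cnj (iexp (Re (\<Sum>n<N. b n * x n))) =
      iexp (Re (\<Sum>j\<in>J. c j * x (s j)))" for x
  proof -
    have "iexp u * cnj (iexp v) = iexp (u - v)" for u v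
      by (simp add: exp_cnj exp_add [symmetric] right_diff_distrib)
    moreover have "(\<Sum>j\<in>J. c j * x (s j)) = (\<Sum>n<N. a n * (backward_shift ^^ k) x n) - (\<Sum>n<N. b n * x n)"
      by (simp add: sumJ c_def s_def backward_shift_power sum_negf)
    ultimately show ?thesis by (simp only: minus_complex.sel)
  qed
  then have "(LINT x|law. iexp (Re (\<Sum>n<N. a n * (backward_shift ^^ k) x n)) * cnj (iexp (Re (\<Sum>n<N. b n * x n)))) =
      complex_of_real (exp (- (\<Sum>i\<in>J. \<Sum>j\<in>J. Re (c i * cnj (c j)) * cov (s i) (s j)) / 2))"
    using law_char [of J c s] by (simp add: J_def del: times_complex.sel)
  also have "(\<Sum>i\<in>J. \<Sum>j\<in>J. Re (c i * cnj (c j)) * cov (s i) (s j)) =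
      shifted_cov N 0 a a + shifted_cov N 0 b b - 2 * shifted_cov N k a b"
  proof -
    have sym: "(\<Sum>n<N. \<Sum>m<N. Re (b n * cnj (a m)) * stationary_cov (int n - (int m + int k))) = shifted_cov N k a b"
    proof -
      have "stationary_cov (int n - (int m + int k)) = stationary_cov (int m + int k - int n)" for n m
        using riesz_coeff_uminus [of "int m + int k - int n"] by (auto simp: stationary_cov_def)
      moreover have "Re (b n * cnj (a m)) = Re (a m * cnj (b n))" for n m by simp
      ultimately show ?thesis
        unfolding shifted_cov_def by (subst sum.swap) (simp only:)
    qed
    have "(\<Sum>i\<in>J. \<Sum>j\<in>J. Re (c i * cnj (c j)) * cov (s i) (s j)) =
      (\<Sum>n<N. \<Sum>m<N. Re (a n * cnj (a m)) * stationary_cov (int n - int m)) -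
      (\<Sum>n<N. \<Sum>m<N. Re (a n * cnj (b m)) * stationary_cov (int n + int k - int m)) -
      (\<Sum>n<N. \<Sum>m<N. Re (b n * cnj (a m)) * stationary_cov (int n - (int m + int k))) +
      (\<Sum>n<N. \<Sum>m<N. Re (b n * cnj (b m)) * stationary_cov (int n - int m))"
      by (simp add: sumJ c_def s_def cov_stationary sum.distrib sum_negf sum_subtractf del: times_complex.sel)
    then show ?thesis by (simp only: sym) (simp add: shifted_cov_def)
  qed
  also have "exp (- (shifted_cov N 0 a a + shifted_cov N 0 b b - 2 * shifted_cov N k a b) / 2) =
      exp (- shifted_cov N 0 a a / 2) * exp (- shifted_cov N 0 b b / 2) * exp (shifted_cov N k a b)"
    unfolding exp_add [symmetric] by (intro arg_cong [where f = exp]) (simp add: field_simps)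
  finally show ?thesis .
qed

definition correlation :: "nat \<Rightarrow> ((nat \<Rightarrow> complex) \<Rightarrow> complex) \<Rightarrow> ((nat \<Rightarrow> complex) \<Rightarrow> complex) \<Rightarrow> complex" where
  "correlation k f g = (LINT x|law. f ((backward_shift ^^ k) x) * cnj (g x))"

lemma shift_power_measurable [measurable]: "(backward_shift ^^ k) \<in> law \<rightarrow>\<^sub>M law"
proof (induction k)
  case (Suc k)
  then show ?case using law_invariant measurable_comp [of "backward_shift ^^ k" law law backward_shift law]
    by (simp add: invariant_measure_def comp_def)
qed (simp add: id_def)

lemma shift_power_preserves: "distr law law (backward_shift ^^ k) = law"
proof (induction k)
  case (Suc k)
  have T: "backward_shift \<in> law \<rightarrow>\<^sub>M law" "distr law law backward_shift = law"
    using law_invariant by (simp_all add: invariant_measure_def)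
  have "distr law law (backward_shift ^^ Suc k) = distr (distr law law (backward_shift ^^ k)) law backward_shift"
    using T by (simp add: distr_distr comp_def)
  then show ?case by (simp only: Suc T)
qed (simp add: id_def distr_id)

lemma square_integrable_shift:
  assumes f: "f \<in> square_integrable law"
  shows "(\<lambda>x. f ((backward_shift ^^ k) x)) \<in> square_integrable law"
    and "(LINT x|law. (cmod (f ((backward_shift ^^ k) x)))\<^sup>2) = (LINT x|law. (cmod (f x))\<^sup>2)"
    and "(LINT x|law. f ((backward_shift ^^ k) x)) = (LINT x|law. f x)"
proof -
  have [measurable]: "f \<in> borel_measurable law" and int: "integrable law (\<lambda>x. (cmod (f x))\<^sup>2)"
    using f by (auto simp: square_integrable_def)
  have "integrable (distr law law (backward_shift ^^ k)) (\<lambda>x. (cmod (f x))\<^sup>2)"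
    using int by (simp add: shift_power_preserves)
  then have "integrable law (\<lambda>x. (cmod (f ((backward_shift ^^ k) x)))\<^sup>2)"
    by (subst (asm) integrable_distr_eq) measurable
  then show "(\<lambda>x. f ((backward_shift ^^ k) x)) \<in> square_integrable law"
    by (simp add: square_integrable_def)
  have "(LINT x|distr law law (backward_shift ^^ k). (cmod (f x))\<^sup>2) = (LINT x|law. (cmod (f ((backward_shift ^^ k) x)))\<^sup>2)"
    by (rule integral_distr) measurable
  then show "(LINT x|law. (cmod (f ((backward_shift ^^ k) x)))\<^sup>2) = (LINT x|law. (cmod (f x))\<^sup>2)"
    by (simp add: shift_power_preserves)
  have "(LINT x|distr law law (backward_shift ^^ k). f x) = (LINT x|law. f ((backward_shift ^^ k) x))"
    by (rule integral_distr) measurable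
  then show "(LINT x|law. f ((backward_shift ^^ k) x)) = (LINT x|law. f x)"
    by (simp add: shift_power_preserves)
qed

lemma linear_exponential_measurable [measurable]:
  "(\<lambda>x. iexp (Re (\<Sum>n<N. a n * x n))) \<in> borel_measurable law"
proof -
  have "(\<lambda>x. Re (\<Sum>n<N. a n * x n)) \<in> borel_measurable law"
    using linear_functionals_measurable [OF linear_functionals_Re] by (simp cong: measurable_cong_sets)
  then show ?thesis by measurable
qed

lemma correlation_self: "correlation 0 f f = complex_of_real (LINT x|law. (cmod (f x))\<^sup>2)"
proof -
  have "correlation 0 f f = (LINT x|law. complex_of_real ((cmod (f x))\<^sup>2))"
    unfolding correlation_def by (intro Bochner_Integration.integral_cong refl) (simp only: complex_norm_square funpow_0)
  then show ?thesis by (simp only: integral_complex_of_real)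
qed

text \<open>Each coefficient absorbs the mean of its exponential. The product of the means then has
  the same double sum with every entry 1, so subtracting it leaves entries exp - 1, as in the
  contraction.\<close>

lemma trig_correlation:
  fixes c :: "nat \<Rightarrow> complex"
  assumes p: "p = (\<lambda>x. \<Sum>j<J. c j * iexp (Re (\<Sum>n<N. a j n * x n)))"
  defines "\<beta> \<equiv> \<lambda>j. c j * complex_of_real (exp (- shifted_cov N 0 (a j) (a j) / 2))"
  shows "(LINT x|law. p x) = (\<Sum>j<J. \<beta> j)"
    and "correlation k p p = (\<Sum>i<J. \<Sum>j<J. \<beta> i * cnj (\<beta> j) * complex_of_real (exp (shifted_cov N k (a i) (a j))))"
proof -
  define e where "e j x = iexp (Re (\<Sum>n<N. a j n * x n))" for j x
  have em [measurable]: "e j \<in> borel_measurable law" for j unfolding e_def by measurable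
  have ne: "cmod (e j x) = 1" for j x by (simp add: e_def)
  have p_eq: "p = (\<lambda>x. \<Sum>j<J. c j * e j x)" unfolding p e_def ..
  have int: "integrable law (e j)" for j
    by (rule law.integrable_const_bound [of _ 1]) (simp_all add: ne)
  have int2: "integrable law (\<lambda>x. e i ((backward_shift ^^ k) x) * cnj (e j x))" for i j
  proof (rule law.integrable_const_bound [of _ 1])
    show "(\<lambda>x. e i ((backward_shift ^^ k) x) * cnj (e j x)) \<in> borel_measurable law"
      by (intro borel_measurable_times measurable_compose [OF shift_power_measurable em] borel_measurable_cnj em)
  qed (simp add: ne norm_mult)
  have "(LINT x|law. p x) = (\<Sum>j<J. c j * (LINT x|law. e j x))"
    unfolding p_eq using int by (subst Bochner_Integration.integral_sum) simp_all
  also have "\<dots> = (\<Sum>j<J. \<beta> j)"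
    unfolding e_def lin_mean \<beta>_def ..
  finally show "(LINT x|law. p x) = (\<Sum>j<J. \<beta> j)" .
  have "correlation k p p = (LINT x|law. (\<Sum>i<J. \<Sum>j<J. c i * cnj (c j) * (e i ((backward_shift ^^ k) x) * cnj (e j x))))"
    unfolding correlation_def p_eq cnj_sum sum_product
    by (intro Bochner_Integration.integral_cong sum.cong refl) (simp only: complex_cnj_mult mult_ac)
  also have "\<dots> = (\<Sum>i<J. \<Sum>j<J. c i * cnj (c j) * (LINT x|law. e i ((backward_shift ^^ k) x) * cnj (e j x)))"
    using int2 by (simp add: Bochner_Integration.integral_sum Bochner_Integration.integrable_sum integrable_mult_right)
  also have "\<dots> = (\<Sum>i<J. \<Sum>j<J. \<beta> i * cnj (\<beta> j) * complex_of_real (exp (shifted_cov N k (a i) (a j))))"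
    unfolding e_def lin_correlation \<beta>_def
    by (intro sum.cong refl) (simp only: of_real_mult complex_cnj_mult complex_cnj_complex_of_real mult_ac)
  finally show "correlation k p p = (\<Sum>i<J. \<Sum>j<J. \<beta> i * cnj (\<beta> j) * complex_of_real (exp (shifted_cov N k (a i) (a j))))" .
qed

text \<open>\<open>S k\<close> is the correlation with the product of the means removed and
  \<open>S 0\<close> is the variance; the contraction halves the latter.\<close>

lemma trig_decorrelation:
  assumes "p \<in> trig_span linear_functionals"
  shows "\<exists>K. \<forall>k\<ge>K. cmod (correlation k p p) \<le> (cmod (LINT x|law. p x))\<^sup>2 + (LINT x|law. (cmod (p x))\<^sup>2) / 2"
proof -
  obtain J :: nat and N c a where p: "p = (\<lambda>x. \<Sum>j<J. c j * iexp (Re (\<Sum>n<N. a j n * x n)))"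
    using trig_span_linear_functionals [OF assms] by (elim exE) (rule that)
  define \<beta> where "\<beta> j = c j * complex_of_real (exp (- shifted_cov N 0 (a j) (a j) / 2))" for j
  note corr = trig_correlation [OF p, folded \<beta>_def]
  define S where "S k = (\<Sum>i<J. \<Sum>j<J. \<beta> i * cnj (\<beta> j) * complex_of_real (exp (shifted_cov N k (a i) (a j)) - 1))" for k
  have S: "S k = correlation k p p - complex_of_real ((cmod (LINT x|law. p x))\<^sup>2)" for k
    unfolding complex_norm_square corr S_def cnj_sum sum_product
    by (simp add: sum_subtractf right_diff_distrib)
  obtain K where K: "\<And>k. K \<le> k \<Longrightarrow> cmod (S k) \<le> 1 / 2 * Re (S 0)"
    using shifted_cov_contraction [of N a] unfolding S_def by blast
  have "cmod (correlation k p p) \<le> (cmod (LINT x|law. p x))\<^sup>2 + (LINT x|law. (cmod (p x))\<^sup>2) / 2" if "K \<le> k" for k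
  proof -
    have "cmod (correlation k p p) \<le> cmod (S k) + cmod (complex_of_real ((cmod (LINT x|law. p x))\<^sup>2))"
      using norm_triangle_ineq [of "S k" "complex_of_real ((cmod (LINT x|law. p x))\<^sup>2)"] by (simp add: S)
    moreover have "Re (S 0) = (LINT x|law. (cmod (p x))\<^sup>2) - (cmod (LINT x|law. p x))\<^sup>2"
      by (simp only: S correlation_self minus_complex.sel Re_complex_of_real)
    then have "cmod (S k) \<le> (LINT x|law. (cmod (p x))\<^sup>2) / 2"
      using K [OF that] zero_le_power2 [of "cmod (LINT x|law. p x)"] by linarith
    moreover have "cmod (complex_of_real ((cmod (LINT x|law. p x))\<^sup>2)) = (cmod (LINT x|law. p x))\<^sup>2"
      unfolding norm_of_real by simp
    ultimately show ?thesis by linarith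
  qed
  then show ?thesis by blast
qed

text \<open>Cauchy--Schwarz in the form of a weighted arithmetic mean. The free weight
  \<open>t\<close> adapts it to factors of different size.\<close>

lemma integral_mult_cnj_le:
  assumes u: "u \<in> square_integrable law" and v: "v \<in> square_integrable law" and t: "0 < t"
  shows "integrable law (\<lambda>x. u x * cnj (v x))"
    and "cmod (LINT x|law. u x * cnj (v x)) \<le> ((LINT x|law. (cmod (u x))\<^sup>2) / t + t * (LINT x|law. (cmod (v x))\<^sup>2)) / 2"
proof -
  have [measurable]: "u \<in> borel_measurable law" "v \<in> borel_measurable law"
    and int: "integrable law (\<lambda>x. (cmod (u x))\<^sup>2)" "integrable law (\<lambda>x. (cmod (v x))\<^sup>2)"
    using u v by (auto simp: square_integrable_def)
  have le: "cmod (u x * cnj (v x)) \<le> ((cmod (u x))\<^sup>2 / t + t * (cmod (v x))\<^sup>2) / 2" for x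
    using sum_squares_bound [of "cmod (u x)" "t * cmod (v x)"] t
    by (simp add: norm_mult field_simps power2_eq_square)
  have intb: "integrable law (\<lambda>x. ((cmod (u x))\<^sup>2 / t + t * (cmod (v x))\<^sup>2) / 2)" using int by simp
  show intu: "integrable law (\<lambda>x. u x * cnj (v x))"
  proof (rule Bochner_Integration.integrable_bound [OF intb])
    show "(\<lambda>x. u x * cnj (v x)) \<in> borel_measurable law" by measurable
    show "AE x in law. norm (u x * cnj (v x)) \<le> norm (((cmod (u x))\<^sup>2 / t + t * (cmod (v x))\<^sup>2) / 2)"
      unfolding real_norm_def by (intro AE_I2 order_trans [OF le abs_ge_self])
  qed
  have "cmod (LINT x|law. u x * cnj (v x)) \<le> (LINT x|law. cmod (u x * cnj (v x)))" by (rule integral_norm_bound)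
  also have "\<dots> \<le> (LINT x|law. ((cmod (u x))\<^sup>2 / t + t * (cmod (v x))\<^sup>2) / 2)"
    using le by (intro integral_mono integrable_norm intu intb)
  also have "\<dots> = ((LINT x|law. (cmod (u x))\<^sup>2) / t + t * (LINT x|law. (cmod (v x))\<^sup>2)) / 2"
    using int by simp
  finally show "cmod (LINT x|law. u x * cnj (v x)) \<le> ((LINT x|law. (cmod (u x))\<^sup>2) / t + t * (LINT x|law. (cmod (v x))\<^sup>2)) / 2" .
qed

text \<open>The difference is split by replacing one argument at a time. The first error is at most
  t; in the second \<open>p\<close> has squared norm at most 4, which with weight 1 / t gives (4 t +
  t) / 2 \<le> 3 t.\<close>

lemma correlation_approx:
  assumes f: "f \<in> square_integrable law" and p: "p \<in> square_integrable law" and t: "0 < t"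
    and f1: "(LINT x|law. (cmod (f x))\<^sup>2) = 1" and fp: "(LINT x|law. (cmod (f x - p x))\<^sup>2) \<le> t\<^sup>2" "t \<le> 1"
  shows "cmod (correlation k f f - correlation k p p) \<le> 4 * t"
proof -
  let ?T = "backward_shift ^^ k"
  have d: "(\<lambda>x. f x - p x) \<in> square_integrable law" by (rule law.square_integrable_diff [OF f p])
  note fT = square_integrable_shift [OF f] and pT = square_integrable_shift [OF p] and dT = square_integrable_shift [OF d]
  have p4: "(LINT x|law. (cmod (p x))\<^sup>2) \<le> 4"
  proof -
    have "(LINT x|law. (cmod (p x - 0))\<^sup>2) \<le> 2 * (LINT x|law. (cmod (p x - f x))\<^sup>2) + 2 * (LINT x|law. (cmod (f x - 0))\<^sup>2)"
      using p f law.square_integrableI_bounded [of "\<lambda>_. 0" 0] by (intro law.integral_sq_diff_le) simp_all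
    moreover have "t\<^sup>2 \<le> 1" using t fp(2) by (simp add: power_le_one)
    ultimately show ?thesis using fp(1) f1 by (simp add: norm_minus_commute)
  qed
  have "correlation k f f - correlation k p p =
      (LINT x|law. (f (?T x) - p (?T x)) * cnj (f x)) + (LINT x|law. p (?T x) * cnj (f x - p x))"
    using integral_mult_cnj_le(1) [OF fT(1) f, of 1] integral_mult_cnj_le(1) [OF pT(1) p, of 1]
      integral_mult_cnj_le(1) [OF pT(1) f, of 1]
    by (simp add: correlation_def left_diff_distrib right_diff_distrib)
  then have "cmod (correlation k f f - correlation k p p) \<le>
      cmod (LINT x|law. (f (?T x) - p (?T x)) * cnj (f x)) + cmod (LINT x|law. p (?T x) * cnj (f x - p x))"
    by (simp only: norm_triangle_ineq)
  moreover have "cmod (LINT x|law. (f (?T x) - p (?T x)) * cnj (f x)) \<le> t"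
  proof -
    have "(LINT x|law. (cmod (f x - p x))\<^sup>2) / t \<le> t"
      using fp(1) t by (simp add: divide_le_eq power2_eq_square)
    then show ?thesis using integral_mult_cnj_le(2) [OF dT(1) [of k] f t] unfolding dT(2) f1 by simp
  qed
  moreover have "cmod (LINT x|law. p (?T x) * cnj (f x - p x)) \<le> 3 * t"
  proof -
    have "(LINT x|law. (cmod (f x - p x))\<^sup>2) / t \<le> t"
      using fp(1) t by (simp add: divide_le_eq power2_eq_square)
    moreover have "(LINT x|law. (cmod (p x))\<^sup>2) * t \<le> 4 * t" using p4 t by simp
    moreover have "cmod (LINT x|law. p (?T x) * cnj (f x - p x)) \<le>
        ((LINT x|law. (cmod (p x))\<^sup>2) * t + (LINT x|law. (cmod (f x - p x))\<^sup>2) / t) / 2"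
      using integral_mult_cnj_le(2) [OF pT(1) [of k] d, of "1 / t"] t unfolding pT(2) by simp
    moreover have "z \<le> 3 * t" if "x \<le> t" "y \<le> 4 * t" "z \<le> (y + x) / 2" for x y z
      using that t by (simp add: field_simps)
    ultimately show ?thesis by blast
  qed
  ultimately show ?thesis by linarith
qed

lemma trig_span_dense:
  assumes f: "f \<in> square_integrable law" and e: "0 < e"
  shows "\<exists>p\<in>trig_span linear_functionals. p \<in> square_integrable law \<and> (LINT x|law. (cmod (f x - p x))\<^sup>2) < e"
proof -
  have meas: "l \<in> borel_measurable law" if "l \<in> linear_functionals" for l
    using linear_functionals_measurable [OF that] by (simp cong: measurable_cong_sets)
  have gen: "sets law \<subseteq> sigma_sets (space law) {{x \<in> space law. a < l x} |a l. l \<in> linear_functionals}"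
    using borel_wl2_generated by simp
  note approx_set = law.trig_span_approx_set [of linear_functionals, OF meas linear_functionals_add linear_functionals_zero linear_functionals_scale gen]
  interpret bounded_function_algebra law "trig_span linear_functionals" by (rule approx_set(1))
  show ?thesis using dense_L2 [OF approx_set(2) f e] T_square_integrable by blast
qed

lemma correlation_eventually_le:
  assumes f: "f \<in> square_integrable law" and mean: "(LINT x|law. f x) = 0"
    and norm: "(LINT x|law. (cmod (f x))\<^sup>2) = 1"
  shows "\<exists>K. \<forall>k\<ge>K. cmod (correlation k f f) \<le> 9 / 10"
proof -
  \<comment> \<open>With this value 4 t + t^2 + (1 + 4 t) / 2 = 0.8025: approximation error, squared
    mean of \<open>p\<close>, and half its squared norm.\<close>
  define t :: real where "t = 1 / 20"
  have t: "0 < t" "t \<le> 1" by (simp_all add: t_def)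
  obtain p where p: "p \<in> trig_span linear_functionals" "p \<in> square_integrable law"
    and fp: "(LINT x|law. (cmod (f x - p x))\<^sup>2) < t\<^sup>2"
    using trig_span_dense [OF f, of "t\<^sup>2"] t by auto
  have close: "cmod (correlation k f f - correlation k p p) \<le> 4 * t" for k
    by (rule correlation_approx [OF f p(2) t(1) norm less_imp_le [OF fp] t(2)])
  have "cmod (LINT x|law. p x) \<le> t"
  proof -
    have d: "(\<lambda>x. f x - p x) \<in> square_integrable law" by (rule law.square_integrable_diff [OF f p(2)])
    have "(LINT x|law. f x - p x) = - (LINT x|law. p x)"
      using law.square_integrable_imp_L1 [OF f] law.square_integrable_imp_L1 [OF p(2)] mean by simp
    then have "cmod (LINT x|law. p x) = cmod (LINT x|law. f x - p x)" by simp
    also have "\<dots> \<le> (LINT x|law. cmod (f x - p x))" by (rule integral_norm_bound)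
    also have "\<dots> \<le> t" using fp by (intro law.L1_le_L2 [OF d t(1)]) simp
    finally show ?thesis .
  qed
  then have mean_p: "(cmod (LINT x|law. p x))\<^sup>2 \<le> t\<^sup>2" by (rule power_mono) simp
  have norm_p: "(LINT x|law. (cmod (p x))\<^sup>2) \<le> 1 + 4 * t"
    using close [of 0] abs_Re_le_cmod [of "correlation 0 f f - correlation 0 p p"] norm
    by (simp add: correlation_self)
  obtain K where K: "\<And>k. K \<le> k \<Longrightarrow> cmod (correlation k p p) \<le> (cmod (LINT x|law. p x))\<^sup>2 + (LINT x|law. (cmod (p x))\<^sup>2) / 2"
    using trig_decorrelation [OF p(1)] by blast
  have "cmod (correlation k f f) \<le> 9 / 10" if "K \<le> k" for k
  proof -
    have "cmod (correlation k f f) \<le> cmod (correlation k f f - correlation k p p) + cmod (correlation k p p)"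
      using norm_triangle_ineq [of "correlation k f f - correlation k p p" "correlation k p p"] by simp
    moreover have "t\<^sup>2 \<le> 1 / 400" by (simp add: t_def power2_eq_square)
    ultimately show ?thesis using close [of k] K [OF that] mean_p norm_p t_def by linarith
  qed
  then show ?thesis by blast
qed

lemma koopman_power: "(koopman T ^^ n) f = (\<lambda>x. f ((T ^^ n) x))"
  by (induction n arbitrary: f) (simp_all add: koopman_def comp_def funpow_swap1)

text \<open>A negative lag is a complex conjugate, which the modulus does not notice.\<close>

lemma cmod_koopman_correlation:
  "cmod (koopman_correlation law backward_shift f n) = cmod (correlation (nat \<bar>n\<bar>) f f)"
  by (simp add: koopman_correlation_def koopman_power l2_inner_def correlation_def)

lemma law_mildly_mixing: "mildly_mixing law backward_shift"
  unfolding mildly_mixing_def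
proof (intro ballI impI, elim conjE)
  fix f assume f: "f \<in> square_integrable law" and mean: "(LINT x|law. f x) = 0" and "l2_norm law f = 1"
  moreover have "l2_inner law f f = complex_of_real (LINT x|law. (cmod (f x))\<^sup>2)"
    using correlation_self [of f] by (simp add: correlation_def l2_inner_def)
  ultimately have "(LINT x|law. (cmod (f x))\<^sup>2) = 1" by (simp add: l2_norm_def)
  then obtain K where K: "\<And>k. K \<le> k \<Longrightarrow> cmod (correlation k f f) \<le> 9 / 10"
    using correlation_eventually_le [OF f mean] by blast
  have "\<forall>\<^sub>F n in filtercomap abs at_top. ereal (cmod (koopman_correlation law backward_shift f n)) \<le> ereal (9 / 10)"
    unfolding eventually_filtercomap
  proof (intro exI [of _ "\<lambda>n. int K \<le> n"] conjI allI impI)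
    show "\<forall>\<^sub>F n in at_top. int K \<le> n" by (rule eventually_ge_at_top)
    fix n :: int assume "int K \<le> \<bar>n\<bar>"
    then have "K \<le> nat \<bar>n\<bar>" by linarith
    then show "ereal (cmod (koopman_correlation law backward_shift f n)) \<le> ereal (9 / 10)"
      using K by (simp add: cmod_koopman_correlation)
  qed
  then have "Limsup (filtercomap abs at_top) (\<lambda>n. ereal (cmod (koopman_correlation law backward_shift f n))) \<le> ereal (9 / 10)"
    by (rule Limsup_bounded)
  also have "\<dots> < 1" by simp
  finally show "Limsup (filtercomap abs at_top) (\<lambda>n. ereal (cmod (koopman_correlation law backward_shift f n))) < 1" .
qed

end

section \<open>Failure of strong mixing\<close>

text \<open>Linear functionals that are bounded uniformly in \<open>n\<close> and tend to 0 on
  indicators tend to 0 on L2. The bound has the weighted form of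
  \<open>integral_mult_cnj_le\<close>, with \<open>D\<close> in the role of the fixed
  factor.\<close>

lemma (in prob_space) square_integrable_functional_limit:
  fixes \<Phi> :: "nat \<Rightarrow> ('a \<Rightarrow> complex) \<Rightarrow> complex"
  assumes add: "\<And>n f g. f \<in> square_integrable M \<Longrightarrow> g \<in> square_integrable M \<Longrightarrow> \<Phi> n (\<lambda>x. f x + g x) = \<Phi> n f + \<Phi> n g"
    and scale: "\<And>n f c. f \<in> square_integrable M \<Longrightarrow> \<Phi> n (\<lambda>x. c * f x) = c * \<Phi> n f"
    and bound: "\<And>n f t. f \<in> square_integrable M \<Longrightarrow> 0 < t \<Longrightarrow> cmod (\<Phi> n f) \<le> (LINT x|M. (cmod (f x))\<^sup>2) / t + t * D"
    and D: "0 \<le> D"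
    and ind: "\<And>S. S \<in> sets M \<Longrightarrow> (\<lambda>n. \<Phi> n (\<lambda>x. of_bool (x \<in> S))) \<longlonglongrightarrow> 0"
    and f: "f \<in> square_integrable M"
  shows "(\<lambda>n. \<Phi> n f) \<longlonglongrightarrow> 0"
  using f
proof (induction f rule: square_integrable_induct)
  case (indicator S)
  then show ?case by (rule ind)
next
  case (add f g)
  then show ?case using tendsto_add [OF add.IH] assms(1) [OF add.hyps] by simp
next
  case (scale f c)
  then show ?case using tendsto_mult [OF tendsto_const [of c] scale.IH] assms(2) [OF scale.hyps] by simp
next
  case (limit f)
  show ?case
  proof (rule LIMSEQ_I)
    fix e :: real assume e: "0 < e"
    \<comment> \<open>The weight makes \<open>t * D\<close> at most e / 4; the approximation error
      is then chosen small relative to t.\<close>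
    define t where "t = e / (4 * (D + 1))"
    have t: "0 < t" using e D by (simp add: t_def)
    have tD: "t * D \<le> e / 4" using e D by (simp add: t_def field_simps)
    obtain g where g: "g \<in> square_integrable M" "(\<lambda>n. \<Phi> n g) \<longlonglongrightarrow> 0" "(LINT x|M. (cmod (f x - g x))\<^sup>2) < e / 4 * t"
      using limit.IH [of "e / 4 * t"] e t by auto
    have d: "(\<lambda>x. f x - g x) \<in> square_integrable M" by (rule square_integrable_diff [OF limit.hyps g(1)])
    have small: "cmod (\<Phi> n (\<lambda>x. f x - g x)) < e / 2" for n
    proof -
      have "(LINT x|M. (cmod (f x - g x))\<^sup>2) / t < e / 4" using g(3) t by (simp add: divide_less_eq)
      then show ?thesis using bound [OF d t, of n] tD by linarith
    qed
    have split: "\<Phi> n f = \<Phi> n g + \<Phi> n (\<lambda>x. f x - g x)" for n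
      using assms(1) [OF g(1) d, of n] by simp
    obtain N where N: "\<And>n. N \<le> n \<Longrightarrow> cmod (\<Phi> n g) < e / 2"
      using LIMSEQ_D [OF g(2), of "e / 2"] e by auto
    have "norm (\<Phi> n f - 0) < e" if "N \<le> n" for n
      using norm_triangle_ineq [of "\<Phi> n g" "\<Phi> n (\<lambda>x. f x - g x)"] N [OF that] small [of n] by (simp add: split)
    then show "\<exists>N. \<forall>n\<ge>N. norm (\<Phi> n f - 0) < e" by blast
  qed
qed

context stationary_gaussian_matrix
begin

lemma mean_sq_le:
  assumes f: "f \<in> square_integrable law"
  shows "(cmod (LINT x|law. f x))\<^sup>2 \<le> (LINT x|law. (cmod (f x))\<^sup>2)"
proof (cases "(LINT x|law. f x) = 0")
  case False
  define m where "m = cmod (LINT x|law. f x)"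
  have m: "0 < m" using False by (simp add: m_def)
  have "(\<lambda>_. 1) \<in> square_integrable law" by (rule law.square_integrableI_bounded [of _ 1]) simp_all
  then have "m \<le> ((LINT x|law. (cmod (f x))\<^sup>2) / m + m) / 2"
    using integral_mult_cnj_le(2) [OF f _ m, of "\<lambda>_. 1"] by (simp add: m_def)
  then have "m * m \<le> (LINT x|law. (cmod (f x))\<^sup>2)" using m by (simp add: field_simps)
  then show ?thesis by (simp add: m_def power2_eq_square)
qed simp

definition defect :: "nat \<Rightarrow> ((nat \<Rightarrow> complex) \<Rightarrow> complex) \<Rightarrow> ((nat \<Rightarrow> complex) \<Rightarrow> complex) \<Rightarrow> complex" where
  "defect n f h = correlation n f h - (LINT x|law. f x) * cnj (LINT x|law. h x)"

lemma defect_bound: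
  assumes f: "f \<in> square_integrable law" and h: "h \<in> square_integrable law" and t: "0 < t"
  shows "cmod (defect n f h) \<le> (LINT x|law. (cmod (f x))\<^sup>2) / t + t * (LINT x|law. (cmod (h x))\<^sup>2)"
proof -
  let ?F = "LINT x|law. (cmod (f x))\<^sup>2" and ?H = "LINT x|law. (cmod (h x))\<^sup>2"
  let ?m = "cmod (LINT x|law. f x)" and ?k = "cmod (LINT x|law. h x)"
  have "cmod (correlation n f h) \<le> (?F / t + t * ?H) / 2"
    using integral_mult_cnj_le(2) [OF square_integrable_shift(1) [OF f] h t, of n]
    unfolding correlation_def square_integrable_shift(2) [OF f] .
  moreover have "?m * ?k \<le> (?F / t + t * ?H) / 2"
  proof -
    have "?m * ?k \<le> (?m\<^sup>2 / t + t * ?k\<^sup>2) / 2"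
      using sum_squares_bound [of ?m "t * ?k"] t by (simp add: field_simps power2_eq_square)
    also have "\<dots> \<le> (?F / t + t * ?H) / 2"
      using mean_sq_le [OF f] mean_sq_le [OF h] t
      by (intro divide_right_mono add_mono mult_left_mono) simp_all
    finally show ?thesis .
  qed
  moreover have "cmod (defect n f h) \<le> cmod (correlation n f h) + ?m * ?k"
    unfolding defect_def using norm_triangle_ineq4 [of "correlation n f h" "(LINT x|law. f x) * cnj (LINT x|law. h x)"]
    by (simp add: norm_mult)
  moreover have "z \<le> s" if "x \<le> s / 2" "y \<le> s / 2" "z \<le> x + y" for x y z s :: real
    using that by linarith
  ultimately show ?thesis by blast
qed

lemma correlation_linear:
  assumes f: "f \<in> square_integrable law" and g: "g \<in> square_integrable law" and h: "h \<in> square_integrable law"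
  shows "correlation n (\<lambda>x. f x + g x) h = correlation n f h + correlation n g h"
    and "correlation n h (\<lambda>x. f x + g x) = correlation n h f + correlation n h g"
    and "correlation n (\<lambda>x. c * f x) h = c * correlation n f h"
    and "correlation n h (\<lambda>x. c * f x) = cnj c * correlation n h f"
proof -
  note fT = square_integrable_shift(1) [OF f, of n] and gT = square_integrable_shift(1) [OF g, of n]
    and hT = square_integrable_shift(1) [OF h, of n]
  show "correlation n (\<lambda>x. f x + g x) h = correlation n f h + correlation n g h"
    using integral_mult_cnj_le(1) [OF fT h, of 1] integral_mult_cnj_le(1) [OF gT h, of 1]
    by (simp add: correlation_def distrib_right)
  show "correlation n h (\<lambda>x. f x + g x) = correlation n h f + correlation n h g"
    using integral_mult_cnj_le(1) [OF hT f, of 1] integral_mult_cnj_le(1) [OF hT g, of 1]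
    by (simp add: correlation_def distrib_left)
  show "correlation n (\<lambda>x. c * f x) h = c * correlation n f h"
    by (simp add: correlation_def mult.assoc)
  show "correlation n h (\<lambda>x. c * f x) = cnj c * correlation n h f"
    by (simp add: correlation_def mult.left_commute)
qed

lemma law_integral_of_bool:
  assumes "S \<in> sets law"
  shows "(LINT x|law. of_bool (x \<in> S) :: complex) = complex_of_real (law.prob S)"
proof -
  have "(LINT x|law. of_bool (x \<in> S) :: complex) = (LINT x|law. complex_of_real (indicator S x))"
    by (intro Bochner_Integration.integral_cong refl) (simp add: indicator_def)
  also have "\<dots> = complex_of_real (LINT x|law. indicator S x)"
    by (rule integral_complex_of_real)
  finally show ?thesis using assms sets.sets_into_space [OF assms] by (simp add: Int_absorb2)
qed

text \<open>Strong mixing speaks of sets while the counterexample is an exponential, so the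
  convergence is extended from indicators to L2 in each argument separately.\<close>

lemma defect_tendsto_0:
  assumes mixing: "strongly_mixing law backward_shift"
    and f: "f \<in> square_integrable law" and h: "h \<in> square_integrable law"
  shows "(\<lambda>n. defect n f h) \<longlonglongrightarrow> 0"
proof -
  have ind: "(\<lambda>x. of_bool (x \<in> S)) \<in> square_integrable law" if "S \<in> sets law" for S
    using that by (intro law.square_integrableI_bounded [of _ 1]) auto
  have sets: "(\<lambda>n. defect n (\<lambda>x. of_bool (x \<in> A)) (\<lambda>x. of_bool (x \<in> B))) \<longlonglongrightarrow> 0"
    if A: "A \<in> sets law" and B: "B \<in> sets law" for A B
  proof -
    have "defect n (\<lambda>x. of_bool (x \<in> A)) (\<lambda>x. of_bool (x \<in> B)) =
        complex_of_real (law.prob (((backward_shift ^^ n) -` A \<inter> space law) \<inter> B) - law.prob A * law.prob B)" for n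
    proof -
      have S: "((backward_shift ^^ n) -` A \<inter> space law) \<inter> B \<in> sets law"
        using A B shift_power_measurable [of n] by measurable
      have "correlation n (\<lambda>x. of_bool (x \<in> A)) (\<lambda>x. of_bool (x \<in> B)) =
          (LINT x|law. of_bool (x \<in> ((backward_shift ^^ n) -` A \<inter> space law) \<inter> B))"
        unfolding correlation_def by (intro Bochner_Integration.integral_cong refl) auto
      then show ?thesis
        by (simp only: defect_def law_integral_of_bool [OF S] law_integral_of_bool [OF A] law_integral_of_bool [OF B]
            complex_cnj_complex_of_real of_real_diff of_real_mult)
    qed
    moreover have "(\<lambda>n. law.prob (((backward_shift ^^ n) -` A \<inter> space law) \<inter> B) - law.prob A * law.prob B) \<longlonglongrightarrow> 0"
      using mixing A B unfolding strongly_mixing_def by (intro LIM_zero) blast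
    ultimately show ?thesis using tendsto_of_real [where 'a = complex] by fastforce
  qed
  have fB: "(\<lambda>n. defect n f (\<lambda>x. of_bool (x \<in> B))) \<longlonglongrightarrow> 0" if B: "B \<in> sets law" for B
  proof (rule law.square_integrable_functional_limit [where \<Phi> = "\<lambda>n u. defect n u (\<lambda>x. of_bool (x \<in> B))" and D = "LINT x|law. (cmod (of_bool (x \<in> B)))\<^sup>2"])
    show "defect n (\<lambda>x. u x + v x) (\<lambda>x. of_bool (x \<in> B)) = defect n u (\<lambda>x. of_bool (x \<in> B)) + defect n v (\<lambda>x. of_bool (x \<in> B))"
      if "u \<in> square_integrable law" "v \<in> square_integrable law" for n u v
      using correlation_linear(1) [OF that ind [OF B]] that [THEN law.square_integrable_imp_L1]
      by (simp add: defect_def algebra_simps)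
    show "defect n (\<lambda>x. c * u x) (\<lambda>x. of_bool (x \<in> B)) = c * defect n u (\<lambda>x. of_bool (x \<in> B))"
      if "u \<in> square_integrable law" for n u c
      using correlation_linear(3) [OF that that ind [OF B]] by (simp add: defect_def algebra_simps)
    show "0 \<le> (LINT x|law. (cmod (of_bool (x \<in> B)))\<^sup>2)" by simp
    show "cmod (defect n u (\<lambda>x. of_bool (x \<in> B))) \<le>
        (LINT x|law. (cmod (u x))\<^sup>2) / t + t * (LINT x|law. (cmod (of_bool (x \<in> B)))\<^sup>2)"
      if "u \<in> square_integrable law" "0 < t" for n u t
      by (rule defect_bound [OF that(1) ind [OF B] that(2)])
    show "(\<lambda>n. defect n (\<lambda>x. of_bool (x \<in> S)) (\<lambda>x. of_bool (x \<in> B))) \<longlonglongrightarrow> 0" if "S \<in> sets law" for S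
      by (rule sets [OF that B])
    show "f \<in> square_integrable law" by (rule f)
  qed
  \<comment> \<open>The defect is antilinear in its second argument; conjugation restores the
    linearity required above.\<close>
  have "(\<lambda>n. cnj (defect n f h)) \<longlonglongrightarrow> 0"
  proof (rule law.square_integrable_functional_limit [where \<Phi> = "\<lambda>n h. cnj (defect n f h)" and D = "LINT x|law. (cmod (f x))\<^sup>2"])
    show "cnj (defect n f (\<lambda>x. u x + v x)) = cnj (defect n f u) + cnj (defect n f v)"
      if "u \<in> square_integrable law" "v \<in> square_integrable law" for n u v
      using correlation_linear(2) [OF that f] that [THEN law.square_integrable_imp_L1]
      by (simp add: defect_def algebra_simps)
    show "cnj (defect n f (\<lambda>x. c * u x)) = c * cnj (defect n f u)" if "u \<in> square_integrable law" for n u c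
      using correlation_linear(4) [OF that that f] by (simp add: defect_def algebra_simps)
    \<comment> \<open>The weight 1 / t moves the division to the second argument.\<close>
    show "cmod (cnj (defect n f u)) \<le> (LINT x|law. (cmod (u x))\<^sup>2) / t + t * (LINT x|law. (cmod (f x))\<^sup>2)"
      if "u \<in> square_integrable law" "0 < t" for n u t
      using defect_bound [OF f that(1), of "1 / t" n] that(2) by (simp add: algebra_simps)
    show "(\<lambda>n. cnj (defect n f (\<lambda>x. of_bool (x \<in> S)))) \<longlonglongrightarrow> 0" if "S \<in> sets law" for S
      using tendsto_cnj [OF fB [OF that]] by simp
  qed (use h in simp_all)
  then show ?thesis using tendsto_cnj by fastforce
qed

text \<open>For the exponential of \<open>Re (x 0)\<close>, of variance 2, the lags
  \<open>4 ^ k\<close> all give covariance 1/2, so the defect is one positive constant along this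
  subsequence.\<close>

lemma law_not_strongly_mixing: "\<not> strongly_mixing law backward_shift"
proof
  assume mixing: "strongly_mixing law backward_shift"
  define e where "e x = iexp (Re (\<Sum>n<1. 1 * x n))" for x :: "nat \<Rightarrow> complex"
  have e: "e \<in> square_integrable law"
    using linear_exponential_measurable [of "\<lambda>_. 1" 1]
    by (intro law.square_integrableI_bounded [of _ 1]) (simp_all add: e_def [abs_def])
  have defect: "defect (4 ^ k) e e = complex_of_real (exp (- 2) * (exp (1 / 2) - 1))" for k
  proof -
    have V: "shifted_cov 1 0 (\<lambda>_. 1) (\<lambda>_. 1) = 2" "shifted_cov 1 (4 ^ k) (\<lambda>_. 1) (\<lambda>_. 1) = 1 / 2"
      by (simp_all add: shifted_cov_def stationary_cov_def riesz_coeff_power)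
    have "correlation (4 ^ k) e e = complex_of_real (exp (- 1) * exp (- 1) * exp (1 / 2))"
      unfolding correlation_def e_def lin_correlation V by simp
    moreover have "(LINT x|law. e x) = complex_of_real (exp (- 1))"
      unfolding e_def lin_mean V by simp
    ultimately have "defect (4 ^ k) e e = complex_of_real (exp (- 1) * exp (- 1) * exp (1 / 2) - exp (- 1) * exp (- 1))"
      by (simp only: defect_def of_real_mult of_real_diff complex_cnj_complex_of_real)
    also have "exp (- 1) * exp (- 1) * exp (1 / 2) - exp (- 1) * exp (- 1) = exp (- 2) * (exp (1 / 2) - (1::real))"
      by (simp add: exp_add [symmetric] right_diff_distrib)
    finally show ?thesis .
  qed
  have "strict_mono (\<lambda>k. 4 ^ k :: nat)" by (simp add: strict_mono_def)
  then have "(\<lambda>k. defect (4 ^ k) e e) \<longlonglongrightarrow> 0"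
    using LIMSEQ_subseq_LIMSEQ [OF defect_tendsto_0 [OF mixing e e]] by (fastforce simp: comp_def)
  then have "complex_of_real (exp (- 2) * (exp (1 / 2) - 1)) = 0"
    unfolding defect by (simp add: tendsto_const_iff)
  then show False by simp
qed

end

theorem corollary1p11:
  shows "\<exists>(X :: (nat \<Rightarrow> complex) complex_space) T \<mu>.
     complex_hilbert_space X \<and> separable_space (norm_topology X) \<and> infinite_dimensional X \<and>
     T \<in> bounded_operators X \<and>
     gaussian_measure X \<mu> \<and> invariant_measure \<mu> T \<and> full_support X \<mu> \<and>
     mildly_mixing \<mu> T \<and> \<not> strongly_mixing \<mu> T"
proof -
  obtain A w C where "stationary_gaussian_matrix A w C"
    using stationary_gaussian_matrix_exists by blast
  then interpret stationary_gaussian_matrix A w C .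
  show ?thesis
    using wl2_hilbert wl2_separable wl2_infinite_dimensional backward_shift_bounded law_gaussian
      law_invariant full_support_law [OF unit_column] law_mildly_mixing law_not_strongly_mixing
    by blast
qed

end
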